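(* The cylinder $S^1(\sqrt2)\times\mathbb{R}^{n-1}\subset\mathbb{C}^n$ (where $S^1(\sqrt2)\subset\mathbb{C}$ is the circle of radius $\sqrt2$ centered at the origin and $\mathbb{R}^{n-1}\subset\mathbb{C}^{n-1}$ is the real subspace) is a Lagrangian self-shrinker which is Lagrangian F-stable, and hence also Hamiltonian F-stable.
   Context: A self-shrinker is a submanifold $\Sigma^n\subset\mathbb{R}^{n+p}$ with $H=-\frac12x^\perp$ ($H=\mathrm{tr}A$, $A(X,Y)=(\bar\nabla_XY)^\perp$). For $x_0\in\mathbb{R}^{2n}$, $t_0>0$, $F_{x_0,t_0}(\Sigma)=(4\pi t_0)^{-n/2}\int_\Sigma e^{-|x-x_0|^2/(4t_0)}d\mu$. On a Lagrangian submanifold $\Sigma$ of $(\mathbb{C}^n,\bar\omega)$, a variation field $V$ is Lagrangian (resp. Hamiltonian) if the 1-form $i^*(V\lrcorner\bar\omega)$ on $\Sigma$ is closed (resp. exact). A Lagrangian self-shrinker $\Sigma$ is Lagrangian (resp. Hamiltonian) F-stable if for every compactly supported variation $\Sigma_s$, $\Sigma_0=\Sigma$, with Lagrangian (resp. Hamiltonian) variation field, there exist variations $x_s$ of $x_0=0$ and $t_s$ of $t_0=1$ such that $\partial_s^2|_{s=0}F_{x_s,t_s}(\Sigma_s)\ge0$. *)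

theory Defs
  imports "HOL-Analysis.Analysis"
begin

fun iter_dderiv :: "'a::real_normed_vector list \<Rightarrow> ('a \<Rightarrow> 'b::real_normed_vector) \<Rightarrow> 'a \<Rightarrow> 'b" where
  "iter_dderiv [] f = f"
| "iter_dderiv (v # vs) f = (\<lambda>x. frechet_derivative (iter_dderiv vs f) (at x) v)"

definition smooth :: "('a::real_normed_vector \<Rightarrow> 'b::real_normed_vector) \<Rightarrow> bool" where
  "smooth f \<longleftrightarrow> (\<forall>vs x. iter_dderiv vs f differentiable (at x))"

definition pd :: "'n::finite \<Rightarrow> (real^'n \<Rightarrow> 'b::real_normed_vector) \<Rightarrow> real^'n \<Rightarrow> 'b" where
  "pd j f p = frechet_derivative f (at p) (axis j 1)"

definition omega :: "complex^'n::finite \<Rightarrow> complex^'n \<Rightarrow> real" where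
  "omega u v = (\<Sum>j\<in>UNIV. Re (u$j) * Im (v$j) - Im (u$j) * Re (v$j))"

definition metric :: "(real^'n::finite \<Rightarrow> complex^'n) \<Rightarrow> real^'n \<Rightarrow> real^'n^'n" where
  "metric F p = (\<chi> i j. pd i F p \<bullet> pd j F p)"

definition area_density :: "(real^'n::finite \<Rightarrow> complex^'n) \<Rightarrow> real^'n \<Rightarrow> real" where
  "area_density F p = sqrt (det (metric F p))"

definition normal_part :: "(real^'n::finite \<Rightarrow> complex^'n) \<Rightarrow> real^'n \<Rightarrow> complex^'n \<Rightarrow> complex^'n" where
  "normal_part F p v = v - (\<Sum>i\<in>UNIV. \<Sum>j\<in>UNIV.
      (matrix_inv (metric F p) $ i $ j * (v \<bullet> pd i F p)) *\<^sub>R pd j F p)"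

definition mean_curv :: "(real^'n::finite \<Rightarrow> complex^'n) \<Rightarrow> real^'n \<Rightarrow> complex^'n" where
  "mean_curv F p = (\<Sum>i\<in>UNIV. \<Sum>j\<in>UNIV.
      matrix_inv (metric F p) $ i $ j *\<^sub>R normal_part F p (pd i (pd j F) p))"

definition immersion :: "(real^'n::finite \<Rightarrow> complex^'n) \<Rightarrow> bool" where
  "immersion F \<longleftrightarrow> smooth F \<and> (\<forall>p. det (metric F p) \<noteq> 0)"

definition lagrangian :: "(real^'n::finite \<Rightarrow> complex^'n) \<Rightarrow> bool" where
  "lagrangian F \<longleftrightarrow> immersion F \<and> (\<forall>p i j. omega (pd i F p) (pd j F p) = 0)"

definition self_shrinker :: "(real^'n::finite \<Rightarrow> complex^'n) \<Rightarrow> bool" where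
  "self_shrinker F \<longleftrightarrow> immersion F \<and> (\<forall>p. mean_curv F p = - (1/2) *\<^sub>R normal_part F p (F p))"

definition cyl :: "'n::finite \<Rightarrow> real^'n \<Rightarrow> complex^'n" where
  "cyl i0 p = (\<chi> j. if j = i0 then complex_of_real (sqrt 2) * cis (p$i0) else complex_of_real (p$j))"

definition fund_dom :: "'n::finite \<Rightarrow> (real^'n) set" where
  "fund_dom i0 = {p. 0 \<le> p$i0 \<and> p$i0 < 2*pi}"

definition periodic_in :: "'n::finite \<Rightarrow> (real^'n \<Rightarrow> 'b) \<Rightarrow> bool" where
  "periodic_in i0 f \<longleftrightarrow> (\<forall>p. f (p + (2*pi) *\<^sub>R axis i0 1) = f p)"

definition Ffun :: "'n::finite \<Rightarrow> complex^'n \<Rightarrow> real \<Rightarrow> (real^'n \<Rightarrow> complex^'n) \<Rightarrow> real" where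
  "Ffun i0 x0 t0 G = (4*pi*t0) powr (- real CARD('n) / 2) *
      integral (fund_dom i0) (\<lambda>p. exp (- (norm (G p - x0))\<^sup>2 / (4*t0)) * area_density G p)"

definition cyl_variation :: "'n::finite \<Rightarrow> (real \<Rightarrow> real^'n \<Rightarrow> complex^'n) \<Rightarrow> bool" where
  "cyl_variation i0 Fv \<longleftrightarrow>
     smooth (\<lambda>(s,p). Fv s p) \<and> Fv 0 = cyl i0 \<and>
     (\<forall>s. periodic_in i0 (Fv s)) \<and>
     (\<exists>B. \<forall>s p. (\<exists>j. j \<noteq> i0 \<and> \<bar>p$j\<bar> > B) \<longrightarrow> Fv s p = cyl i0 p)"

text \<open>Variation field V and the 1-form alpha = i^*(V \<lrcorner> omega), components alpha_j.\<close>
definition var_field :: "(real \<Rightarrow> real^'n::finite \<Rightarrow> complex^'n) \<Rightarrow> real^'n \<Rightarrow> complex^'n" where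
  "var_field Fv p = frechet_derivative (\<lambda>(s,q). Fv s q) (at (0,p)) (1,0)"

definition var_form :: "'n::finite \<Rightarrow> (real \<Rightarrow> real^'n \<Rightarrow> complex^'n) \<Rightarrow> 'n \<Rightarrow> real^'n \<Rightarrow> real" where
  "var_form i0 Fv j p = omega (var_field Fv p) (pd j (cyl i0) p)"

definition lagrangian_variation :: "'n::finite \<Rightarrow> (real \<Rightarrow> real^'n \<Rightarrow> complex^'n) \<Rightarrow> bool" where
  "lagrangian_variation i0 Fv \<longleftrightarrow>
     (\<forall>i j p. pd i (var_form i0 Fv j) p = pd j (var_form i0 Fv i) p)"

definition hamiltonian_variation :: "'n::finite \<Rightarrow> (real \<Rightarrow> real^'n \<Rightarrow> complex^'n) \<Rightarrow> bool" where
  "hamiltonian_variation i0 Fv \<longleftrightarrow>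
     (\<exists>f :: real^'n \<Rightarrow> real. smooth f \<and> periodic_in i0 f \<and>
        (\<forall>j p. pd j f p = var_form i0 Fv j p))"

definition F_stable_wrt :: "'n::finite \<Rightarrow> ((real \<Rightarrow> real^'n \<Rightarrow> complex^'n) \<Rightarrow> bool) \<Rightarrow> bool" where
  "F_stable_wrt i0 P \<longleftrightarrow>
     (\<forall>Fv. cyl_variation i0 Fv \<and> P Fv \<longrightarrow>
        (\<exists>(xs :: real \<Rightarrow> complex^'n) (ts :: real \<Rightarrow> real) D1 D2.
            smooth xs \<and> smooth ts \<and> xs 0 = 0 \<and> ts 0 = 1 \<and>
            (\<forall>\<^sub>F s in nhds 0. ((\<lambda>r. Ffun i0 (xs r) (ts r) (Fv r)) has_real_derivative D1 s) (at s)) \<and>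
            (D1 has_real_derivative D2) (at 0) \<and> D2 \<ge> 0))"

definition lagrangian_F_stable :: "'n::finite \<Rightarrow> bool" where
  "lagrangian_F_stable i0 \<longleftrightarrow> F_stable_wrt i0 (lagrangian_variation i0)"

definition hamiltonian_F_stable :: "'n::finite \<Rightarrow> bool" where
  "hamiltonian_F_stable i0 \<longleftrightarrow> F_stable_wrt i0 (hamiltonian_variation i0)"

end

theory Submission
  imports Defs "HOL-Probability.Probability"
begin

text \<open>
  Identify the cylinder with its parameter space and split a variation field \<open>V\<close> into its tangential
  components \<open>T\<close> and normal components \<open>N\<close> in the product frame, \<open>u\<close> being the radial normal
  component. Writing the integrand of \<open>F\<close> as \<open>exp E\<close>, one has \<open>F'' = \<integral> (E'' + E'\<^sup>2) exp E\<close> at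
  \<open>s = 0\<close>. Since the cylinder is critical, integration by parts against the weight \<open>exp (- |y|\<^sup>2 / 4)\<close>
  removes the acceleration and all tangential terms. What remains is
  \<open>|\<nabla>u|\<^sup>2 - u\<^sup>2\<close> plus \<open>|\<nabla>N\<^sub>j|\<^sup>2 - N\<^sub>j\<^sup>2 / 2\<close> for the flat normal directions, together with terms
  linear and quadratic in the velocities of \<open>x\<^sub>s\<close> and \<open>t\<^sub>s\<close>.

  The Gaussian and circular Poincare inequalities both have constant 2 in the normalised frame, so
  \<open>N\<^sub>j\<close> is harmless once its mean is absorbed by a translation. For \<open>u\<close> the dangerous modes are the
  constant one and the first Fourier modes in the angle. The first Fourier modes are absorbed by
  translating in the plane of the circle. Closedness of the 1-form of \<open>V\<close> makes the angular mean of
  \<open>u\<close> constant along the flat factor, hence zero if \<open>n \<ge> 2\<close> by compact support; if \<open>n = 1\<close> it is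
  absorbed by the velocity of \<open>t\<^sub>s\<close>.
\<close>

section \<open>One-dimensional inequalities\<close>

text \<open>The estimate for \<open>u\<close> has no slack. On the circle of radius sqrt 2 the m-th
  Fourier mode has eigenvalue m^2 / 2, and on the Gaussian factor a Hermite polynomial of degree d
  has eigenvalue d / 2, so a mode of \<open>u\<close> contributes m^2 / 2 + d / 2 - 1. Only (m, d) =
  (0, 0), (1, 0) and (0, 1) are negative. The last kind, linear in a flat coordinate, is matched
  neither by a translation nor by a change of scale; it is excluded by closedness alone, and for
  this the angular mean must vanish over every point of the flat factor and not merely in total. The
  velocities of x_s and t_s maximise the concave quadratic expression in which they enter and cancel
  the remaining deficits exactly.

  The other obstacle is that F is differentiated twice under an integral over a noncompact cylinder.
  Translations along the real flat directions and changes of scale would put unbounded functions of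
  y into the exponent. Hence x_s moves only in the plane of the circle and in the imaginary flat
  directions, and t_s moves only if there is no flat factor.\<close>

lemma tendsto_square_over_simple_zero:
  fixes g s :: "real \<Rightarrow> real"
  assumes g: "(g has_real_derivative g') (at a)" "g a = 0"
    and s: "(s has_real_derivative s') (at a)" "s a = 0" "s' \<noteq> 0"
  shows "((\<lambda>x. (g x)\<^sup>2 / s x) \<longlongrightarrow> 0) (at a)"
proof -
  have 1: "((\<lambda>x. g x / (x - a)) \<longlongrightarrow> g') (at a)" "((\<lambda>x. s x / (x - a)) \<longlongrightarrow> s') (at a)"
    using g s by (simp_all add: has_field_derivative_iff)
  \<comment> \<open>Both functions are replaced by their difference quotients; one factor
    \<open>x - a\<close> survives and forces the limit 0. This is what makes primitives containing
    \<open>g\<close> squared times a cotangent, or over \<open>x\<close>, continuous at their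
    apparent poles.\<close>
  have "((\<lambda>x. (g x / (x - a))\<^sup>2 * (x - a) / (s x / (x - a))) \<longlongrightarrow> g'\<^sup>2 * (a - a) / s') (at a)"
    by (intro tendsto_intros 1 s)
  moreover have "\<forall>\<^sub>F x in at a. (g x / (x - a))\<^sup>2 * (x - a) / (s x / (x - a)) = (g x)\<^sup>2 / s x"
    unfolding eventually_at_filter
    by (rule always_eventually) (auto simp: power2_eq_square)
  ultimately show ?thesis
    using Lim_transform_eventually by force
qed

text \<open>
  If \<open>f a = f (a + \<pi> / m)\<close>, then \<open>g = f - f a\<close> vanishes at all zeros of \<open>sin (m (x - a))\<close>, and
  \<open>g'\<^sup>2 - m\<^sup>2 g\<^sup>2\<close> is \<open>(g' - m g cot)\<^sup>2\<close> plus the derivative of \<open>m g\<^sup>2 cot\<close>.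
\<close>

lemma wirtinger_inequality:
  fixes f :: "real \<Rightarrow> real" and m :: nat
  assumes m: "m > 0" and per: "\<And>x. f (x + 2 * pi / m) = f x"
    and der: "\<And>x. (f has_real_derivative f' x) (at x)"
    and int: "(\<lambda>x. (f' x)\<^sup>2) integrable_on {0..2 * pi}"
  shows "\<exists>c. (real m)\<^sup>2 * integral {0..2 * pi} (\<lambda>x. (f x - c)\<^sup>2) \<le> integral {0..2 * pi} (\<lambda>x. (f' x)\<^sup>2)"
proof -
  define k where "k = real m"
  have k: "k > 0" using m by (simp add: k_def)
  have contf: "continuous_on A f" for A
    by (meson DERIV_continuous_on der has_field_derivative_at_within)
  \<comment> \<open>\<open>d\<close> changes sign between 0 and \<open>pi / k\<close> because
    \<open>f\<close> has period \<open>2 * pi / k\<close>, so the intermediate value theorem yields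
    a base point \<open>a\<close> with \<open>f (a + pi / k) = f a\<close>.\<close>
  define d where "d = (\<lambda>x. f (x + pi / k) - f x)"
  have contd: "continuous_on {0..pi/k} d"
    unfolding d_def by (intro continuous_intros continuous_on_compose2[OF contf[of UNIV]]) auto
  have dd: "d (pi / k) = - d 0"
    unfolding d_def using per[of 0] by (simp add: k_def add_divide_distrib[symmetric])
  have pk: "0 \<le> pi / k" using k by simp
  have "\<exists>x. 0 \<le> x \<and> x \<le> pi / k \<and> d x = 0"
  proof (cases "d 0 \<le> 0")
    case True
    then show ?thesis using IVT'[of d 0 0 "pi/k"] dd pk contd by auto
  next
    case False
    then show ?thesis using IVT2'[of d "pi/k" 0 0] dd pk contd by auto
  qed
  then obtain a where a: "f (a + pi / k) = f a"
    unfolding d_def by auto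
  have perint: "f (x + of_int i * (2 * pi / k)) = f x" for x and i :: int
  proof (induction i rule: int_induct[where k = 0])
    case (step1 i)
    then show ?case using per[of "x + of_int i * (2 * pi / k)"] by (simp add: k_def algebra_simps add_divide_distrib diff_divide_distrib)
  next
    case (step2 i)
    then show ?case using per[of "x + of_int (i - 1) * (2 * pi / k)"] by (simp add: k_def algebra_simps add_divide_distrib diff_divide_distrib)
  qed simp
  have feq: "f (a + of_int i * pi / k) = f a" for i :: int
  proof (cases "even i")
    case True
    then obtain j where "i = 2 * j" by blast
    then show ?thesis using perint[of a j] by (simp add: algebra_simps)
  next
    case False
    then obtain j where "i = 2 * j + 1" by (rule oddE)
    then have "a + of_int i * pi / k = (a + pi / k) + of_int j * (2 * pi / k)"
      by (simp add: algebra_simps add_divide_distrib)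
    then show ?thesis using perint[of "a + pi / k" j] a by metis
  qed
  define g where "g = (\<lambda>x. f x - f a)"
  define S where "S = (\<lambda>i::int. a + of_int i * pi / k) ` {\<lceil>- k * a / pi\<rceil>..\<lfloor>k * (2 * pi - a) / pi\<rfloor>}"
  have derg: "(g has_real_derivative f' x) (at x)" for x
    unfolding g_def by (auto intro!: derivative_eq_intros der)
  have gS: "g x = 0" if "x \<in> S" for x
    using that feq unfolding S_def g_def by auto
  have zeros: "x \<in> S" if xin: "x \<in> {0..2 * pi}" and sin0: "sin (k * (x - a)) = 0" for x
  proof -
    obtain i :: int where i: "k * (x - a) = of_int i * pi"
      using sin0 by (metis sin_zero_iff_int2)
    have x: "x = a + of_int i * pi / k" using i k by (simp add: field_simps)
    have i': "of_int i = k * (x - a) / pi" using i by simp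
    have "- k * a / pi \<le> of_int i" "of_int i \<le> k * (2 * pi - a) / pi"
      unfolding i' by (rule divide_right_mono; use xin k in \<open>simp add: algebra_simps\<close>)+
    then show ?thesis
      unfolding S_def x by (intro imageI) (simp add: ceiling_le_iff le_floor_iff)
  qed
  \<comment> \<open>At a zero of the sine in the interval \<open>g\<close> vanishes as well, and the
    convention \<open>0 / 0 = 0\<close> gives \<open>h\<close> the value 0, which is its limit
    there. So \<open>h\<close> is continuous across the exceptional set \<open>S\<close>.\<close>
  define h where "h = (\<lambda>x. k * cos (k * (x - a)) * ((g x)\<^sup>2 / sin (k * (x - a))))"
  define h' where "h' = (\<lambda>x. 2 * k * g x * f' x * cot (k * (x - a)) - k\<^sup>2 * (g x)\<^sup>2 * (1 + (cot (k * (x - a)))\<^sup>2))"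
  have "(h' has_integral (h (2 * pi) - h 0)) {0..2 * pi}"
  proof (rule fundamental_theorem_of_calculus_strong[where S = S])
    fix x assume x: "x \<in> {0..2 * pi} - S"
    then have s: "sin (k * (x - a)) \<noteq> 0" using zeros by blast
    have d1: "((\<lambda>x. k * cos (k * (x - a))) has_real_derivative - (k * k * sin (k * (x - a)))) (at x)"
      and d2: "((\<lambda>x. (g x)\<^sup>2) has_real_derivative 2 * g x * f' x) (at x)"
      and d3: "((\<lambda>x. sin (k * (x - a))) has_real_derivative k * cos (k * (x - a))) (at x)"
      by (auto intro!: derivative_eq_intros derg)
    have alg: "- (k * k * S) * (G\<^sup>2 / S) + (2 * G * F * S - G\<^sup>2 * (k * C)) / (S * S) * (k * C)
        = 2 * k * G * F * (C / S) - k\<^sup>2 * G\<^sup>2 * (1 + (C / S)\<^sup>2)" if "S \<noteq> 0" for S G F C :: real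
      using that by (simp add: field_simps power2_eq_square)
    have "(h has_real_derivative h' x) (at x)"
      using DERIV_mult[OF d1 DERIV_divide[OF d2 d3 s]]
      unfolding alg[OF s] h_def h'_def cot_def by simp
    then show "(h has_vector_derivative h' x) (at x)"
      by (simp add: has_real_derivative_iff_has_vector_derivative)
  next
    have "isCont h x" if x: "x \<in> {0..2 * pi}" for x
    proof (cases "sin (k * (x - a)) = 0")
      case True
      then have g0: "g x = 0" using zeros gS x by blast
      have c: "cos (k * (x - a)) \<noteq> 0" using True sin_cos_squared_add[of "k * (x - a)"] by fastforce
      have "((\<lambda>y. (g y)\<^sup>2 / sin (k * (y - a))) \<longlongrightarrow> 0) (at x)"
      proof (rule tendsto_square_over_simple_zero[where s = "\<lambda>y. sin (k * (y - a))", OF derg g0 _ True])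
        show "((\<lambda>y. sin (k * (y - a))) has_real_derivative (k * cos (k * (x - a)))) (at x)"
          by (auto intro!: derivative_eq_intros)
        show "k * cos (k * (x - a)) \<noteq> 0" using c k by simp
      qed
      then have "(h \<longlongrightarrow> k * cos (k * (x - a)) * 0) (at x)"
        unfolding h_def by (intro tendsto_intros)
      then show ?thesis
        using g0 by (simp add: isCont_def h_def)
    next
      case False
      then show ?thesis unfolding h_def
        by (intro continuous_intros DERIV_isCont[OF derg]) auto
    qed
    then show "continuous_on {0..2 * pi} h"
      by (simp add: continuous_at_imp_continuous_on)
  qed (auto simp: S_def)
  \<comment> \<open>Since \<open>m\<close> is an integer, \<open>h\<close> repeats after 2 pi and no
    boundary term is left.\<close>
  moreover have "h (2 * pi) = h 0"
  proof -
    have "k * (2 * pi - a) = k * (0 - a) + 2 * of_int (int m) * pi" by (simp add: k_def algebra_simps add_divide_distrib diff_divide_distrib)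
    then have "sin (k * (2 * pi - a)) = sin (k * (0 - a))" "cos (k * (2 * pi - a)) = cos (k * (0 - a))"
      using sin_2npi[of m] cos_2npi[of m] by (simp_all add: sin_diff cos_diff mult.assoc)
    moreover have "f (2 * pi) = f 0"
      using perint[of 0 "int m"] m by (simp add: k_def)
    ultimately show ?thesis
      unfolding h_def g_def by simp
  qed
  ultimately have h': "(h' has_integral 0) {0..2 * pi}" by simp
  have gint: "(\<lambda>x. k\<^sup>2 * (g x)\<^sup>2) integrable_on {0..2 * pi}"
    unfolding g_def by (intro integrable_continuous_real continuous_intros contf)
  have "0 \<le> integral {0..2 * pi} (\<lambda>x. (f' x)\<^sup>2 - k\<^sup>2 * (g x)\<^sup>2)"
  proof (rule has_integral_le[OF h'])
    show "((\<lambda>x. (f' x)\<^sup>2 - k\<^sup>2 * (g x)\<^sup>2) has_integral integral {0..2 * pi} (\<lambda>x. (f' x)\<^sup>2 - k\<^sup>2 * (g x)\<^sup>2)) {0..2 * pi}"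
      by (intro integrable_integral integrable_diff int gint)
    fix x
    have "0 \<le> (f' x - k * g x * cot (k * (x - a)))\<^sup>2" by simp
    then show "h' x \<le> (f' x)\<^sup>2 - k\<^sup>2 * (g x)\<^sup>2"
      unfolding h'_def by (simp add: power2_eq_square algebra_simps)
  qed
  also have "\<dots> = integral {0..2 * pi} (\<lambda>x. (f' x)\<^sup>2) - k\<^sup>2 * integral {0..2 * pi} (\<lambda>x. (g x)\<^sup>2)"
    using Henstock_Kurzweil_Integration.integral_diff[OF int gint] by simp
  finally show ?thesis unfolding g_def k_def by auto
qed

section \<open>The Gaussian measure of variance 2 and its Poincare inequality\<close>

definition gauss :: "real measure" where
  "gauss = density lborel (normal_density 0 (sqrt 2))"

text \<open>The variance 2 is chosen so that the density is, up to normalisation, the weight of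
  \<open>Ffun\<close> at time 1 in one flat variable.\<close>

lemma normal_density_sqrt2: "normal_density 0 (sqrt 2) x = exp (- x\<^sup>2 / 4) / sqrt (4 * pi)"
  by (simp add: normal_density_def)

lemma sets_gauss [measurable_cong]: "sets gauss = sets borel"
  by (simp add: gauss_def)

interpretation gauss: prob_space gauss
  unfolding gauss_def by (rule prob_space_normal_density) simp

lemma integral_gauss:
  assumes "f \<in> borel_measurable borel"
  shows "(\<integral>x. f x \<partial>gauss) = (\<integral>x. exp (- x\<^sup>2 / 4) / sqrt (4 * pi) * f x \<partial>lborel)"
  unfolding gauss_def using assms
  by (subst integral_density) (auto simp: normal_density_sqrt2)

lemma integrable_gauss:
  assumes "f \<in> borel_measurable borel"
  shows "integrable gauss f \<longleftrightarrow> integrable lborel (\<lambda>x. exp (- x\<^sup>2 / 4) * f x)"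
proof -
  have "integrable gauss f \<longleftrightarrow> integrable lborel (\<lambda>x. (1 / sqrt (4 * pi)) * (exp (- x\<^sup>2 / 4) * f x))"
    unfolding gauss_def using assms
    by (subst integrable_density) (auto simp: normal_density_sqrt2)
  then show ?thesis
    by (subst (asm) integrable_mult_left_iff) auto
qed

text \<open>
  The same device with \<open>1 / x\<close> in place of the cotangent: for \<open>g = f - f 0\<close> and \<open>w = exp (- x\<^sup>2 / 4)\<close>,
  \<open>w (g'\<^sup>2 - g\<^sup>2 / 2)\<close> is \<open>w (g' - g / x)\<^sup>2\<close> plus the derivative of \<open>w g\<^sup>2 / x\<close>.
\<close>

lemma gauss_poincare:
  fixes f :: "real \<Rightarrow> real"
  assumes der: "\<And>x. (f has_real_derivative f' x) (at x)"
    and [measurable]: "f' \<in> borel_measurable borel"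
    and bf: "\<And>x. \<bar>f x\<bar> \<le> C" and bf': "\<And>x. \<bar>f' x\<bar> \<le> C"
  shows "(\<integral>x. (f x - f 0)\<^sup>2 \<partial>gauss) \<le> 2 * (\<integral>x. (f' x)\<^sup>2 \<partial>gauss)"
proof -
  define w :: "real \<Rightarrow> real" where "w = (\<lambda>x. exp (- x\<^sup>2 / 4))"
  define g where "g = (\<lambda>x. f x - f 0)"
  have wpos: "w x > 0" for x by (simp add: w_def)
  have contw: "isCont w x" for x by (auto simp: w_def[abs_def])
  have derg: "(g has_real_derivative f' x) (at x)" for x
    unfolding g_def by (auto intro!: derivative_eq_intros der)
  have contg: "continuous_on A g" for A
    by (meson DERIV_continuous_on derg has_field_derivative_at_within)
  have [measurable]: "g \<in> borel_measurable borel"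
    using contg borel_measurable_continuous_onI by blast
  have [measurable]: "w \<in> borel_measurable borel" unfolding w_def by measurable
  have C0: "C \<ge> 0" using bf[of 0] by linarith
  have bg: "(g x)\<^sup>2 \<le> (2 * C)\<^sup>2" for x
    using bf[of x] bf[of 0] C0 by (subst abs_le_square_iff[symmetric]) (auto simp: g_def)
  have bf'2: "(f' x)\<^sup>2 \<le> C\<^sup>2" for x
    using bf'[of x] C0 by (simp add: abs_le_square_iff[symmetric])
  have igauss: "integrable gauss (\<lambda>x. (g x)\<^sup>2)" "integrable gauss (\<lambda>x. (f' x)\<^sup>2)"
    by (rule gauss.integrable_const_bound[where B = "(2*C)\<^sup>2"] gauss.integrable_const_bound[where B = "C\<^sup>2"];
        use bg bf'2 in simp)+
  have ig: "integrable lborel (\<lambda>x. w x * (g x)\<^sup>2)" and if': "integrable lborel (\<lambda>x. w x * (f' x)\<^sup>2)"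
    using igauss by (simp_all add: integrable_gauss w_def)
  have fin: "(LINT x:{-R..R}|lborel. w x * (g x)\<^sup>2) \<le> 2 * (\<integral>x. w x * (f' x)\<^sup>2 \<partial>lborel)" if R: "R > 0" for R
  proof -
    \<comment> \<open>As with the cotangent, the value \<open>0 / 0 = 0\<close> at the origin is the
      correct continuous one.\<close>
    define h where "h = (\<lambda>x. w x * ((g x)\<^sup>2 / x))"
    define h' where "h' = (\<lambda>x. w x * (2 * g x * f' x / x - (g x)\<^sup>2 / x\<^sup>2 - (g x)\<^sup>2 / 2))"
    have "(h' has_integral (h R - h (- R))) {-R..R}"
    proof (rule fundamental_theorem_of_calculus_strong[where S = "{0}"])
      fix x assume x: "x \<in> {-R..R} - {0}"
      have d1: "(w has_real_derivative w x * (- (x / 2))) (at x)"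
        and d2: "((\<lambda>x. (g x)\<^sup>2) has_real_derivative 2 * g x * f' x) (at x)"
        by (auto intro!: derivative_eq_intros derg simp: w_def[abs_def])
      have alg: "W * (- (x / 2)) * (G\<^sup>2 / x) + (2 * G * F * x - G\<^sup>2 * 1) / (x * x) * W
          = W * (2 * G * F / x - G\<^sup>2 / x\<^sup>2 - G\<^sup>2 / 2)" if "x \<noteq> 0" for W G F :: real
        using that by (simp add: field_simps power2_eq_square)
      have "(h has_real_derivative h' x) (at x)"
        using DERIV_mult[OF d1 DERIV_divide[OF d2 DERIV_ident]] x alg
        unfolding h_def h'_def by simp
      then show "(h has_vector_derivative h' x) (at x)"
        by (simp add: has_real_derivative_iff_has_vector_derivative)
    next
      have "isCont h x" for x
      proof (cases "x = 0")
        case True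
        have "((\<lambda>y. (g y)\<^sup>2 / y) \<longlongrightarrow> 0) (at 0)"
          by (rule tendsto_square_over_simple_zero[OF derg _ DERIV_ident]) (auto simp: g_def)
        then have "(h \<longlongrightarrow> w 0 * 0) (at 0)"
          unfolding h_def by (intro tendsto_intros isContD[OF contw])
        then show ?thesis
          using True by (simp add: isCont_def h_def)
      next
        case False
        then show ?thesis unfolding h_def
          by (intro continuous_intros contw DERIV_isCont[OF derg]) auto
      qed
      then show "continuous_on {-R..R} h"
        by (simp add: continuous_at_imp_continuous_on)
    qed (use R in auto)
    moreover have "h R - h (- R) \<ge> 0"
      using R wpos[of R] by (auto simp: h_def w_def)
    ultimately obtain I where I: "(h' has_integral I) {-R..R}" "I \<ge> 0" by blast
    have sg: "set_integrable lborel {-R..R} (\<lambda>x. w x * (g x)\<^sup>2)"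
      and sf: "set_integrable lborel {-R..R} (\<lambda>x. w x * (f' x)\<^sup>2)"
      unfolding set_integrable_def by (intro integrable_mult_indicator ig if'; simp)+
    have sg': "set_integrable lborel {-R..R} (\<lambda>x. w x * (g x)\<^sup>2 / 2)"
      using sg by simp
    have "I \<le> integral {-R..R} (\<lambda>x. w x * (f' x)\<^sup>2 - w x * (g x)\<^sup>2 / 2)"
    proof (rule has_integral_le[OF I(1) integrable_integral])
      show "(\<lambda>x. w x * (f' x)\<^sup>2 - w x * (g x)\<^sup>2 / 2) integrable_on {-R..R}"
        by (intro integrable_diff set_borel_integral_eq_integral sf sg')
      fix x
      have "0 \<le> w x * (f' x - g x / x)\<^sup>2" using wpos[of x] by simp
      then show "h' x \<le> w x * (f' x)\<^sup>2 - w x * (g x)\<^sup>2 / 2"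
        unfolding h'_def by (simp add: power2_diff power_divide algebra_simps)
    qed
    also have "\<dots> = (LINT x:{-R..R}|lborel. w x * (f' x)\<^sup>2) - (LINT x:{-R..R}|lborel. w x * (g x)\<^sup>2) / 2"
      using Henstock_Kurzweil_Integration.integral_diff[OF set_borel_integral_eq_integral(1)[OF sf] set_borel_integral_eq_integral(1)[OF sg']]
        set_borel_integral_eq_integral(2)[OF sf] set_borel_integral_eq_integral(2)[OF sg'] by simp
    finally have "(LINT x:{-R..R}|lborel. w x * (g x)\<^sup>2) \<le> 2 * (LINT x:{-R..R}|lborel. w x * (f' x)\<^sup>2)"
      using I by simp
    also have "(LINT x:{-R..R}|lborel. w x * (f' x)\<^sup>2) \<le> (\<integral>x. w x * (f' x)\<^sup>2 \<partial>lborel)"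
      unfolding set_lebesgue_integral_def
    proof (rule integral_mono[OF sf[unfolded set_integrable_def] if'])
      show "indicat_real {-R..R} x *\<^sub>R (w x * (f' x)\<^sup>2) \<le> w x * (f' x)\<^sup>2" for x
        using wpos[of x] by (simp add: indicator_def)
    qed
    finally show ?thesis by simp
  qed
  have "((\<lambda>n. LINT x:{-real n..real n}|lborel. w x * (g x)\<^sup>2) \<longlonglongrightarrow> (\<integral>x. w x * (g x)\<^sup>2 \<partial>lborel))"
    unfolding set_lebesgue_integral_def
  proof (rule integral_dominated_convergence[where w = "\<lambda>x. w x * (g x)\<^sup>2"])
    show "AE x in lborel. (\<lambda>n. indicat_real {- real n..real n} x *\<^sub>R (w x * (g x)\<^sup>2)) \<longlonglongrightarrow> w x * (g x)\<^sup>2"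
    proof (rule AE_I2)
      fix x
      have "\<forall>\<^sub>F n in sequentially. indicat_real {- real n..real n} x *\<^sub>R (w x * (g x)\<^sup>2) = w x * (g x)\<^sup>2"
        using eventually_ge_at_top[of "nat \<lceil>\<bar>x\<bar>\<rceil>"]
      proof eventually_elim
        case (elim n)
        then have "x \<in> {- real n..real n}" by (simp add: nat_le_iff ceiling_le_iff abs_le_iff)
        then show ?case by simp
      qed
      then show "(\<lambda>n. indicat_real {- real n..real n} x *\<^sub>R (w x * (g x)\<^sup>2)) \<longlonglongrightarrow> w x * (g x)\<^sup>2"
        by (rule tendsto_eventually)
    qed
    show "AE x in lborel. norm (indicat_real {- real n..real n} x *\<^sub>R (w x * (g x)\<^sup>2)) \<le> w x * (g x)\<^sup>2" for n
      using wpos by (intro AE_I2) (simp add: indicator_def less_imp_le)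
  qed (use ig in simp_all)
  then have "(\<integral>x. w x * (g x)\<^sup>2 \<partial>lborel) \<le> 2 * (\<integral>x. w x * (f' x)\<^sup>2 \<partial>lborel)"
    by (rule LIMSEQ_le_const2) (use fin in \<open>auto intro!: exI[of _ 1]\<close>)
  then have "(\<integral>x. w x * (g x)\<^sup>2 \<partial>lborel) / sqrt (4 * pi) \<le> 2 * (\<integral>x. w x * (f' x)\<^sup>2 \<partial>lborel) / sqrt (4 * pi)"
    by (intro divide_right_mono) auto
  moreover have "(\<integral>x. (g x)\<^sup>2 \<partial>gauss) = (\<integral>x. w x * (g x)\<^sup>2 \<partial>lborel) / sqrt (4 * pi)"
     "(\<integral>x. (f' x)\<^sup>2 \<partial>gauss) = (\<integral>x. w x * (f' x)\<^sup>2 \<partial>lborel) / sqrt (4 * pi)"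
    by (simp_all add: integral_gauss w_def)
  ultimately show ?thesis
    unfolding g_def by simp
qed

text \<open>Multiplied by the Gaussian weight, the integrand is the derivative of weight times
  \<open>f\<close>; the compact support leaves no boundary terms.\<close>

lemma gauss_integration_by_parts:
  fixes f :: "real \<Rightarrow> real"
  assumes der: "\<And>x. (f has_real_derivative f' x) (at x)"
    and [measurable]: "f' \<in> borel_measurable borel"
    and supp: "\<And>x. \<bar>x\<bar> > B \<Longrightarrow> f x = 0" and bf': "\<And>x. \<bar>f' x\<bar> \<le> C"
  shows "(\<integral>x. f' x - x / 2 * f x \<partial>gauss) = 0"
proof -
  define w :: "real \<Rightarrow> real" where "w = (\<lambda>x. exp (- x\<^sup>2 / 4))"
  define R where "R = \<bar>B\<bar> + 1"
  have R: "R > 0" "R > B" by (auto simp: R_def)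
  have contf: "continuous_on A f" for A
    by (meson DERIV_continuous_on der has_field_derivative_at_within)
  have [measurable]: "f \<in> borel_measurable borel"
    using contf borel_measurable_continuous_onI by blast
  have zero: "f' x = 0" if "\<bar>x\<bar> > B" for x
  proof -
    have "\<forall>\<^sub>F y in nhds x. \<bar>y\<bar> > B"
      using that by (intro order_tendstoD(1)[OF tendsto_rabs[OF filterlim_ident]])
    then have "\<forall>\<^sub>F y in nhds x. f y = 0" by eventually_elim (use supp in auto)
    then have "(f has_real_derivative 0) (at x)"
      using DERIV_cong_ev[of x x f "\<lambda>_. 0" 0 0] by simp
    then show ?thesis using der DERIV_unique by blast
  qed
  define G where "G = (\<lambda>x. w x * (f' x - x / 2 * f x))"
  have "(G has_integral (w R * f R - w (-R) * f (-R))) {-R..R}"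
  proof (rule fundamental_theorem_of_calculus)
    fix x assume "x \<in> {-R..R}"
    have "((\<lambda>x. w x * f x) has_real_derivative G x) (at x)"
      unfolding w_def G_def by (auto intro!: derivative_eq_intros der simp: algebra_simps)
    then show "((\<lambda>x. w x * f x) has_vector_derivative G x) (at x within {-R..R})"
      by (simp add: has_real_derivative_iff_has_vector_derivative has_vector_derivative_at_within)
  qed (use R in auto)
  then have "(G has_integral 0) {-R..R}" using supp R by simp
  then have GI: "(G has_integral 0) UNIV"
    by (rule has_integral_on_superset) (use zero supp R in \<open>auto simp: G_def\<close>)
  obtain M where M: "\<And>x. x \<in> {-R..R} \<Longrightarrow> \<bar>x / 2 * f x\<bar> \<le> M"
    using compact_imp_bounded[OF compact_continuous_image[of "{-R..R}" "\<lambda>x. x / 2 * f x"]] contf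
    by (force simp: bounded_iff intro!: continuous_intros)
  have "\<bar>f' x - x / 2 * f x\<bar> \<le> C + \<bar>M\<bar>" for x
    using M[of x] bf'[of x] supp[of x] R by (cases "x \<in> {-R..R}") auto
  then have "integrable gauss (\<lambda>x. f' x - x / 2 * f x)"
    by (intro gauss.integrable_const_bound[where B = "C + \<bar>M\<bar>"]) auto
  then have "integrable lborel G"
    by (simp add: integrable_gauss G_def w_def)
  with GI have "(\<integral>x. G x \<partial>lborel) = 0"
    using integral_lborel integral_unique by metis
  then show ?thesis
    by (simp add: integral_gauss G_def w_def)
qed

section \<open>The weighted probability measure on the cylinder\<close>

text \<open>Written as a displacement along a coordinate axis, so that slices are affine lines and
  their one-variable derivatives are directional derivatives.\<close>

definition upd :: "real^'n \<Rightarrow> 'n::finite \<Rightarrow> real \<Rightarrow> real^'n" where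
  "upd p k t = p + (t - p $ k) *\<^sub>R axis k 1"

lemma upd_nth: "upd p k t $ j = (if j = k then t else p $ j)"
  by (simp add: upd_def axis_def)

lemma upd_same [simp]: "upd p k (p $ k) = p"
  and upd_upd [simp]: "upd (upd p k s) k t = upd p k t"
  by (simp_all add: vec_eq_iff upd_nth)

lemma upd_commute: "i \<noteq> j \<Longrightarrow> upd (upd p i s) j t = upd (upd p j t) i s"
  by (simp add: vec_eq_iff upd_nth)

lemma borel_measurable_upd [measurable]:
  assumes [measurable]: "f \<in> borel_measurable M" "g \<in> borel_measurable M"
  shows "(\<lambda>x. upd (f x) k (g x)) \<in> borel_measurable M"
proof -
  have [measurable]: "(\<lambda>x. f x $ k) \<in> borel_measurable M"
    using borel_measurable_continuous_on[OF _ assms(1), of "\<lambda>v. v $ k"] by (simp add: continuous_intros)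
  show ?thesis unfolding upd_def by measurable
qed

definition circ :: "real measure" where
  "circ = density lborel (\<lambda>x. indicator {0..2*pi} x / (2 * pi))"

lemma sets_circ [measurable_cong]: "sets circ = sets borel"
  by (simp add: circ_def)

interpretation circ: prob_space circ
proof
  have "emeasure circ (space circ) = (\<integral>\<^sup>+x. ennreal (1 / (2 * pi)) * indicator {0..2*pi} x \<partial>lborel)"
    unfolding circ_def by (subst emeasure_density) (auto intro!: nn_integral_cong simp: indicator_def)
  also have "\<dots> = ennreal (1 / (2 * pi)) * ennreal (2 * pi)"
    by (subst nn_integral_cmult) auto
  also have "\<dots> = 1" by (subst ennreal_mult[symmetric]) auto
  finally show "emeasure circ (space circ) = 1" .
qed

lemma integral_circ:
  fixes f :: "real \<Rightarrow> real"
  assumes [measurable]: "f \<in> borel_measurable borel" and b: "\<And>x. \<bar>f x\<bar> \<le> C"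
  shows "(\<integral>x. f x \<partial>circ) = integral {0..2*pi} f / (2 * pi)" and "f integrable_on {0..2*pi}"
proof -
  have 1: "set_integrable lborel {0..2*pi} f"
    unfolding set_integrable_def
    by (rule integrableI_bounded_set_indicator[where B = C]) (use b in auto)
  show "f integrable_on {0..2*pi}" using set_borel_integral_eq_integral[OF 1] by simp
  have "(\<integral>x. f x \<partial>circ) = (\<integral>x. (indicator {0..2*pi} x / (2 * pi)) *\<^sub>R f x \<partial>lborel)"
    unfolding circ_def by (rule integral_density) auto
  also have "\<dots> = (LINT x:{0..2*pi}|lborel. f x) / (2 * pi)"
    unfolding set_lebesgue_integral_def by simp
  finally show "(\<integral>x. f x \<partial>circ) = integral {0..2*pi} f / (2 * pi)"
    using set_borel_integral_eq_integral[OF 1] by simp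
qed

lemma circ_integral_deriv_periodic:
  fixes f :: "real \<Rightarrow> real"
  assumes der: "\<And>x. (f has_real_derivative f' x) (at x)"
    and "f' \<in> borel_measurable borel" and "\<And>x. \<bar>f' x\<bar> \<le> C" and per: "f (2 * pi) = f 0"
  shows "(\<integral>x. f' x \<partial>circ) = 0"
proof -
  have "(f' has_integral (f (2 * pi) - f 0)) {0..2*pi}"
    using der by (intro fundamental_theorem_of_calculus)
      (auto simp: has_real_derivative_iff_has_vector_derivative has_vector_derivative_at_within)
  then show ?thesis
    using integral_circ(1)[OF assms(2,3)] per by (simp add: integral_unique)
qed

text \<open>A class closed under the algebra and the averaging below and integrable against every
  Borel probability measure, so that integrability conditions are discharged by
  simplification.\<close>

definition bddm :: "('a::topological_space \<Rightarrow> real) \<Rightarrow> bool" where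
  "bddm f \<longleftrightarrow> f \<in> borel_measurable borel \<and> (\<exists>C. \<forall>p. \<bar>f p\<bar> \<le> C)"

lemma bddmD: "bddm f \<Longrightarrow> f \<in> borel_measurable borel"
  by (simp add: bddm_def)

lemma bddm_const [simp]: "bddm (\<lambda>_. c)"
  by (auto simp: bddm_def)

lemma bddm_add [simp]: "bddm f \<Longrightarrow> bddm g \<Longrightarrow> bddm (\<lambda>x. f x + g x)"
  unfolding bddm_def
proof (safe, goal_cases)
  case (2 C D)
  then have "\<bar>f p + g p\<bar> \<le> C + D" for p
    using abs_triangle_ineq[of "f p" "g p"] add_mono[of "\<bar>f p\<bar>" C "\<bar>g p\<bar>" D] by fastforce
  then show ?case by blast
qed auto

lemma bddm_mult [simp]: "bddm f \<Longrightarrow> bddm g \<Longrightarrow> bddm (\<lambda>x. f x * g x)"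
  unfolding bddm_def
proof (safe, goal_cases)
  case (2 C D)
  then have "\<bar>f p * g p\<bar> \<le> C * D" for p
    unfolding abs_mult by (intro mult_mono) (auto intro: order_trans[OF abs_ge_zero])
  then show ?case by blast
qed auto

lemma bddm_uminus [simp]: "bddm f \<Longrightarrow> bddm (\<lambda>x. - f x)"
  using bddm_mult[of "\<lambda>_. -1" f] by simp

lemma bddm_diff [simp]: "bddm f \<Longrightarrow> bddm g \<Longrightarrow> bddm (\<lambda>x. f x - g x)"
  using bddm_add[of f "\<lambda>x. - g x"] by simp

lemma bddm_power2 [simp]: "bddm f \<Longrightarrow> bddm (\<lambda>x. (f x)\<^sup>2)"
  by (simp add: power2_eq_square)

lemma bddm_divide [simp]: "bddm f \<Longrightarrow> bddm (\<lambda>x. f x / c)"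
  using bddm_mult[of f "\<lambda>_. 1 / c"] by simp

lemma bddm_sum [simp]: "(\<And>i. i \<in> I \<Longrightarrow> bddm (f i)) \<Longrightarrow> bddm (\<lambda>x. \<Sum>i\<in>I. f i x)"
  by (induction I rule: infinite_finite_induct) auto

lemma bddm_compose:
  assumes "bddm f" "g \<in> borel_measurable borel" shows "bddm (\<lambda>x. f (g x))"
  using assms unfolding bddm_def by (auto intro: measurable_compose)

lemma integrable_bddm:
  assumes "prob_space M" "bddm f" "sets M = sets borel" shows "integrable M f"
proof -
  interpret prob_space M by fact
  obtain C where "\<And>p. \<bar>f p\<bar> \<le> C" using assms unfolding bddm_def by auto
  moreover have "f \<in> borel_measurable M"
    using assms by (simp add: bddm_def measurable_cong_sets[OF assms(3) refl])
  ultimately show ?thesis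
    by (intro integrable_const_bound[where B = C]) auto
qed

definition marg :: "'n \<Rightarrow> 'n::finite \<Rightarrow> real measure" where
  "marg i0 k = (if k = i0 then circ else gauss)"

lemma sets_marg [measurable_cong, simp]: "sets (marg i0 k) = sets borel"
  by (simp add: marg_def sets_gauss sets_circ)

lemma space_marg [simp]: "space (marg i0 k) = UNIV"
  by (simp add: marg_def gauss_def circ_def)

lemma prob_space_marg: "prob_space (marg i0 k)"
  by (simp add: marg_def gauss.prob_space_axioms circ.prob_space_axioms)

text \<open>The normalised weighted area measure of the cylinder in parameter coordinates. Building
  it as the image of a product measure gives Fubini one coordinate at a time; its Lebesgue density
  is computed later, for the link with \<open>Ffun\<close>.\<close>

definition cmeas :: "'n::finite \<Rightarrow> (real^'n) measure" where
  "cmeas i0 = distr (\<Pi>\<^sub>M j\<in>UNIV. marg i0 j) borel (\<lambda>x. \<chi> j. x j)"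

text \<open>The conditional expectation given all coordinates except \<open>k\<close>. It stays a
  function of the full point, constant in coordinate \<open>k\<close>, so that averages can be
  iterated and compared with \<open>f\<close> itself.\<close>

definition avg :: "'n \<Rightarrow> 'n::finite \<Rightarrow> (real^'n \<Rightarrow> real) \<Rightarrow> real^'n \<Rightarrow> real" where
  "avg i0 k f p = (\<integral>t. f (upd p k t) \<partial>marg i0 k)"

lemma measurable_vec_lambda_PiM:
  assumes "\<And>j. sets (M j) = sets borel"
  shows "(\<lambda>x. \<chi> j. x j) \<in> measurable (\<Pi>\<^sub>M j\<in>(UNIV::'n::finite set). M j) (borel :: (real^'n) measure)"
proof -
  have [measurable]: "(\<lambda>x. x j) \<in> borel_measurable (Pi\<^sub>M UNIV M)" for j
    using measurable_component_singleton[of j UNIV M] assms by (simp cong: measurable_cong_sets)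
  have "(\<lambda>x. \<Sum>j\<in>UNIV. x j *\<^sub>R (axis j 1 :: real^'n)) \<in> borel_measurable (Pi\<^sub>M UNIV M)"
    by measurable
  moreover have "(\<lambda>x. \<Sum>j\<in>UNIV. x j *\<^sub>R (axis j 1 :: real^'n)) = (\<lambda>x. \<chi> j. x j)"
    by (auto simp: fun_eq_iff vec_eq_iff axis_def if_distrib cong: if_cong)
  ultimately show ?thesis by simp
qed

lemma sets_cmeas [measurable_cong, simp]: "sets (cmeas i0) = sets borel"
  by (simp add: cmeas_def)

lemma prob_space_cmeas: "prob_space (cmeas i0)"
  unfolding cmeas_def
  by (intro prob_space.prob_space_distr prob_space_PiM prob_space_marg measurable_vec_lambda_PiM) simp

lemma integrable_cmeas: "bddm f \<Longrightarrow> integrable (cmeas i0) f"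
  by (rule integrable_bddm[OF prob_space_cmeas]) auto

lemma integrable_marg: "bddm f \<Longrightarrow> integrable (marg i0 k) f"
  by (rule integrable_bddm[OF prob_space_marg]) auto

lemma bddm_slice: "bddm f \<Longrightarrow> bddm (\<lambda>t. f (upd p k t))"
  by (rule bddm_compose) measurable

lemma integrable_slice: "bddm f \<Longrightarrow> integrable (marg i0 k) (\<lambda>t. f (upd p k t))"
  by (intro integrable_marg bddm_slice)

lemma bddm_avg [simp]: assumes "bddm f" shows "bddm (avg i0 k f)"
proof -
  interpret prob_space "marg i0 k" by (rule prob_space_marg)
  have [measurable]: "f \<in> borel_measurable borel" using assms by (rule bddmD)
  obtain C where C: "\<And>p. \<bar>f p\<bar> \<le> C" using assms by (auto simp: bddm_def)
  have "avg i0 k f \<in> borel_measurable borel"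
    unfolding avg_def[abs_def] by (intro borel_measurable_lebesgue_integral) measurable
  moreover have "\<bar>avg i0 k f p\<bar> \<le> C" for p
  proof -
    have "\<bar>avg i0 k f p\<bar> \<le> (\<integral>t. \<bar>f (upd p k t)\<bar> \<partial>marg i0 k)"
      unfolding avg_def by (rule integral_abs_bound)
    also have "\<dots> \<le> C"
      using C by (intro integral_le_const integrable_abs integrable_slice assms) auto
    finally show ?thesis .
  qed
  ultimately show ?thesis by (auto simp: bddm_def)
qed

text \<open>Fubini with coordinate \<open>k\<close> singled out as the inner integral; averaging
  overwrites whatever value is stored in that coordinate.\<close>

lemma integral_cmeas_avg:
  assumes f: "bddm f"
  shows "(\<integral>p. f p \<partial>cmeas i0) = (\<integral>p. avg i0 k f p \<partial>cmeas i0)"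
proof -
  interpret product_sigma_finite "marg i0"
    by (intro product_sigma_finite.intro prob_space_imp_sigma_finite prob_space_marg)
  have ins: "UNIV = insert k (UNIV - {k})" by auto
  have mv: "(\<lambda>x. \<chi> j. x j) \<in> measurable (Pi\<^sub>M UNIV (marg i0)) borel"
    by (rule measurable_vec_lambda_PiM) simp
  have *: "(\<integral>p. g p \<partial>cmeas i0) = (\<integral>x. (\<integral>y. g (\<chi> j. (x(k:=y)) j) \<partial>marg i0 k) \<partial>Pi\<^sub>M (UNIV - {k}) (marg i0))"
    if g: "bddm g" for g
  proof -
    have "(\<integral>p. g p \<partial>cmeas i0) = (\<integral>x. g (\<chi> j. x j) \<partial>Pi\<^sub>M UNIV (marg i0))"
      unfolding cmeas_def by (rule integral_distr[OF mv bddmD[OF g]])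
    moreover have "integrable (Pi\<^sub>M UNIV (marg i0)) (\<lambda>x. g (\<chi> j. x j))"
      using integrable_cmeas[OF g, of i0] integrable_distr_eq[OF mv bddmD[OF g]] unfolding cmeas_def
      by simp
    ultimately show ?thesis
      using product_integral_insert[of "UNIV - {k}" k "\<lambda>x. g (\<chi> j. x j)"] ins by simp
  qed
  interpret k: prob_space "marg i0 k" by (rule prob_space_marg)
  have u: "upd (vec_lambda (x(k := y))) k t = vec_lambda (x(k := t))" for x y t
    by (simp add: vec_eq_iff upd_nth)
  have "(\<integral>y. avg i0 k f (\<chi> j. (x(k:=y)) j) \<partial>marg i0 k) = (\<integral>y. f (\<chi> j. (x(k:=y)) j) \<partial>marg i0 k)" for x
    unfolding avg_def u using k.prob_space by (simp add: fun_upd_def)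
  then show ?thesis
    by (simp add: * f)
qed

lemma avg_upd [simp]: "avg i0 k f (upd p k t) = avg i0 k f p"
  by (simp add: avg_def)

lemma avg_add: "bddm f \<Longrightarrow> bddm g \<Longrightarrow> avg i0 k (\<lambda>p. f p + g p) p = avg i0 k f p + avg i0 k g p"
  unfolding avg_def by (intro Bochner_Integration.integral_add integrable_slice)

lemma avg_mult_invariant:
  assumes "\<And>p t. g (upd p k t) = g p"
  shows "avg i0 k (\<lambda>p. f p * g p) p = avg i0 k f p * g p"
  unfolding avg_def using assms by simp

lemma avg_invariant:
  assumes "\<And>p t. g (upd p k t) = g p"
  shows "avg i0 k g p = g p"
proof -
  interpret k: prob_space "marg i0 k" by (rule prob_space_marg)
  show ?thesis unfolding avg_def using assms k.prob_space by simp
qed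

lemma avg_invariant_other:
  assumes "\<And>p t. g (upd p j t) = g p"
  shows "avg i0 k g (upd p j t) = avg i0 k g p"
proof (cases "k = j")
  case False
  then show ?thesis unfolding avg_def using assms by (simp add: upd_commute[of j k])
qed simp

lemma avg_commute:
  assumes f: "bddm f"
  shows "avg i0 i (avg i0 j f) p = avg i0 j (avg i0 i f) p"
proof (cases "i = j")
  case False
  interpret i: prob_space "marg i0 i" by (rule prob_space_marg)
  interpret j: prob_space "marg i0 j" by (rule prob_space_marg)
  interpret ij: pair_prob_space "marg i0 i" "marg i0 j" ..
  have [measurable]: "f \<in> borel_measurable borel" using f by (rule bddmD)
  obtain C where C: "\<And>p. \<bar>f p\<bar> \<le> C" using f by (auto simp: bddm_def)
  have "integrable (marg i0 i \<Otimes>\<^sub>M marg i0 j) (\<lambda>(s, t). f (upd (upd p i s) j t))"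
    by (rule ij.P.integrable_const_bound[where B = C]) (use C in \<open>auto simp: split_beta\<close>)
  from ij.Fubini_integral[OF this] show ?thesis
    unfolding avg_def using False by (simp add: upd_commute)
qed simp

lemma integral_mult_avg_invariant:
  assumes "bddm f" "bddm g" "\<And>p t. g (upd p k t) = g p"
  shows "(\<integral>p. f p * g p \<partial>cmeas i0) = (\<integral>p. avg i0 k f p * g p \<partial>cmeas i0)"
  using integral_cmeas_avg[of "\<lambda>p. f p * g p" i0 k] assms by (simp add: avg_mult_invariant)

text \<open>Pythagoras for the projection \<open>avg i0 k\<close>: what it removes from
  \<open>f\<close> is orthogonal to everything invariant in coordinate \<open>k\<close>.\<close>

lemma integral_square_avg_le:
  assumes f: "bddm f"
  shows "(\<integral>p. (f p - avg i0 k f p)\<^sup>2 \<partial>cmeas i0) = (\<integral>p. (f p)\<^sup>2 \<partial>cmeas i0) - (\<integral>p. (avg i0 k f p)\<^sup>2 \<partial>cmeas i0)"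
    and "(\<integral>p. (avg i0 k f p)\<^sup>2 \<partial>cmeas i0) \<le> (\<integral>p. (f p)\<^sup>2 \<partial>cmeas i0)"
proof -
  have 1: "(\<integral>p. f p * avg i0 k f p \<partial>cmeas i0) = (\<integral>p. (avg i0 k f p)\<^sup>2 \<partial>cmeas i0)"
    using integral_mult_avg_invariant[of f "avg i0 k f" k i0] f by (simp add: power2_eq_square)
  have "(\<integral>p. (f p - avg i0 k f p)\<^sup>2 \<partial>cmeas i0)
      = (\<integral>p. (f p)\<^sup>2 + (avg i0 k f p)\<^sup>2 - 2 * (f p * avg i0 k f p) \<partial>cmeas i0)"
    by (simp add: power2_diff mult.assoc)
  also have "\<dots> = (\<integral>p. (f p)\<^sup>2 \<partial>cmeas i0) + (\<integral>p. (avg i0 k f p)\<^sup>2 \<partial>cmeas i0) - 2 * (\<integral>p. f p * avg i0 k f p \<partial>cmeas i0)"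
    using f by (simp add: integrable_cmeas)
  finally show 2: "(\<integral>p. (f p - avg i0 k f p)\<^sup>2 \<partial>cmeas i0) = (\<integral>p. (f p)\<^sup>2 \<partial>cmeas i0) - (\<integral>p. (avg i0 k f p)\<^sup>2 \<partial>cmeas i0)"
    using 1 by simp
  have "0 \<le> (\<integral>p. (f p - avg i0 k f p)\<^sup>2 \<partial>cmeas i0)" by simp
  then show "(\<integral>p. (avg i0 k f p)\<^sup>2 \<partial>cmeas i0) \<le> (\<integral>p. (f p)\<^sup>2 \<partial>cmeas i0)" using 2 by simp
qed

section \<open>Poincare inequalities on the cylinder\<close>

text \<open>Dominated convergence along sequences. The mean value theorem bounds the difference
  quotients by the constant \<open>C\<close>, which is integrable because the measure is
  finite.\<close>

lemma has_real_derivative_integral: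
  fixes f f' :: "real \<Rightarrow> 'a \<Rightarrow> real"
  assumes "finite_measure M" and s0: "s0 \<in> {a<..<b}"
    and int: "\<And>s. s \<in> {a<..<b} \<Longrightarrow> integrable M (f s)"
    and meas: "f' s0 \<in> borel_measurable M"
    and der: "\<And>s x. s \<in> {a<..<b} \<Longrightarrow> x \<in> space M \<Longrightarrow> ((\<lambda>s. f s x) has_real_derivative f' s x) (at s)"
    and bnd: "\<And>s x. s \<in> {a<..<b} \<Longrightarrow> x \<in> space M \<Longrightarrow> \<bar>f' s x\<bar> \<le> C"
  shows "((\<lambda>s. \<integral>x. f s x \<partial>M) has_real_derivative (\<integral>x. f' s0 x \<partial>M)) (at s0)"
proof -
  interpret finite_measure M by fact
  have "((\<lambda>s. ((\<integral>x. f s x \<partial>M) - (\<integral>x. f s0 x \<partial>M)) / (s - s0)) \<longlongrightarrow> (\<integral>x. f' s0 x \<partial>M)) (at s0 within {a<..<b})"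
    unfolding tendsto_at_iff_sequentially
  proof (intro allI impI)
    fix X :: "nat \<Rightarrow> real" assume X: "\<forall>i. X i \<in> {a<..<b} - {s0}" and lim: "X \<longlonglongrightarrow> s0"
    have "(\<lambda>i. \<integral>x. (f (X i) x - f s0 x) / (X i - s0) \<partial>M) \<longlonglongrightarrow> (\<integral>x. f' s0 x \<partial>M)"
    proof (rule integral_dominated_convergence[where w = "\<lambda>_. C"])
      show "AE x in M. (\<lambda>i. (f (X i) x - f s0 x) / (X i - s0)) \<longlonglongrightarrow> f' s0 x"
      proof (rule AE_I2)
        fix x assume x: "x \<in> space M"
        have "((\<lambda>s. (f s x - f s0 x) / (s - s0)) \<longlongrightarrow> f' s0 x) (at s0)"
          using der[OF s0 x] by (simp add: has_field_derivative_iff)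
        moreover have "filterlim X (at s0) sequentially"
          using lim X by (auto simp: filterlim_at)
        ultimately show "(\<lambda>i. (f (X i) x - f s0 x) / (X i - s0)) \<longlonglongrightarrow> f' s0 x"
          by (rule filterlim_compose)
      qed
      show "AE x in M. norm ((f (X i) x - f s0 x) / (X i - s0)) \<le> C" for i
      proof (rule AE_I2)
        fix x assume x: "x \<in> space M"
        have Xi: "X i \<in> {a<..<b}" "X i \<noteq> s0" using X by auto
        have "norm (f (X i) x - f s0 x) \<le> C * norm (X i - s0)"
          by (rule field_differentiable_bound[where S = "{a<..<b}" and f' = "\<lambda>s. f' s x"])
            (use der x bnd s0 Xi in \<open>auto intro: has_field_derivative_at_within\<close>)
        then show "norm ((f (X i) x - f s0 x) / (X i - s0)) \<le> C"
          using Xi by (simp add: field_simps)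
      qed
    qed (use X s0 int meas in auto)
    also have "(\<lambda>i. \<integral>x. (f (X i) x - f s0 x) / (X i - s0) \<partial>M)
      = (\<lambda>s. ((\<integral>x. f s x \<partial>M) - (\<integral>x. f s0 x \<partial>M)) / (s - s0)) \<circ> X"
      using X s0 int by (auto simp: fun_eq_iff)
    finally show "((\<lambda>s. ((\<integral>x. f s x \<partial>M) - (\<integral>x. f s0 x \<partial>M)) / (s - s0)) \<circ> X) \<longlonglongrightarrow> (\<integral>x. f' s0 x \<partial>M)" .
  qed
  then show ?thesis
    using s0 by (simp add: has_field_derivative_iff at_within_open[OF s0])
qed

text \<open>Smoothness is awkward to carry through averages. This slicewise notion survives
  averaging over another coordinate by \<open>has_real_derivative_integral\<close> and is all that
  the inequalities use.\<close>

definition pdp :: "'n::finite \<Rightarrow> (real^'n \<Rightarrow> real) \<Rightarrow> (real^'n \<Rightarrow> real) \<Rightarrow> bool" where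
  "pdp k f f' \<longleftrightarrow> bddm f \<and> bddm f' \<and>
     (\<forall>p t. ((\<lambda>t. f (upd p k t)) has_real_derivative f' (upd p k t)) (at t))"

lemma pdpD:
  assumes "pdp k f f'"
  shows "bddm f" "bddm f'" "((\<lambda>t. f (upd p k t)) has_real_derivative f' (upd p k t)) (at t)"
  using assms by (auto simp: pdp_def)

lemma pdp_avg:
  assumes f: "pdp k f f'" and "i \<noteq> k"
  shows "pdp k (avg i0 i f) (avg i0 i f')"
proof -
  interpret i: prob_space "marg i0 i" by (rule prob_space_marg)
  obtain C where C: "\<And>p. \<bar>f' p\<bar> \<le> C" using pdpD(2)[OF f] by (auto simp: bddm_def)
  have "((\<lambda>t. avg i0 i f (upd p k t)) has_real_derivative avg i0 i f' (upd p k t)) (at t)" for p t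
    unfolding avg_def
  proof (rule has_real_derivative_integral[where a = "t - 1" and b = "t + 1" and C = C])
    show "(\<lambda>x. f' (upd (upd p k t) i x)) \<in> borel_measurable (marg i0 i)"
      by (rule borel_measurable_integrable[OF integrable_slice[OF pdpD(2)[OF f]]])
    show "integrable (marg i0 i) (\<lambda>x. f (upd (upd p k s) i x))" for s
      by (intro integrable_slice pdpD(1)[OF f])
  qed (use C pdpD(3)[OF f] assms(2) in \<open>auto intro!: i.finite_measure_axioms simp: upd_commute[of k i]\<close>)
  then show ?thesis
    using f by (auto simp: pdp_def)
qed

text \<open>The factor turning the coordinate derivative into the derivative along the unit frame.\<close>

definition lam :: "'n \<Rightarrow> 'n \<Rightarrow> real" where
  "lam i0 k = (if k = i0 then 1 / sqrt 2 else 1)"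

lemma periodic_slice:
  assumes "periodic_in i0 f" shows "f (upd p i0 (t + 2 * pi)) = f (upd p i0 t)"
proof -
  have "upd p i0 (t + 2 * pi) = upd p i0 t + (2 * pi) *\<^sub>R axis i0 1"
    by (simp add: upd_def algebra_simps)
  then show ?thesis using assms by (simp add: periodic_in_def)
qed

lemma periodic_in_avg:
  assumes "periodic_in i0 f" shows "periodic_in i0 (avg i0 k f)"
proof -
  have "upd (p + (2 * pi) *\<^sub>R axis i0 1) k t = (if k = i0 then upd p k t else upd p k t + (2 * pi) *\<^sub>R axis i0 1)" for p t
    by (auto simp: vec_eq_iff upd_nth axis_def)
  then show ?thesis using assms by (cases "k = i0") (simp_all add: periodic_in_def avg_def)
qed

text \<open>The one-variable inequalities are proved with some constant or with a value of
  \<open>f\<close> subtracted; the mean is the best constant, so they carry over to the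
  variance.\<close>

lemma variance_le:
  assumes "prob_space M" and f: "integrable M f" "integrable M (\<lambda>x. (f x :: real)\<^sup>2)"
  shows "(\<integral>x. (f x - (\<integral>x. f x \<partial>M))\<^sup>2 \<partial>M) \<le> (\<integral>x. (f x - c)\<^sup>2 \<partial>M)"
proof -
  interpret prob_space M by fact
  have *: "(\<integral>x. (f x - d)\<^sup>2 \<partial>M) = (\<integral>x. (f x)\<^sup>2 \<partial>M) - 2 * d * (\<integral>x. f x \<partial>M) + d\<^sup>2" for d
  proof -
    have "(\<integral>x. (f x - d)\<^sup>2 \<partial>M) = (\<integral>x. (f x)\<^sup>2 - 2 * d * f x + d\<^sup>2 \<partial>M)"
      by (simp add: power2_diff algebra_simps)
    also have "\<dots> = (\<integral>x. (f x)\<^sup>2 \<partial>M) - 2 * d * (\<integral>x. f x \<partial>M) + d\<^sup>2"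
      using f prob_space by simp
    finally show ?thesis .
  qed
  have "0 \<le> (c - (\<integral>x. f x \<partial>M))\<^sup>2" by simp
  then show ?thesis unfolding * by (simp add: power2_eq_square algebra_simps)
qed

lemma circ_wirtinger:
  fixes f :: "real \<Rightarrow> real"
  assumes m: "m > 0" and f: "bddm f" "bddm f'" and per: "\<And>x. f (x + 2 * pi / real m) = f x"
    and der: "\<And>x. (f has_real_derivative f' x) (at x)"
  shows "(real m)\<^sup>2 * (\<integral>x. (f x - (\<integral>x. f x \<partial>circ))\<^sup>2 \<partial>circ) \<le> (\<integral>x. (f' x)\<^sup>2 \<partial>circ)"
proof -
  have *: "(\<integral>x. g x \<partial>circ) = integral {0..2*pi} g / (2 * pi)" "g integrable_on {0..2*pi}" if "bddm g" for g
    using that integral_circ unfolding bddm_def by metis+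
  have i: "integrable circ g" if "bddm g" for g :: "real \<Rightarrow> real"
    using that by (intro integrable_bddm circ.prob_space_axioms sets_circ)
  obtain c where c: "(real m)\<^sup>2 * integral {0..2 * pi} (\<lambda>x. (f x - c)\<^sup>2) \<le> integral {0..2 * pi} (\<lambda>x. (f' x)\<^sup>2)"
    using wirtinger_inequality[OF m per der *(2)] f by auto
  have "(real m)\<^sup>2 * (\<integral>x. (f x - (\<integral>x. f x \<partial>circ))\<^sup>2 \<partial>circ) \<le> (real m)\<^sup>2 * (\<integral>x. (f x - c)\<^sup>2 \<partial>circ)"
    using f by (intro mult_left_mono variance_le circ.prob_space_axioms i) auto
  also have "\<dots> \<le> (\<integral>x. (f' x)\<^sup>2 \<partial>circ)"
    using f c by (simp add: * divide_right_mono)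
  finally show ?thesis .
qed

text \<open>By Pythagoras the left side is the integral of the variances of the slices, each
  controlled by its one-variable inequality. On the circle the constant 1 for the angle derivative
  is the constant 2 after scaling by \<open>lam i0 i0\<close>.\<close>

lemma poincare_step:
  assumes f: "pdp k f f'" and per: "periodic_in i0 f"
  shows "(\<integral>p. (f p)\<^sup>2 \<partial>cmeas i0) - (\<integral>p. (avg i0 k f p)\<^sup>2 \<partial>cmeas i0) \<le> 2 * (\<integral>p. (lam i0 k * f' p)\<^sup>2 \<partial>cmeas i0)"
proof -
  note b = pdpD(1,2)[OF f]
  have slice: "avg i0 k (\<lambda>p. (f p - avg i0 k f p)\<^sup>2) p \<le> avg i0 k (\<lambda>p. 2 * (lam i0 k * f' p)\<^sup>2) p" for p
  proof (cases "k = i0")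
    case True
    have "(real 1)\<^sup>2 * (\<integral>t. (f (upd p k t) - (\<integral>t. f (upd p k t) \<partial>circ))\<^sup>2 \<partial>circ) \<le> (\<integral>t. (f' (upd p k t))\<^sup>2 \<partial>circ)"
      by (rule circ_wirtinger) (use True per periodic_slice pdpD(3)[OF f] in \<open>auto intro!: bddm_slice b\<close>)
    then show ?thesis
      using True unfolding avg_def by (simp add: lam_def marg_def power_mult_distrib power_divide)
  next
    case False
    have b': "bddm (\<lambda>t. f (upd p k t))" "bddm (\<lambda>t. f' (upd p k t))"
      using b by (auto intro!: bddm_slice)
    obtain C where C: "\<And>t. \<bar>f (upd p k t)\<bar> \<le> C" using b'(1) unfolding bddm_def by auto
    obtain C' where C': "\<And>t. \<bar>f' (upd p k t)\<bar> \<le> C'" using b'(2) unfolding bddm_def by auto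
    have "(\<integral>t. (f (upd p k t) - (\<integral>t. f (upd p k t) \<partial>gauss))\<^sup>2 \<partial>gauss) \<le> (\<integral>t. (f (upd p k t) - f (upd p k 0))\<^sup>2 \<partial>gauss)"
      using b' by (intro variance_le gauss.prob_space_axioms integrable_bddm sets_gauss) auto
    also have "\<dots> \<le> 2 * (\<integral>t. (f' (upd p k t))\<^sup>2 \<partial>gauss)"
      by (rule gauss_poincare[where C = "max C C'"])
        (use pdpD(3)[OF f] C C' bddmD[OF b'(2)] in \<open>auto simp: le_max_iff_disj\<close>)
    finally show ?thesis
      using False unfolding avg_def by (simp add: lam_def marg_def)
  qed
  have "(\<integral>p. (f p)\<^sup>2 \<partial>cmeas i0) - (\<integral>p. (avg i0 k f p)\<^sup>2 \<partial>cmeas i0) = (\<integral>p. avg i0 k (\<lambda>p. (f p - avg i0 k f p)\<^sup>2) p \<partial>cmeas i0)"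
    using b by (simp add: integral_square_avg_le(1)[symmetric] integral_cmeas_avg[symmetric])
  also have "\<dots> \<le> (\<integral>p. avg i0 k (\<lambda>p. 2 * (lam i0 k * f' p)\<^sup>2) p \<partial>cmeas i0)"
    using b by (intro integral_mono slice integrable_cmeas) auto
  also have "\<dots> = 2 * (\<integral>p. (lam i0 k * f' p)\<^sup>2 \<partial>cmeas i0)"
    using b by (simp add: integral_cmeas_avg[symmetric])
  finally show ?thesis .
qed

section \<open>Tensorisation over all coordinates\<close>

fun avgs :: "'n \<Rightarrow> 'n::finite list \<Rightarrow> (real^'n \<Rightarrow> real) \<Rightarrow> real^'n \<Rightarrow> real" where
  "avgs i0 [] f = f"
| "avgs i0 (k # ks) f = avgs i0 ks (avg i0 k f)"

lemma bddm_avgs [simp]: "bddm f \<Longrightarrow> bddm (avgs i0 ks f)"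
  by (induction ks arbitrary: f) auto

lemma periodic_in_avgs: "periodic_in i0 f \<Longrightarrow> periodic_in i0 (avgs i0 ks f)"
  by (induction ks arbitrary: f) (auto intro: periodic_in_avg)

lemma pdp_avgs: "pdp k f f' \<Longrightarrow> k \<notin> set ks \<Longrightarrow> pdp k (avgs i0 ks f) (avgs i0 ks f')"
proof (induction ks arbitrary: f f')
  case (Cons i ks)
  then have "pdp k (avg i0 i f) (avg i0 i f')" by (intro pdp_avg) auto
  then show ?case using Cons by simp
qed simp

lemma avgs_invariant:
  assumes "(\<forall>p t. f (upd p j t) = f p) \<or> j \<in> set ks"
  shows "avgs i0 ks f (upd p j t) = avgs i0 ks f p"
  using assms
proof (induction ks arbitrary: f p t)
  case (Cons k ks)
  have "(\<forall>p t. avg i0 k f (upd p j t) = avg i0 k f p) \<or> j \<in> set ks"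
    using Cons.prems avg_invariant_other[of f j i0 k] by (cases "j = k") auto
  then show ?case using Cons.IH[of "avg i0 k f"] by simp
qed auto

lemma integral_cmeas_avgs: "bddm f \<Longrightarrow> (\<integral>p. f p \<partial>cmeas i0) = (\<integral>p. avgs i0 ks f p \<partial>cmeas i0)"
proof (induction ks arbitrary: f)
  case (Cons k ks)
  then show ?case using integral_cmeas_avg[of f i0 k] Cons.IH[of "avg i0 k f"] by simp
qed simp

lemma integral_mult_avgs:
  assumes "bddm f" "bddm g" "\<And>k p t. k \<in> set ks \<Longrightarrow> g (upd p k t) = g p"
  shows "(\<integral>p. f p * g p \<partial>cmeas i0) = (\<integral>p. avgs i0 ks f p * g p \<partial>cmeas i0)"
  using assms
proof (induction ks arbitrary: f)
  case (Cons k ks)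
  have "(\<integral>p. f p * g p \<partial>cmeas i0) = (\<integral>p. avg i0 k f p * g p \<partial>cmeas i0)"
    using Cons.prems by (intro integral_mult_avg_invariant) auto
  then show ?case using Cons by simp
qed simp

lemma integral_square_avgs:
  assumes "bddm f"
  shows "(\<integral>p. (f p - avgs i0 ks f p)\<^sup>2 \<partial>cmeas i0) = (\<integral>p. (f p)\<^sup>2 \<partial>cmeas i0) - (\<integral>p. (avgs i0 ks f p)\<^sup>2 \<partial>cmeas i0)"
proof -
  have 1: "(\<integral>p. f p * avgs i0 ks f p \<partial>cmeas i0) = (\<integral>p. (avgs i0 ks f p)\<^sup>2 \<partial>cmeas i0)"
    using integral_mult_avgs[of f "avgs i0 ks f" ks i0] assms by (simp add: power2_eq_square avgs_invariant)
  have "(\<integral>p. (f p - avgs i0 ks f p)\<^sup>2 \<partial>cmeas i0)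
      = (\<integral>p. (f p)\<^sup>2 + (avgs i0 ks f p)\<^sup>2 - 2 * (f p * avgs i0 ks f p) \<partial>cmeas i0)"
    by (simp add: power2_diff mult.assoc)
  also have "\<dots> = (\<integral>p. (f p)\<^sup>2 \<partial>cmeas i0) + (\<integral>p. (avgs i0 ks f p)\<^sup>2 \<partial>cmeas i0) - 2 * (\<integral>p. f p * avgs i0 ks f p \<partial>cmeas i0)"
    using assms by (simp add: integrable_cmeas)
  finally show ?thesis using 1 by simp
qed

lemma avgs_commute_avg: "bddm f \<Longrightarrow> avg i0 k (avgs i0 ks f) = avgs i0 ks (avg i0 k f)"
proof (induction ks arbitrary: f)
  case (Cons j ks)
  have "avg i0 k (avg i0 j f) = avg i0 j (avg i0 k f)" using avg_commute[OF Cons.prems] by blast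
  then show ?case using Cons by simp
qed simp

lemma avgs_const: "avgs i0 ks (\<lambda>_. c) = (\<lambda>_. c)"
proof (induction ks)
  case (Cons k ks)
  have "avg i0 k (\<lambda>_. c) = (\<lambda>_. c)" using avg_invariant[of "\<lambda>_. c"] by blast
  then show ?case using Cons by simp
qed simp

text \<open>Averaging out one coordinate after another telescopes the left side. The later steps
  involve averaged derivatives, whose L2 norms are not larger, so the one-coordinate bounds simply
  add up.\<close>

lemma poincare_list:
  assumes "distinct ks" "bddm f" "periodic_in i0 f" "\<And>k. k \<in> set ks \<Longrightarrow> pdp k f (f' k)"
  shows "(\<integral>p. (f p)\<^sup>2 \<partial>cmeas i0) - (\<integral>p. (avgs i0 ks f p)\<^sup>2 \<partial>cmeas i0)
    \<le> 2 * (\<Sum>k\<in>set ks. \<integral>p. (lam i0 k * f' k p)\<^sup>2 \<partial>cmeas i0)"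
  using assms
proof (induction ks arbitrary: f f')
  case (Cons k ks)
  have "(\<integral>p. (avg i0 k f p)\<^sup>2 \<partial>cmeas i0) - (\<integral>p. (avgs i0 ks (avg i0 k f) p)\<^sup>2 \<partial>cmeas i0)
      \<le> 2 * (\<Sum>j\<in>set ks. \<integral>p. (lam i0 j * avg i0 k (f' j) p)\<^sup>2 \<partial>cmeas i0)"
    by (rule Cons.IH) (use Cons.prems in \<open>auto intro!: periodic_in_avg pdp_avg\<close>)
  also have "\<dots> \<le> 2 * (\<Sum>j\<in>set ks. \<integral>p. (lam i0 j * f' j p)\<^sup>2 \<partial>cmeas i0)"
  proof -
    have "(\<integral>p. (lam i0 j * avg i0 k (f' j) p)\<^sup>2 \<partial>cmeas i0) \<le> (\<integral>p. (lam i0 j * f' j p)\<^sup>2 \<partial>cmeas i0)"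
      if "j \<in> set ks" for j
      using integral_square_avg_le(2)[of "f' j" i0 k] pdpD(2)[OF Cons.prems(4)] that
      by (simp add: power_mult_distrib mult_left_mono)
    then show ?thesis by (simp add: sum_mono)
  qed
  finally have "(\<integral>p. (avg i0 k f p)\<^sup>2 \<partial>cmeas i0) - (\<integral>p. (avgs i0 ks (avg i0 k f) p)\<^sup>2 \<partial>cmeas i0)
      \<le> 2 * (\<Sum>j\<in>set ks. \<integral>p. (lam i0 j * f' j p)\<^sup>2 \<partial>cmeas i0)" .
  moreover have "(\<integral>p. (f p)\<^sup>2 \<partial>cmeas i0) - (\<integral>p. (avg i0 k f p)\<^sup>2 \<partial>cmeas i0) \<le> 2 * (\<integral>p. (lam i0 k * f' k p)\<^sup>2 \<partial>cmeas i0)"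
    using Cons.prems by (intro poincare_step) auto
  ultimately show ?case using Cons.prems by simp
qed simp

lemma invariant_imp_eq:
  fixes g :: "real^'n::finite \<Rightarrow> 'b"
  assumes "finite S" "\<And>k p t. k \<in> S \<Longrightarrow> g (upd p k t) = g p" "\<And>j. j \<notin> S \<Longrightarrow> p $ j = q $ j"
  shows "g p = g q"
  using assms
proof (induction S arbitrary: q)
  case empty
  then have "p = q" by (simp add: vec_eq_iff)
  then show ?case by simp
next
  case (insert k S)
  have "g p = g (upd q k (p $ k))"
    using insert.prems by (intro insert.IH) (auto simp: upd_nth)
  then show ?case using insert.prems by simp
qed

text \<open>Averaging over every coordinate leaves a constant, which can only be the mean.\<close>

theorem cylinder_poincare:
  fixes f :: "real^'n::finite \<Rightarrow> real"
  assumes "bddm f" "periodic_in i0 f" "\<And>k. pdp k f (f' k)"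
  shows "(\<integral>p. (f p - (\<integral>p. f p \<partial>cmeas i0))\<^sup>2 \<partial>cmeas i0) \<le> 2 * (\<Sum>k\<in>UNIV. \<integral>p. (lam i0 k * f' k p)\<^sup>2 \<partial>cmeas i0)"
proof -
  interpret prob_space "cmeas i0" by (rule prob_space_cmeas)
  obtain ks :: "'n list" where ks: "distinct ks" "set ks = UNIV"
    using finite_distinct_list[of "UNIV :: 'n set"] by auto
  have "avgs i0 ks f p = avgs i0 ks f 0" for p
    by (rule invariant_imp_eq[of UNIV]) (auto intro!: avgs_invariant simp: ks)
  then have c: "avgs i0 ks f = (\<lambda>_. avgs i0 ks f 0)" by blast
  have "(\<integral>p. f p \<partial>cmeas i0) = avgs i0 ks f 0"
    using integral_cmeas_avgs[OF assms(1), of i0 ks] by (subst (asm) c) (simp add: prob_space)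
  then have "(\<integral>p. (f p - (\<integral>p. f p \<partial>cmeas i0))\<^sup>2 \<partial>cmeas i0) = (\<integral>p. (f p - avgs i0 ks f p)\<^sup>2 \<partial>cmeas i0)"
    using c by metis
  then show ?thesis
    using poincare_list[OF ks(1) assms] ks(2) integral_square_avgs[OF assms(1), of i0 ks] by simp
qed

section \<open>Fourier modes on the circle and the radial component\<close>

lemma integral_circ_shift:
  assumes f: "bddm f" and per: "\<And>x. f (x + 2 * pi) = f x"
  shows "(\<integral>x. f (x + pi) \<partial>circ) = (\<integral>x. f x \<partial>circ)"
proof -
  have int: "g integrable_on {0..2*pi}" "(\<integral>x. g x \<partial>circ) = integral {0..2*pi} g / (2 * pi)" if "bddm g" for g
    using that integral_circ unfolding bddm_def by metis+
  have fs: "bddm (\<lambda>x. f (x + pi))" by (rule bddm_compose[OF f]) auto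
  have int1: "f integrable_on {a..b}" if "{a..b} \<subseteq> {0..2*pi}" for a b
    using int(1)[OF f] that integrable_on_subinterval by blast
  have sh: "((\<lambda>x. g (x + c)) has_integral I) {a..b} \<longleftrightarrow> (g has_integral I) {a + c..b + c}" for g :: "real \<Rightarrow> real" and a b c I
    using has_integral_shift_cbox_iff[of g c I a b] by (simp add: o_def add.commute)
  have "((\<lambda>x. f (x + pi)) has_integral integral {pi..2*pi} f) {0..pi}"
    unfolding sh using int1[of pi "2*pi"] by (simp add: has_integral_integral[symmetric])
  moreover have "((\<lambda>x. f (x + pi)) has_integral integral {0..pi} f) {pi..2*pi}"
  proof -
    have "(f has_integral integral {0..pi} f) {0..pi}"
      using int1[of 0 "pi"] by (simp add: has_integral_integral[symmetric])
    then have "((\<lambda>x. f (x + 2 * pi)) has_integral integral {0..pi} f) {0..pi}"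
      using per by simp
    then show ?thesis unfolding sh by (simp add: algebra_simps)
  qed
  ultimately have "((\<lambda>x. f (x + pi)) has_integral integral {pi..2*pi} f + integral {0..pi} f) {0..2*pi}"
    by (intro has_integral_combine[where c = pi]) auto
  moreover have "integral {0..pi} f + integral {pi..2*pi} f = integral {0..2*pi} f"
    by (rule Henstock_Kurzweil_Integration.integral_combine) (use int(1)[OF f] in auto)
  ultimately show ?thesis using f fs by (simp add: int integral_unique add.commute)
qed

lemma bddm_cos [simp]: "bddm (cos :: real \<Rightarrow> real)" and bddm_sin [simp]: "bddm (sin :: real \<Rightarrow> real)"
  by (auto simp: bddm_def intro!: exI[of _ 1])

lemma integrable_circ: "bddm f \<Longrightarrow> integrable circ f"
  by (intro integrable_bddm circ.prob_space_axioms sets_circ)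

lemma integral_circ_trig:
  "(\<integral>x. cos x \<partial>circ) = 0" "(\<integral>x. sin x \<partial>circ) = 0" "(\<integral>x. sin x * cos x \<partial>circ) = 0"
  "(\<integral>x. (cos x)\<^sup>2 \<partial>circ) = 1 / 2" "(\<integral>x. (sin x)\<^sup>2 \<partial>circ) = 1 / 2"
proof -
  have b: "\<bar>cos x\<bar> \<le> 1" "\<bar>sin x\<bar> \<le> 1" "\<bar>sin x * cos x\<bar> \<le> 1" for x :: real
    by (auto simp: abs_mult intro!: mult_le_one)
  show "(\<integral>x. cos x \<partial>circ) = 0"
    by (rule circ_integral_deriv_periodic[where f = sin and C = 1])
      (auto intro!: derivative_eq_intros)
  show "(\<integral>x. sin x \<partial>circ) = 0"
    by (rule circ_integral_deriv_periodic[where f = "\<lambda>x. - cos x" and C = 1])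
      (auto intro!: derivative_eq_intros)
  show "(\<integral>x. sin x * cos x \<partial>circ) = 0"
    by (rule circ_integral_deriv_periodic[where f = "\<lambda>x. (sin x)\<^sup>2 / 2" and C = 1])
      (use b in \<open>auto intro!: derivative_eq_intros\<close>)
  have "(\<integral>x. (cos x)\<^sup>2 - (sin x)\<^sup>2 \<partial>circ) = 0"
  proof (rule circ_integral_deriv_periodic[where f = "\<lambda>x. sin x * cos x" and C = 1])
    have "(cos x)\<^sup>2 - (sin x)\<^sup>2 = cos (2 * x)" for x :: real by (simp add: cos_double)
    then show "\<bar>(cos x)\<^sup>2 - (sin x)\<^sup>2\<bar> \<le> 1" for x :: real by simp
  qed (auto intro!: derivative_eq_intros simp: power2_eq_square)
  moreover have "(\<integral>x. (cos x)\<^sup>2 - (sin x)\<^sup>2 \<partial>circ) = (\<integral>x. (cos x)\<^sup>2 \<partial>circ) - (\<integral>x. (sin x)\<^sup>2 \<partial>circ)"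
    by (intro Bochner_Integration.integral_diff integrable_circ) auto
  moreover have "(\<integral>x. (cos x)\<^sup>2 + (sin x)\<^sup>2 \<partial>circ) = (\<integral>x. (cos x)\<^sup>2 \<partial>circ) + (\<integral>x. (sin x)\<^sup>2 \<partial>circ)"
    by (intro Bochner_Integration.integral_add integrable_circ) auto
  moreover have "(\<integral>x. (cos x)\<^sup>2 + (sin x :: real)\<^sup>2 \<partial>circ) = 1"
    by (simp add: circ.prob_space)
  ultimately show "(\<integral>x. (cos x)\<^sup>2 \<partial>circ) = 1 / 2" "(\<integral>x. (sin x)\<^sup>2 \<partial>circ) = 1 / 2"
    by linarith+
qed

text \<open>
  Split \<open>g\<close> into its parts even and odd under translation by \<open>\<pi>\<close>. The even part, and the odd part
  multiplied by \<open>cos\<close> and by \<open>sin\<close>, are \<open>\<pi>\<close>-periodic with mean zero, so the Wirtinger inequality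
  with \<open>m = 2\<close> applies to them.
\<close>

lemma circ_second_wirtinger:
  fixes g :: "real \<Rightarrow> real"
  assumes g: "bddm g" "bddm g'" and per: "\<And>x. g (x + 2 * pi) = g x"
    and der: "\<And>x. (g has_real_derivative g' x) (at x)"
    and orth: "(\<integral>x. g x \<partial>circ) = 0" "(\<integral>x. g x * cos x \<partial>circ) = 0" "(\<integral>x. g x * sin x \<partial>circ) = 0"
  shows "3 * (\<integral>x. (g x)\<^sup>2 \<partial>circ) \<le> (\<integral>x. (g' x)\<^sup>2 \<partial>circ)"
proof -
  define G where "G = (\<lambda>x. g (x + pi))"
  define G' where "G' = (\<lambda>x. g' (x + pi))"
  have b: "bddm G" "bddm G'" unfolding G_def G'_def by (rule bddm_compose[where g = "\<lambda>x. x + pi"], use g in auto)+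
  have derG: "(G has_real_derivative G' x) (at x)" for x
    unfolding G_def G'_def by (rule DERIV_shift[THEN iffD1, OF der])
  have perG: "g (x + pi) = G x" "G (x + pi) = g x" for x
    using per[of x] by (simp_all add: G_def add.commute)
  have per': "g' (x + 2 * pi) = g' x" for x
  proof -
    have "((\<lambda>y. g (y + 2 * pi)) has_real_derivative g' (x + 2 * pi)) (at x)"
      by (rule DERIV_shift[THEN iffD1, OF der])
    then have "(g has_real_derivative g' (x + 2 * pi)) (at x)" using per by simp
    then show ?thesis using der DERIV_unique by blast
  qed
  define f1 where "f1 = (\<lambda>x. (g x + G x) / 2)"
  define f2 where "f2 = (\<lambda>x. (g x - G x) / 2 * cos x)"
  define f3 where "f3 = (\<lambda>x. (g x - G x) / 2 * sin x)"
  define f1' where "f1' = (\<lambda>x. (g' x + G' x) / 2)"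
  define f2' where "f2' = (\<lambda>x. (g' x - G' x) / 2 * cos x - (g x - G x) / 2 * sin x)"
  define f3' where "f3' = (\<lambda>x. (g' x - G' x) / 2 * sin x + (g x - G x) / 2 * cos x)"
  have bs: "bddm f1" "bddm f2" "bddm f3" "bddm f1'" "bddm f2'" "bddm f3'"
    unfolding f1_def f2_def f3_def f1'_def f2'_def f3'_def using b g by auto
  have ders: "(f1 has_real_derivative f1' x) (at x)" "(f2 has_real_derivative f2' x) (at x)"
    "(f3 has_real_derivative f3' x) (at x)" for x
    unfolding f1_def f2_def f3_def f1'_def f2'_def f3'_def
    by (auto intro!: derivative_eq_intros der derG simp: field_simps)
  have pers: "f1 (x + pi) = f1 x" "f2 (x + pi) = f2 x" "f3 (x + pi) = f3 x" for x
    unfolding f1_def f2_def f3_def perG by (auto simp: field_simps)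
  have sh: "(\<integral>x. G x \<partial>circ) = 0" "(\<integral>x. G x * cos x \<partial>circ) = 0" "(\<integral>x. G x * sin x \<partial>circ) = 0"
    "(\<integral>x. (G x)\<^sup>2 \<partial>circ) = (\<integral>x. (g x)\<^sup>2 \<partial>circ)" "(\<integral>x. (G' x)\<^sup>2 \<partial>circ) = (\<integral>x. (g' x)\<^sup>2 \<partial>circ)"
    using integral_circ_shift[of g] integral_circ_shift[of "\<lambda>x. g x * cos x"] integral_circ_shift[of "\<lambda>x. g x * sin x"]
      integral_circ_shift[of "\<lambda>x. (g x)\<^sup>2"] integral_circ_shift[of "\<lambda>x. (g' x)\<^sup>2"] g per per' orth
    by (simp_all add: G_def G'_def)
  have means: "(\<integral>x. f1 x \<partial>circ) = 0" "(\<integral>x. f2 x \<partial>circ) = 0" "(\<integral>x. f3 x \<partial>circ) = 0"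
    unfolding f1_def f2_def f3_def using b g orth sh
    by (simp_all add: left_diff_distrib integrable_circ)
  have W: "4 * (\<integral>x. (f x)\<^sup>2 \<partial>circ) \<le> (\<integral>x. (f' x)\<^sup>2 \<partial>circ)"
    if "bddm f" "bddm f'" "\<And>x. f (x + pi) = f x" "\<And>x. (f has_real_derivative f' x) (at x)"
      "(\<integral>x. f x \<partial>circ) = 0" for f f'
    using circ_wirtinger[of 2 f f'] that by simp
  have E1: "(\<integral>x. (f1 x)\<^sup>2 + (f2 x)\<^sup>2 + (f3 x)\<^sup>2 \<partial>circ) = (\<integral>x. (g x)\<^sup>2 \<partial>circ)"
  proof -
    have "(f2 x)\<^sup>2 + (f3 x)\<^sup>2 = ((g x - G x) / 2)\<^sup>2 * ((cos x)\<^sup>2 + (sin x)\<^sup>2)" for x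
      unfolding f2_def f3_def power_mult_distrib by (rule distrib_left[symmetric])
    then have "(f1 x)\<^sup>2 + (f2 x)\<^sup>2 + (f3 x)\<^sup>2 = (g x)\<^sup>2 / 2 + (G x)\<^sup>2 / 2" for x
      unfolding f1_def by (simp add: power2_eq_square field_simps)
    then show ?thesis using b g sh by (simp add: integrable_circ)
  qed
  have "4 * ((\<integral>x. (f1 x)\<^sup>2 \<partial>circ) + (\<integral>x. (f2 x)\<^sup>2 \<partial>circ) + (\<integral>x. (f3 x)\<^sup>2 \<partial>circ))
      \<le> (\<integral>x. (f1' x)\<^sup>2 \<partial>circ) + (\<integral>x. (f2' x)\<^sup>2 \<partial>circ) + (\<integral>x. (f3' x)\<^sup>2 \<partial>circ)"
    using W[OF bs(1,4) pers(1) ders(1) means(1)] W[OF bs(2,5) pers(2) ders(2) means(2)]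
      W[OF bs(3,6) pers(3) ders(3) means(3)] by argo
  also have "(\<integral>x. (f1 x)\<^sup>2 \<partial>circ) + (\<integral>x. (f2 x)\<^sup>2 \<partial>circ) + (\<integral>x. (f3 x)\<^sup>2 \<partial>circ)
      = (\<integral>x. (f1 x)\<^sup>2 + (f2 x)\<^sup>2 + (f3 x)\<^sup>2 \<partial>circ)"
    using bs by (simp add: integrable_circ)
  also note E1
  also have "(\<integral>x. (f1' x)\<^sup>2 \<partial>circ) + (\<integral>x. (f2' x)\<^sup>2 \<partial>circ) + (\<integral>x. (f3' x)\<^sup>2 \<partial>circ)
      = (\<integral>x. (f1' x)\<^sup>2 + (f2' x)\<^sup>2 + (f3' x)\<^sup>2 \<partial>circ)"
    using bs by (simp add: integrable_circ)
  \<comment> \<open>The squared derivatives of \<open>f2\<close> and \<open>f3\<close> contain the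
    odd part of \<open>g\<close> once more undifferentiated. Bounding it by all of \<open>g\<close>
    costs 1 of the constant 4; the remaining 3 exceeds the 2 needed later.\<close>
  also have "\<dots> = (\<integral>x. (g' x)\<^sup>2 / 2 + (G' x)\<^sup>2 / 2 + ((f2 x)\<^sup>2 + (f3 x)\<^sup>2) \<partial>circ)"
  proof (rule Bochner_Integration.integral_cong)
    fix x
    have alg: "(a * c - b * s)\<^sup>2 + (a * s + b * c)\<^sup>2 = a\<^sup>2 * (c\<^sup>2 + s\<^sup>2) + ((b * c)\<^sup>2 + (b * s)\<^sup>2)" for a b c s :: real
      by (simp add: power2_eq_square algebra_simps)
    have "(f2' x)\<^sup>2 + (f3' x)\<^sup>2 = ((g' x - G' x) / 2)\<^sup>2 + ((f2 x)\<^sup>2 + (f3 x)\<^sup>2)"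
      unfolding f2'_def f3'_def f2_def f3_def alg by simp
    then show "(f1' x)\<^sup>2 + (f2' x)\<^sup>2 + (f3' x)\<^sup>2 = (g' x)\<^sup>2 / 2 + (G' x)\<^sup>2 / 2 + ((f2 x)\<^sup>2 + (f3 x)\<^sup>2)"
      unfolding f1'_def by (simp add: power2_eq_square field_simps)
  qed simp
  also have "\<dots> = (\<integral>x. (g' x)\<^sup>2 \<partial>circ) + (\<integral>x. (f2 x)\<^sup>2 + (f3 x)\<^sup>2 \<partial>circ)"
    using b g bs sh by (simp add: integrable_circ)
  also have "(\<integral>x. (f2 x)\<^sup>2 + (f3 x)\<^sup>2 \<partial>circ) \<le> (\<integral>x. (f1 x)\<^sup>2 + (f2 x)\<^sup>2 + (f3 x)\<^sup>2 \<partial>circ)"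
    using bs by (intro integral_mono integrable_circ) auto
  also note E1
  finally show ?thesis by simp
qed

text \<open>Subtracting the mean and the first Fourier modes leaves \<open>g\<close>, on which the
  left side is nonpositive. The mean contributes c^2; the first modes contribute (a^2 + b^2) / 2
  through the function and lose half of it through the derivative.\<close>

lemma circ_fourier_bound:
  fixes f :: "real \<Rightarrow> real"
  assumes f: "bddm f" "bddm f'" and per: "\<And>x. f (x + 2 * pi) = f x"
    and der: "\<And>x. (f has_real_derivative f' x) (at x)"
    and c: "c = (\<integral>x. f x \<partial>circ)" and a: "a = 2 * (\<integral>x. f x * cos x \<partial>circ)" and b: "b = 2 * (\<integral>x. f x * sin x \<partial>circ)"
  shows "(\<integral>x. (f x)\<^sup>2 \<partial>circ) - (\<integral>x. (f' x)\<^sup>2 \<partial>circ) / 2 \<le> c\<^sup>2 + (a\<^sup>2 + b\<^sup>2) / 4"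
proof -
  define g where "g = (\<lambda>x. f x - c - a * cos x - b * sin x)"
  define g' where "g' = (\<lambda>x. f' x + a * sin x - b * cos x)"
  have bg: "bddm g" "bddm g'" unfolding g_def g'_def using f by simp_all
  have derg: "(g has_real_derivative g' x) (at x)" for x
    unfolding g_def g'_def by (auto intro!: derivative_eq_intros der)
  have perg: "g (x + 2 * pi) = g x" for x
    unfolding g_def by (simp add: per)
  have g0: "(\<integral>x. g x \<partial>circ) = 0"
    unfolding g_def using f by (simp add: integrable_circ integral_circ_trig c[symmetric] circ.prob_space)
  have gc: "(\<integral>x. g x * cos x \<partial>circ) = 0"
  proof -
    have "g x * cos x = f x * cos x - c * cos x - a * (cos x)\<^sup>2 - b * (sin x * cos x)" for x
      by (simp add: g_def power2_eq_square algebra_simps)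
    then show ?thesis using f by (simp add: integrable_circ integral_circ_trig a)
  qed
  have gs: "(\<integral>x. g x * sin x \<partial>circ) = 0"
  proof -
    have "g x * sin x = f x * sin x - c * sin x - a * (sin x * cos x) - b * (sin x)\<^sup>2" for x
      by (simp add: g_def power2_eq_square algebra_simps)
    then show ?thesis using f by (simp add: integrable_circ integral_circ_trig b)
  qed
  \<comment> \<open>By parts, \<open>g'\<close> is orthogonal to the first modes as well, which
    kills the mixed terms in the square of \<open>f'\<close>.\<close>
  have parts: "(\<integral>x. g' x * h x \<partial>circ) = - (\<integral>x. g x * h' x \<partial>circ)"
    if h: "bddm h" "bddm h'" "h (2 * pi) = h 0" "\<And>x. (h has_real_derivative h' x) (at x)" for h h'
  proof -
    have bb: "bddm (\<lambda>x. g' x * h x + g x * h' x)" using h bg by simp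
    then obtain C where C: "\<And>x. \<bar>g' x * h x + g x * h' x\<bar> \<le> C" unfolding bddm_def by auto
    have "(\<integral>x. g' x * h x + g x * h' x \<partial>circ) = 0"
    proof (rule circ_integral_deriv_periodic[OF _ bddmD[OF bb] C])
      show "((\<lambda>x. g x * h x) has_real_derivative g' x * h x + g x * h' x) (at x)" for x
        by (auto intro!: derivative_eq_intros derg h(4) simp: algebra_simps)
    qed (use h perg[of 0] in simp)
    then show ?thesis using h bg by (simp add: integrable_circ)
  qed
  have g's: "(\<integral>x. g' x * sin x \<partial>circ) = 0" "(\<integral>x. g' x * cos x \<partial>circ) = 0"
    using parts[of sin cos] parts[of cos "\<lambda>x. - sin x"] gc gs by (auto intro!: derivative_eq_intros)
  have "(\<integral>x. (f x)\<^sup>2 \<partial>circ) = (\<integral>x. (g x)\<^sup>2 + c\<^sup>2 + a\<^sup>2 * (cos x)\<^sup>2 + b\<^sup>2 * (sin x)\<^sup>2 + 2 * c * g x + 2 * a * (g x * cos x)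
      + 2 * b * (g x * sin x) + 2 * c * a * cos x + 2 * c * b * sin x + 2 * a * b * (sin x * cos x) \<partial>circ)"
    by (rule Bochner_Integration.integral_cong) (auto simp: g_def power2_eq_square algebra_simps)
  also have "\<dots> = (\<integral>x. (g x)\<^sup>2 \<partial>circ) + c\<^sup>2 + a\<^sup>2 / 2 + b\<^sup>2 / 2"
    using bg by (simp add: integrable_circ integral_circ_trig g0 gc gs circ.prob_space)
  finally have F: "(\<integral>x. (f x)\<^sup>2 \<partial>circ) = (\<integral>x. (g x)\<^sup>2 \<partial>circ) + c\<^sup>2 + a\<^sup>2 / 2 + b\<^sup>2 / 2" .
  have "(\<integral>x. (f' x)\<^sup>2 \<partial>circ) = (\<integral>x. (g' x)\<^sup>2 + a\<^sup>2 * (sin x)\<^sup>2 + b\<^sup>2 * (cos x)\<^sup>2 - 2 * a * (g' x * sin x)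
      + 2 * b * (g' x * cos x) - 2 * a * b * (sin x * cos x) \<partial>circ)"
    by (rule Bochner_Integration.integral_cong) (auto simp: g'_def power2_eq_square algebra_simps)
  also have "\<dots> = (\<integral>x. (g' x)\<^sup>2 \<partial>circ) + a\<^sup>2 / 2 + b\<^sup>2 / 2"
    using bg by (simp add: integrable_circ integral_circ_trig g's)
  finally have F': "(\<integral>x. (f' x)\<^sup>2 \<partial>circ) = (\<integral>x. (g' x)\<^sup>2 \<partial>circ) + a\<^sup>2 / 2 + b\<^sup>2 / 2" .
  have "3 * (\<integral>x. (g x)\<^sup>2 \<partial>circ) \<le> (\<integral>x. (g' x)\<^sup>2 \<partial>circ)"
    by (rule circ_second_wirtinger[OF bg perg derg g0 gc gs])
  moreover have "0 \<le> (\<integral>x. (g x)\<^sup>2 \<partial>circ)" by simp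
  ultimately show ?thesis unfolding F F' by argo
qed

lemma integral_cmeas_radial:
  fixes F :: "real^'n::finite \<Rightarrow> real"
  assumes "bddm F" "\<And>k p t. k \<noteq> i0 \<Longrightarrow> F (upd p k t) = F p"
  shows "(\<integral>p. F p \<partial>cmeas i0) = (\<integral>t. F (upd q i0 t) \<partial>circ)"
proof -
  interpret prob_space "cmeas i0" by (rule prob_space_cmeas)
  have c: "avg i0 i0 F p = avg i0 i0 F q" for p
    by (rule invariant_imp_eq[of UNIV]) (use assms(2) in \<open>auto, metis avg_invariant_other avg_upd\<close>)
  have "(\<integral>p. avg i0 i0 F p \<partial>cmeas i0) = avg i0 i0 F q"
    using Bochner_Integration.integral_cong[OF refl c, of "cmeas i0"] prob_space by simp
  then show ?thesis
    using integral_cmeas_avg[OF assms(1), of i0 i0] by (simp add: avg_def marg_def)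
qed

lemma bddm_nth: "bddm h \<Longrightarrow> bddm (\<lambda>p :: real^'n::finite. h (p $ k))"
  by (rule bddm_compose) (auto intro!: borel_measurable_continuous_onI continuous_intros)

text \<open>Let \<open>v\<close> be the average of \<open>u\<close> over the flat coordinates. The
  difference \<open>u - v\<close> has mean zero over the flat factor and over each circle, so two
  Poincare inequalities apply to it, each with constant 2; their arithmetic mean gives exactly the
  constant 1 in front of the gradient. The function \<open>v\<close> of the angle alone is covered
  by \<open>circ_fourier_bound\<close>.\<close>

theorem radial_inequality:
  fixes u :: "real^'n::finite \<Rightarrow> real" and i0 :: 'n
  assumes u: "bddm u" "periodic_in i0 u" "\<And>k. pdp k u (u' k)"
    and mean: "\<And>p. avg i0 i0 u p = c"
    and a: "a = 2 * (\<integral>p. u p * cos (p $ i0) \<partial>cmeas i0)"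
    and b: "b = 2 * (\<integral>p. u p * sin (p $ i0) \<partial>cmeas i0)"
  shows "(\<integral>p. (u p)\<^sup>2 \<partial>cmeas i0) - (\<Sum>k\<in>UNIV. \<integral>p. (lam i0 k * u' k p)\<^sup>2 \<partial>cmeas i0) \<le> c\<^sup>2 + (a\<^sup>2 + b\<^sup>2) / 4"
proof -
  interpret prob_space "cmeas i0" by (rule prob_space_cmeas)
  obtain ks :: "'n list" where ks: "distinct ks" "set ks = UNIV - {i0}"
    using finite_distinct_list[of "UNIV - {i0} :: 'n set"] by auto
  define v where "v = avgs i0 ks u"
  define v' where "v' = avgs i0 ks (u' i0)"
  note bu = pdpD(2)[OF u(3)]
  have pv: "pdp i0 v v'" unfolding v_def v'_def by (rule pdp_avgs) (use u ks in auto)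
  have perv: "periodic_in i0 v" unfolding v_def by (rule periodic_in_avgs) fact
  note bv = pdpD(1,2)[OF pv]
  have inv: "v (upd p k t) = v p" "v' (upd p k t) = v' p" if "k \<noteq> i0" for k p t
    unfolding v_def v'_def using ks that by (auto intro!: avgs_invariant)
  have 1: "(\<integral>p. (u p)\<^sup>2 \<partial>cmeas i0) - (\<integral>p. (v p)\<^sup>2 \<partial>cmeas i0)
      \<le> 2 * (\<Sum>k\<in>UNIV - {i0}. \<integral>p. (lam i0 k * u' k p)\<^sup>2 \<partial>cmeas i0)"
    using poincare_list[OF ks(1) u(1,2), of u'] u(3) by (simp add: v_def ks)
  have "pdp i0 (\<lambda>p. u p - v p) (\<lambda>p. u' i0 p - v' p)"
    using u(3)[of i0] pv by (auto simp: pdp_def intro!: DERIV_diff)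
  moreover have "periodic_in i0 (\<lambda>p. u p - v p)"
    using u(2) perv by (auto simp: periodic_in_def)
  ultimately have 2: "(\<integral>p. (u p - v p)\<^sup>2 \<partial>cmeas i0) - (\<integral>p. (avg i0 i0 (\<lambda>p. u p - v p) p)\<^sup>2 \<partial>cmeas i0)
      \<le> 2 * (\<integral>p. (lam i0 i0 * (u' i0 p - v' p))\<^sup>2 \<partial>cmeas i0)"
    by (rule poincare_step)
  have cu: "avg i0 i0 u = (\<lambda>_. c)" using mean by blast
  \<comment> \<open>Averages commute, so \<open>v\<close> inherits the angular mean
    \<open>c\<close>. With a mean varying along the flat factor, \<open>u - v\<close> would not have
    angular mean zero.\<close>
  have cv: "avg i0 i0 v p = c" for p
    unfolding v_def by (simp add: avgs_commute_avg u cu avgs_const)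
  have "avg i0 i0 (\<lambda>p. u p - v p) p = 0" for p
    using avg_add[OF u(1) bddm_uminus[OF bv(1)], of i0 i0 p] cv[of p] mean[of p]
    by (simp add: avg_def)
  with 2 have 2: "(\<integral>p. (u p - v p)\<^sup>2 \<partial>cmeas i0) \<le> (\<integral>p. (u' i0 p - v' p)\<^sup>2 \<partial>cmeas i0)"
    by (simp add: lam_def power_mult_distrib power_divide)
  have 3: "(\<integral>p. (u p - v p)\<^sup>2 \<partial>cmeas i0) = (\<integral>p. (u p)\<^sup>2 \<partial>cmeas i0) - (\<integral>p. (v p)\<^sup>2 \<partial>cmeas i0)"
    "(\<integral>p. (u' i0 p - v' p)\<^sup>2 \<partial>cmeas i0) = (\<integral>p. (u' i0 p)\<^sup>2 \<partial>cmeas i0) - (\<integral>p. (v' p)\<^sup>2 \<partial>cmeas i0)"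
    unfolding v_def v'_def by (auto intro!: integral_square_avgs u bu)
  have ui0: "upd p k t $ i0 = p $ i0" if "k \<noteq> i0" for p t and k :: 'n
    using that by (simp add: upd_nth)
  have R: "(\<integral>p. F p \<partial>cmeas i0) = (\<integral>t. F (upd 0 i0 t) \<partial>circ)"
    if "bddm F" "\<And>k p t. k \<noteq> i0 \<Longrightarrow> F (upd p k t) = F p" for F
    using integral_cmeas_radial that by blast
  have trig: "bddm (\<lambda>p :: real^'n. cos (p $ i0))" "bddm (\<lambda>p :: real^'n. sin (p $ i0))"
    by (auto intro!: bddm_nth)
  have "(\<integral>p. u p * cos (p $ i0) \<partial>cmeas i0) = (\<integral>p. v p * cos (p $ i0) \<partial>cmeas i0)"
    unfolding v_def by (rule integral_mult_avgs) (use u trig ks in \<open>auto simp: upd_nth\<close>)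
  also have "\<dots> = (\<integral>t. v (upd 0 i0 t) * cos (upd 0 i0 t $ i0) \<partial>circ)"
    by (rule R) (use bv trig inv ui0 in auto)
  finally have a': "a = 2 * (\<integral>t. v (upd 0 i0 t) * cos t \<partial>circ)"
    using a by (simp add: upd_nth)
  have "(\<integral>p. u p * sin (p $ i0) \<partial>cmeas i0) = (\<integral>p. v p * sin (p $ i0) \<partial>cmeas i0)"
    unfolding v_def by (rule integral_mult_avgs) (use u trig ks in \<open>auto simp: upd_nth\<close>)
  also have "\<dots> = (\<integral>t. v (upd 0 i0 t) * sin (upd 0 i0 t $ i0) \<partial>circ)"
    by (rule R) (use bv trig inv ui0 in auto)
  finally have b': "b = 2 * (\<integral>t. v (upd 0 i0 t) * sin t \<partial>circ)"
    using b by (simp add: upd_nth)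
  have "(\<integral>t. (v (upd 0 i0 t))\<^sup>2 \<partial>circ) - (\<integral>t. (v' (upd 0 i0 t))\<^sup>2 \<partial>circ) / 2 \<le> c\<^sup>2 + (a\<^sup>2 + b\<^sup>2) / 4"
  proof (rule circ_fourier_bound[OF _ _ _ _ _ a' b'])
    show "c = (\<integral>t. v (upd 0 i0 t) \<partial>circ)" using cv[of 0] by (simp add: avg_def marg_def)
  qed (use bv periodic_slice[OF perv] pdpD(3)[OF pv] in \<open>auto intro!: bddm_slice\<close>)
  then have 4: "(\<integral>p. (v p)\<^sup>2 \<partial>cmeas i0) - (\<integral>p. (v' p)\<^sup>2 \<partial>cmeas i0) / 2 \<le> c\<^sup>2 + (a\<^sup>2 + b\<^sup>2) / 4"
    using R[of "\<lambda>p. (v p)\<^sup>2"] R[of "\<lambda>p. (v' p)\<^sup>2"] bv inv by simp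
  have "(\<Sum>k\<in>UNIV. \<integral>p. (lam i0 k * u' k p)\<^sup>2 \<partial>cmeas i0)
      = (\<integral>p. (lam i0 i0 * u' i0 p)\<^sup>2 \<partial>cmeas i0) + (\<Sum>k\<in>UNIV - {i0}. \<integral>p. (lam i0 k * u' k p)\<^sup>2 \<partial>cmeas i0)"
    by (simp add: sum.remove)
  moreover have "(\<integral>p. (lam i0 i0 * u' i0 p)\<^sup>2 \<partial>cmeas i0) = (\<integral>p. (u' i0 p)\<^sup>2 \<partial>cmeas i0) / 2"
    by (simp add: lam_def power_mult_distrib power_divide)
  ultimately show ?thesis using 1 2 3 4 by linarith
qed

section \<open>Smooth functions\<close>

definition dd :: "'a::real_normed_vector \<Rightarrow> ('a \<Rightarrow> 'b::real_normed_vector) \<Rightarrow> 'a \<Rightarrow> 'b" where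
  "dd v f = (\<lambda>x. frechet_derivative f (at x) v)"

lemma pd_eq_dd: "pd j f = dd (axis j 1) f"
  by (simp add: pd_def dd_def fun_eq_iff)

text \<open>The last entry of the list is the direction differentiated first; peeling it off trades
  \<open>f\<close> for \<open>dd v f\<close>, which is what inductions over direction lists
  need.\<close>

lemma iter_dderiv_snoc: "iter_dderiv (vs @ [v]) f = iter_dderiv vs (dd v f)"
  by (induction vs) (simp_all add: dd_def)

lemma smooth_differentiable: "smooth f \<Longrightarrow> f differentiable (at x)"
  using iter_dderiv.simps(1) unfolding smooth_def by metis

lemma smooth_dd: "smooth f \<Longrightarrow> smooth (dd v f)"
  unfolding smooth_def iter_dderiv_snoc[symmetric] by blast

lemma smooth_pd: "smooth f \<Longrightarrow> smooth (pd j f)"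
  unfolding pd_eq_dd by (rule smooth_dd)

text \<open>Induction from the end of the list of directions. A smoothness proof is thereby reduced
  to naming a family of differentiable functions that is closed under directional
  derivatives.\<close>

lemma smooth_coinduct [consumes 1, case_names step]:
  assumes "P f" and "\<And>f. P f \<Longrightarrow> (\<forall>x. f differentiable (at x)) \<and> (\<forall>v. P (dd v f))"
  shows "smooth f"
proof -
  have "P f \<Longrightarrow> iter_dderiv vs f differentiable (at x)" for vs f x
  proof (induction vs arbitrary: f rule: rev_induct)
    case (snoc v vs)
    then show ?case using assms(2) by (simp add: iter_dderiv_snoc)
  qed (use assms(2) in simp)
  then show ?thesis using assms(1) by (simp add: smooth_def)
qed

lemma smooth_has_derivative: "smooth f \<Longrightarrow> (f has_derivative (\<lambda>v. dd v f x)) (at x)"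
  unfolding dd_def using smooth_differentiable frechet_derivative_works by fastforce

lemma dd_eqI: "(f has_derivative f') (at x) \<Longrightarrow> dd v f x = f' v"
  unfolding dd_def using frechet_derivative_at by metis

lemma smooth_continuous_on: "smooth f \<Longrightarrow> continuous_on A f"
  by (meson continuous_at_imp_continuous_on differentiable_imp_continuous_within smooth_differentiable)

lemma smooth_const [simp]: "smooth (\<lambda>_. c)"
  by (coinduction arbitrary: c rule: smooth_coinduct) (auto intro!: exI[of _ 0] simp: fun_eq_iff dd_eqI[OF has_derivative_const])

lemma dd_compose_linear:
  assumes "bounded_linear L" "smooth f"
  shows "dd v (\<lambda>x. L (f x)) x = L (dd v f x)"
  by (rule dd_eqI[OF bounded_linear.has_derivative[OF assms(1) smooth_has_derivative[OF assms(2)]]])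

lemma smooth_compose_linear:
  assumes L: "bounded_linear L" and f: "smooth f"
  shows "smooth (\<lambda>x. L (f x))"
proof -
  have "\<exists>g. smooth g \<and> (\<lambda>x. L (f x)) = (\<lambda>x. L (g x))" using f by blast
  then show ?thesis
  proof (coinduct rule: smooth_coinduct)
    case (step h)
    then obtain g where g: "smooth g" "h = (\<lambda>x. L (g x))" by blast
    have "h differentiable (at x)" for x
      unfolding g(2) using bounded_linear.has_derivative[OF L smooth_has_derivative[OF g(1)]]
      by (auto simp: differentiable_def)
    moreover have "dd v h = (\<lambda>x. L (dd v g x))" for v
      unfolding g(2) by (rule ext) (rule dd_compose_linear[OF L g(1)])
    ultimately show ?case using smooth_dd[OF g(1)] by blast
  qed
qed

lemma smooth_bounded_linear: "bounded_linear L \<Longrightarrow> smooth L"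
proof -
  assume L: "bounded_linear L"
  have d: "(L has_derivative L) (at x)" for x
    using L by (simp add: bounded_linear_imp_has_derivative)
  then have "dd v L = (\<lambda>_. L v)" for v by (auto simp: fun_eq_iff dd_eqI)
  then have "smooth (dd v L)" for v by simp
  then have "iter_dderiv (vs @ [v]) L differentiable (at x)" for vs v x
    unfolding smooth_def iter_dderiv_snoc by simp
  moreover have "iter_dderiv [] L differentiable (at x)" for x
    using d by (auto simp: differentiable_def)
  ultimately have "iter_dderiv vs L differentiable (at x)" for vs x
    by (cases vs rule: rev_cases) blast+
  then show ?thesis by (simp add: smooth_def)
qed

lemma smooth_compose_affine:
  assumes L: "bounded_linear L" and f: "smooth f"
  shows "smooth (\<lambda>x. f (a + L x))" and "dd v (\<lambda>x. f (a + L x)) x = dd (L v) f (a + L x)"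
proof -
  have d: "((\<lambda>x. g (a + L x)) has_derivative (\<lambda>v. dd (L v) g (a + L x))) (at x)" if "smooth g" for g :: "'b \<Rightarrow> 'c" and x
  proof -
    have "((\<lambda>x. a + L x) has_derivative L) (at x)"
      using L by (auto intro!: derivative_eq_intros bounded_linear_imp_has_derivative)
    from has_derivative_compose[OF this smooth_has_derivative[OF that]] show ?thesis .
  qed
  show "dd v (\<lambda>x. f (a + L x)) x = dd (L v) f (a + L x)" by (rule dd_eqI[OF d[OF f]])
  have "\<exists>g. smooth g \<and> (\<lambda>x. f (a + L x)) = (\<lambda>x. g (a + L x))" using f by blast
  then show "smooth (\<lambda>x. f (a + L x))"
  proof (coinduct rule: smooth_coinduct)
    case (step h)
    then obtain g where g: "smooth g" "h = (\<lambda>x. g (a + L x))" by blast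
    have "h differentiable (at x)" for x
      unfolding g(2) using d[OF g(1)] by (auto simp: differentiable_def)
    moreover have "dd v h = (\<lambda>x. dd (L v) g (a + L x))" for v
      unfolding g(2) by (rule ext) (rule dd_eqI[OF d[OF g(1)]])
    ultimately show ?case using smooth_dd[OF g(1)] by blast
  qed
qed

text \<open>The Leibniz rule turns a product into a sum of products, so products alone are not
  closed under \<open>dd\<close>. The algebra generated by the smooth functions is, and coinduction
  applies to it.\<close>

inductive smooth_alg :: "('a::real_normed_vector \<Rightarrow> real) \<Rightarrow> bool" where
  base: "smooth f \<Longrightarrow> smooth_alg f"
| add: "smooth_alg f \<Longrightarrow> smooth_alg g \<Longrightarrow> smooth_alg (\<lambda>x. f x + g x)"
| mult: "smooth_alg f \<Longrightarrow> smooth_alg g \<Longrightarrow> smooth_alg (\<lambda>x. f x * g x)"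

lemma smooth_alg_step: "smooth_alg f \<Longrightarrow> (\<forall>x. f differentiable (at x)) \<and> (\<forall>v. smooth_alg (dd v f))"
proof (induction rule: smooth_alg.induct)
  case (base f)
  then show ?case by (auto intro: smooth_differentiable smooth_dd smooth_alg.base)
next
  case (add f g)
  have d: "(h has_derivative (\<lambda>v. dd v h x)) (at x)" if "h = f \<or> h = g" for h x
    unfolding dd_def using that add.IH frechet_derivative_works by fastforce
  have "dd v (\<lambda>x. f x + g x) = (\<lambda>x. dd v f x + dd v g x)" for v
    by (rule ext, rule dd_eqI) (auto intro!: derivative_intros d)
  then show ?case using add by (auto intro: smooth_alg.add)
next
  case (mult f g)
  have d: "(h has_derivative (\<lambda>v. dd v h x)) (at x)" if "h = f \<or> h = g" for h x
    unfolding dd_def using that mult.IH frechet_derivative_works by fastforce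
  have "dd v (\<lambda>x. f x * g x) = (\<lambda>x. f x * dd v g x + dd v f x * g x)" for v
    by (rule ext, rule dd_eqI) (auto intro!: derivative_eq_intros d)
  then show ?case using mult by (auto intro!: smooth_alg.intros(2,3))
qed

lemma smooth_alg_smooth: "smooth_alg f \<Longrightarrow> smooth f"
  by (rule smooth_coinduct[where P = smooth_alg]) (auto dest: smooth_alg_step)

lemma smooth_add [simp]: "smooth f \<Longrightarrow> smooth g \<Longrightarrow> smooth (\<lambda>x. f x + g x :: real)"
  and smooth_mult [simp]: "smooth f \<Longrightarrow> smooth g \<Longrightarrow> smooth (\<lambda>x. f x * g x :: real)"
  by (auto intro!: smooth_alg_smooth smooth_alg.intros(2,3) intro: smooth_alg.base)

lemma smooth_uminus [simp]: "smooth f \<Longrightarrow> smooth (\<lambda>x. - f x :: real)"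
  using smooth_mult[of "\<lambda>_. -1" f] by simp

lemma smooth_diff [simp]: "smooth f \<Longrightarrow> smooth g \<Longrightarrow> smooth (\<lambda>x. f x - g x :: real)"
  using smooth_add[of f "\<lambda>x. - g x"] by simp

lemma dd_add: "smooth f \<Longrightarrow> smooth g \<Longrightarrow> dd v (\<lambda>x. f x + g x) x = dd v f x + dd v g x"
  by (rule dd_eqI) (auto intro!: derivative_intros smooth_has_derivative)

lemma dd_mult: "smooth f \<Longrightarrow> smooth g \<Longrightarrow> dd v (\<lambda>x. f x * g x :: real) x = f x * dd v g x + dd v f x * g x"
  by (rule dd_eqI) (auto intro!: derivative_eq_intros smooth_has_derivative)

lemma smooth_nth [simp]: "smooth (\<lambda>p :: real^'n::finite. p $ k)"
  by (rule smooth_bounded_linear) (rule bounded_linear_vec_nth)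

lemma dd_nth: "dd v (\<lambda>p :: real^'n::finite. p $ k) x = v $ k"
  by (rule dd_eqI[OF bounded_linear_imp_has_derivative[OF bounded_linear_vec_nth]])

text \<open>Differentiation maps the span of the two functions to itself; the coefficients stay
  arbitrary so that this span can serve as the family for coinduction.\<close>

lemma smooth_trig:
  fixes k :: "'n::finite"
  shows "smooth (\<lambda>p :: real^'n. a * cos (p $ k) + b * sin (p $ k))"
    and dd_trig: "dd v (\<lambda>p :: real^'n. a * cos (p $ k) + b * sin (p $ k)) x = v $ k * (b * cos (x $ k) - a * sin (x $ k))"
proof -
  have d: "((\<lambda>p :: real^'n. a * cos (p $ k) + b * sin (p $ k)) has_derivative
      (\<lambda>v. v $ k * (b * cos (x $ k) - a * sin (x $ k)))) (at x)" for a b x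
    by (auto intro!: derivative_eq_intros bounded_linear_imp_has_derivative[OF bounded_linear_vec_nth] simp: algebra_simps)
  show "dd v (\<lambda>p :: real^'n. a * cos (p $ k) + b * sin (p $ k)) x = v $ k * (b * cos (x $ k) - a * sin (x $ k))" for a b v x
    by (rule dd_eqI[OF d])
  have "\<exists>a b. (\<lambda>p :: real^'n. a * cos (p $ k) + b * sin (p $ k)) = (\<lambda>p. a * cos (p $ k) + b * sin (p $ k))" by blast
  then show "smooth (\<lambda>p :: real^'n. a * cos (p $ k) + b * sin (p $ k))"
  proof (coinduction arbitrary: a b rule: smooth_coinduct)
    case step
    have "dd v (\<lambda>p :: real^'n. a * cos (p $ k) + b * sin (p $ k)) = (\<lambda>p. (v $ k * b) * cos (p $ k) + (- v $ k * a) * sin (p $ k))" for v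
      by (rule ext, subst dd_eqI[OF d]) (simp add: algebra_simps)
    then show ?case using d unfolding differentiable_def by blast
  qed
qed

lemma smooth_cos [simp]: "smooth (\<lambda>p :: real^'n::finite. cos (p $ k))"
  and smooth_sin [simp]: "smooth (\<lambda>p :: real^'n::finite. sin (p $ k))"
  using smooth_trig[where a = 1 and b = 0 and k = k] smooth_trig[where a = 0 and b = 1 and k = k] by simp_all

lemma smooth_line_derivative:
  assumes "smooth f"
  shows "((\<lambda>t. f (x + t *\<^sub>R v)) has_vector_derivative dd v f (x + t *\<^sub>R v)) (at t)"
proof -
  have "((\<lambda>t. x + t *\<^sub>R v) has_derivative (\<lambda>t. t *\<^sub>R v)) (at t)"
    by (auto intro!: derivative_eq_intros)
  from has_derivative_compose[OF this smooth_has_derivative[OF assms]]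
  have "((\<lambda>t. f (x + t *\<^sub>R v)) has_derivative (\<lambda>s. dd (s *\<^sub>R v) f (x + t *\<^sub>R v))) (at t)" .
  moreover have "dd (s *\<^sub>R v) f y = s *\<^sub>R dd v f y" for s y
    using linear_scale[OF has_derivative_linear[OF smooth_has_derivative[OF assms]]] by blast
  ultimately show ?thesis by (simp add: has_vector_derivative_def)
qed

text \<open>The second difference of \<open>f\<close> over the parallelogram spanned by
  \<open>h\<close> times \<open>v\<close> and \<open>h\<close> times \<open>w\<close> is symmetric
  in the two directions, and two uses of the mean value theorem express it through either mixed
  derivative at a nearby point. Continuity gives the limit.\<close>

lemma dd_commute_real:
  fixes f :: "'a::real_normed_vector \<Rightarrow> real"
  assumes f: "smooth f"
  shows "dd v (dd w f) x = dd w (dd v f) x"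
proof -
  have MVT: "\<exists>z. 0 < z \<and> z < h \<and> g h - g 0 = h * g' z"
    if "h > 0" "\<And>t. (g has_real_derivative g' t) (at t)" for g g' :: "real \<Rightarrow> real" and h
    using MVT2[of 0 h g g'] that by auto
  have key: "\<exists>s t. 0 < s \<and> s < h \<and> 0 < t \<and> t < h \<and>
      f (x + h *\<^sub>R v + h *\<^sub>R w) - f (x + h *\<^sub>R v) - f (x + h *\<^sub>R w) + f x = h * (h * dd w (dd v f) (x + s *\<^sub>R v + t *\<^sub>R w))"
    if h: "h > 0" for h and v w
  proof -
    have line: "((\<lambda>t. g (y + t *\<^sub>R u)) has_real_derivative dd u g (y + t *\<^sub>R u)) (at t)"
      if "smooth g" for g :: "'a \<Rightarrow> real" and y u t
      using smooth_line_derivative[OF that] by (simp add: has_real_derivative_iff_has_vector_derivative)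
    have "((\<lambda>s. f ((x + h *\<^sub>R w) + s *\<^sub>R v) - f (x + s *\<^sub>R v)) has_real_derivative
        dd v f ((x + h *\<^sub>R w) + s *\<^sub>R v) - dd v f (x + s *\<^sub>R v)) (at s)" for s
      by (intro DERIV_diff line f)
    from MVT[OF h this] obtain s where s: "0 < s" "s < h" and
      1: "f (x + h *\<^sub>R w + h *\<^sub>R v) - f (x + h *\<^sub>R v) - (f (x + h *\<^sub>R w) - f x)
        = h * (dd v f (x + h *\<^sub>R w + s *\<^sub>R v) - dd v f (x + s *\<^sub>R v))" by auto
    from MVT[OF h line[OF smooth_dd[OF f, of v], of "x + s *\<^sub>R v" w]] obtain t where
      t: "0 < t" "t < h" "dd v f (x + s *\<^sub>R v + h *\<^sub>R w) - dd v f (x + s *\<^sub>R v) = h * dd w (dd v f) (x + s *\<^sub>R v + t *\<^sub>R w)"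
      by auto
    show ?thesis
      using s t(1,2) 1 t(3) by (intro exI[of _ s] exI[of _ t]) (simp add: algebra_simps)
  qed
  define h where "h = (\<lambda>n. 1 / real (Suc n))"
  have hpos: "h n > 0" for n by (simp add: h_def)
  have h0: "h \<longlonglongrightarrow> 0" unfolding h_def using LIMSEQ_inverse_real_of_nat by (simp add: inverse_eq_divide)
  have lim: "\<exists>X. X \<longlonglongrightarrow> dd w (dd v f) x \<and>
      (\<forall>n. f (x + h n *\<^sub>R v + h n *\<^sub>R w) - f (x + h n *\<^sub>R v) - f (x + h n *\<^sub>R w) + f x = h n * (h n * X n))" for v w
  proof -
    obtain s t where st: "\<And>n. 0 < s n \<and> s n < h n \<and> 0 < t n \<and> t n < h n \<and>
      f (x + h n *\<^sub>R v + h n *\<^sub>R w) - f (x + h n *\<^sub>R v) - f (x + h n *\<^sub>R w) + f x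
        = h n * (h n * dd w (dd v f) (x + s n *\<^sub>R v + t n *\<^sub>R w))"
      using key[OF hpos, of _ v w] by metis
    have "s \<longlonglongrightarrow> 0" "t \<longlonglongrightarrow> 0"
      using st by (auto intro!: tendsto_sandwich[OF _ _ tendsto_const h0] always_eventually less_imp_le)
    then have "(\<lambda>n. x + s n *\<^sub>R v + t n *\<^sub>R w) \<longlonglongrightarrow> x + 0 *\<^sub>R v + 0 *\<^sub>R w"
      by (intro tendsto_intros)
    moreover have "isCont (dd w (dd v f)) (x + 0 *\<^sub>R v + 0 *\<^sub>R w)"
      using differentiable_imp_continuous_within smooth_differentiable smooth_dd f by blast
    ultimately have "(\<lambda>n. dd w (dd v f) (x + s n *\<^sub>R v + t n *\<^sub>R w)) \<longlonglongrightarrow> dd w (dd v f) (x + 0 *\<^sub>R v + 0 *\<^sub>R w)"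
      using isCont_tendsto_compose by blast
    then show ?thesis using st by (intro exI[of _ "\<lambda>n. dd w (dd v f) (x + s n *\<^sub>R v + t n *\<^sub>R w)"]) simp
  qed
  obtain X where X: "X \<longlonglongrightarrow> dd w (dd v f) x" "\<And>n. f (x + h n *\<^sub>R v + h n *\<^sub>R w) - f (x + h n *\<^sub>R v) - f (x + h n *\<^sub>R w) + f x = h n * (h n * X n)"
    using lim[where v=v and w=w] by blast
  obtain Y where Y: "Y \<longlonglongrightarrow> dd v (dd w f) x" "\<And>n. f (x + h n *\<^sub>R w + h n *\<^sub>R v) - f (x + h n *\<^sub>R w) - f (x + h n *\<^sub>R v) + f x = h n * (h n * Y n)"
    using lim[where v=w and w=v] by blast
  have "h n * (h n * X n) = h n * (h n * Y n)" for n
    using X(2)[of n] Y(2)[of n] by (simp add: algebra_simps)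
  then have "X = Y" using hpos by (simp add: fun_eq_iff less_imp_neq[symmetric])
  then show ?thesis using X(1) Y(1) LIMSEQ_unique by blast
qed

lemma dd_commute:
  fixes f :: "'a::real_normed_vector \<Rightarrow> 'b::euclidean_space"
  assumes f: "smooth f"
  shows "dd v (dd w f) x = dd w (dd v f) x"
proof (rule euclidean_eqI)
  fix b :: 'b
  have L: "bounded_linear (\<lambda>y. y \<bullet> b)" by (rule bounded_linear_inner_left)
  have e: "dd w (\<lambda>x. g x \<bullet> b) = (\<lambda>x. dd w g x \<bullet> b)" if "smooth g" for g :: "'a \<Rightarrow> 'b" and w
    using dd_compose_linear[OF L that] by blast
  show "dd v (dd w f) x \<bullet> b = dd w (dd v f) x \<bullet> b"
    using dd_commute_real[OF smooth_compose_linear[OF L f], of v w x]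
    by (simp add: e f smooth_dd)
qed

section \<open>Integration by parts on the cylinder\<close>

text \<open>One angular period times a cube: a compact set of representatives for functions that are
  periodic and, far out, independent of the flat coordinates.\<close>

definition Kbox :: "'n::finite \<Rightarrow> real \<Rightarrow> (real^'n) set" where
  "Kbox i0 B = cbox (\<chi> j. if j = i0 then 0 else - B) (\<chi> j. if j = i0 then 2 * pi else B)"

definition far :: "'n::finite \<Rightarrow> real \<Rightarrow> real^'n \<Rightarrow> bool" where
  "far i0 B p \<longleftrightarrow> (\<exists>j. j \<noteq> i0 \<and> \<bar>p $ j\<bar> > B)"

lemma mem_Kbox: "p \<in> Kbox i0 B \<longleftrightarrow> 0 \<le> p $ i0 \<and> p $ i0 \<le> 2 * pi \<and> (\<forall>j. j \<noteq> i0 \<longrightarrow> \<bar>p $ j\<bar> \<le> B)"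
proof -
  have "p \<in> Kbox i0 B \<longleftrightarrow> (\<forall>j. if j = i0 then 0 \<le> p $ j \<and> p $ j \<le> 2 * pi else \<bar>p $ j\<bar> \<le> B)"
    unfolding Kbox_def mem_box_cart by (intro all_cong1) auto
  then show ?thesis by auto
qed

lemma periodic_in_int:
  assumes "periodic_in i0 f"
  shows "f (p + (of_int m * (2 * pi)) *\<^sub>R axis i0 1) = f p"
proof (induction m rule: int_induct[where k = 0])
  case (step1 m)
  have "p + (of_int (m + 1) * (2 * pi)) *\<^sub>R axis i0 1 = (p + (of_int m * (2 * pi)) *\<^sub>R axis i0 1) + (2 * pi) *\<^sub>R axis i0 1"
    by (simp add: algebra_simps)
  then show ?case using step1 assms unfolding periodic_in_def by metis
next
  case (step2 m)
  have "p + (of_int m * (2 * pi)) *\<^sub>R axis i0 1 = (p + (of_int (m - 1) * (2 * pi)) *\<^sub>R axis i0 1) + (2 * pi) *\<^sub>R axis i0 1"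
    by (simp add: algebra_simps)
  then show ?case using step2 assms unfolding periodic_in_def by metis
qed simp

text \<open>A multiple of 2 pi moves the point into one angular period. If it is then
  \<open>far\<close>, all its flat coordinates are replaced by \<open>B + 1\<close>, which keeps it
  \<open>far\<close>; this is why the box reaches to \<open>B + 1\<close> instead of
  \<open>B\<close>.\<close>

lemma reduce_to_Kbox:
  fixes f :: "real^'n::finite \<Rightarrow> 'b"
  assumes per: "periodic_in i0 f" and B: "B \<ge> 0"
    and inv: "\<And>p q. far i0 B p \<Longrightarrow> far i0 B q \<Longrightarrow> p $ i0 = q $ i0 \<Longrightarrow> f p = f q"
  shows "\<exists>q\<in>Kbox i0 (B + 1). f p = f q"
proof -
  define m where "m = - \<lfloor>p $ i0 / (2 * pi)\<rfloor>"
  define q where "q = p + (of_int m * (2 * pi)) *\<^sub>R axis i0 1"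
  have fq: "f p = f q" unfolding q_def by (rule periodic_in_int[OF per, symmetric])
  have "q $ i0 = 2 * pi * frac (p $ i0 / (2 * pi))"
    by (simp add: q_def m_def frac_def algebra_simps)
  then have q0: "0 \<le> q $ i0" "q $ i0 \<le> 2 * pi"
    using frac_ge_0[of "p $ i0 / (2 * pi)"] frac_lt_1[of "p $ i0 / (2 * pi)"]
    by (auto intro: mult_left_le order.strict_implies_order)
  show ?thesis
  proof (cases "far i0 B q")
    case False
    then have "q \<in> Kbox i0 (B + 1)"
      using q0 unfolding mem_Kbox far_def by (force simp: not_less)
    then show ?thesis using fq by blast
  next
    case True
    define r :: "real^'n" where "r = (\<chi> j. if j = i0 then q $ i0 else B + 1)"
    have "far i0 B r" using True B by (auto simp: far_def r_def)
    then have "f q = f r" by (intro inv True) (simp_all add: r_def)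
    moreover have "r \<in> Kbox i0 (B + 1)" using q0 B by (simp add: mem_Kbox r_def)
    ultimately show ?thesis using fq by auto
  qed
qed

text \<open>Smooth functions of compact support on the cylinder, seen as periodic functions of the
  parameters. \<open>psmooth\<close> drops the support condition and supplies the multipliers, such
  as coordinates and trigonometric functions.\<close>

definition csmooth :: "'n::finite \<Rightarrow> (real^'n \<Rightarrow> real) \<Rightarrow> bool" where
  "csmooth i0 f \<longleftrightarrow> smooth f \<and> periodic_in i0 f \<and> (\<exists>B. \<forall>p. far i0 B p \<longrightarrow> f p = 0)"

definition psmooth :: "'n::finite \<Rightarrow> (real^'n \<Rightarrow> real) \<Rightarrow> bool" where
  "psmooth i0 f \<longleftrightarrow> smooth f \<and> periodic_in i0 f"

lemma csmoothD: "csmooth i0 f \<Longrightarrow> smooth f" "csmooth i0 f \<Longrightarrow> periodic_in i0 f" "csmooth i0 f \<Longrightarrow> psmooth i0 f"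
  and psmoothD: "psmooth i0 f \<Longrightarrow> smooth f" "psmooth i0 f \<Longrightarrow> periodic_in i0 f"
  by (auto simp: csmooth_def psmooth_def)

lemma smooth_measurable: "smooth (f :: 'a::euclidean_space \<Rightarrow> real) \<Longrightarrow> f \<in> borel_measurable borel"
  by (intro borel_measurable_continuous_onI smooth_continuous_on)

lemma csmooth_bddm: assumes f: "csmooth i0 f" shows "bddm f"
proof -
  obtain B0 where B0: "\<And>p. far i0 B0 p \<Longrightarrow> f p = 0" using f by (auto simp: csmooth_def)
  define B where "B = \<bar>B0\<bar>"
  have B: "f p = 0" if "far i0 B p" for p
    using that B0[of p] unfolding far_def B_def by force
  have "compact (f ` Kbox i0 (B + 1))"
    by (intro compact_continuous_image smooth_continuous_on csmoothD[OF f]) (simp add: Kbox_def)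
  then obtain C where C: "\<And>p. p \<in> Kbox i0 (B + 1) \<Longrightarrow> \<bar>f p\<bar> \<le> C"
    using compact_imp_bounded bounded_iff by (metis imageI real_norm_def)
  have "\<exists>q\<in>Kbox i0 (B + 1). f p = f q" for p
    by (rule reduce_to_Kbox) (use csmoothD[OF f] B in \<open>auto simp: B_def\<close>)
  then have "\<bar>f p\<bar> \<le> C" for p using C by metis
  then show ?thesis using smooth_measurable[OF csmoothD(1)[OF f]] by (auto simp: bddm_def)
qed

lemma upd_derivative:
  assumes "smooth f"
  shows "((\<lambda>t. f (upd p k t)) has_vector_derivative pd k f (upd p k t)) (at t)"
proof -
  define q where "q = p - (p $ k) *\<^sub>R axis k 1"
  have "upd p k t = q + t *\<^sub>R axis k 1" for t
    by (simp add: upd_def q_def algebra_simps)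
  then show ?thesis
    using smooth_line_derivative[OF assms, of q "axis k 1" t] by (simp add: pd_eq_dd)
qed

lemma periodic_in_pd:
  assumes "smooth f" "periodic_in i0 f" shows "periodic_in i0 (pd k f)"
proof -
  have "(\<lambda>p. f ((2 * pi) *\<^sub>R axis i0 1 + p)) = f"
    using assms(2) by (auto simp: periodic_in_def add.commute)
  then have "dd v f p = dd v f ((2 * pi) *\<^sub>R axis i0 1 + p)" for v p
    using smooth_compose_affine(2)[OF bounded_linear_ident assms(1), of v "(2 * pi) *\<^sub>R axis i0 1" p] by simp
  then show ?thesis by (simp add: periodic_in_def pd_eq_dd add.commute)
qed

lemma open_far: "open {p :: real^'n::finite. far i0 B p}"
proof -
  have "{p :: real^'n. far i0 B p} = (\<Union>j\<in>-{i0}. {p. \<bar>p $ j\<bar> > B})" by (auto simp: far_def)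
  then show ?thesis by (auto intro!: open_UN open_Collect_less continuous_intros)
qed

lemma dd_cong_open:
  assumes "open S" "x \<in> S" "\<And>y. y \<in> S \<Longrightarrow> f y = g y" "smooth f"
  shows "dd v f x = dd v g x"
proof -
  have "(g has_derivative (\<lambda>v. dd v f x)) (at x)"
    by (rule has_derivative_transform_within_open[OF smooth_has_derivative[OF assms(4)] assms(1,2)]) (use assms(3) in auto)
  then show ?thesis by (simp add: dd_eqI)
qed

lemma csmooth_pd [simp]: assumes f: "csmooth i0 f" shows "csmooth i0 (pd k f)"
proof -
  obtain B where B: "\<And>p. far i0 B p \<Longrightarrow> f p = 0" using f by (auto simp: csmooth_def)
  have "pd k f p = 0" if "far i0 B p" for p
    using dd_cong_open[OF open_far[of i0 B], of p f "\<lambda>_. 0" "axis k 1"] that B csmoothD(1)[OF f]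
      dd_eqI[OF has_derivative_const[of 0 "at p"], of "axis k 1"]
    by (simp add: pd_eq_dd)
  then show ?thesis
    using f by (auto simp: csmooth_def intro!: smooth_pd periodic_in_pd)
qed

lemma csmooth_mult: "csmooth i0 f \<Longrightarrow> psmooth i0 g \<Longrightarrow> csmooth i0 (\<lambda>p. g p * f p)"
  unfolding csmooth_def psmooth_def by (auto simp: periodic_in_def)

lemma csmooth_cmult: "csmooth i0 f \<Longrightarrow> csmooth i0 (\<lambda>p. c * f p)"
  by (rule csmooth_mult) (auto simp: psmooth_def periodic_in_def)

lemma csmooth_add: assumes "csmooth i0 f" "csmooth i0 g" shows "csmooth i0 (\<lambda>p. f p + g p)"
proof -
  obtain B where B: "\<And>p. far i0 B p \<Longrightarrow> f p = 0" using assms by (auto simp: csmooth_def)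
  obtain C where C: "\<And>p. far i0 C p \<Longrightarrow> g p = 0" using assms by (auto simp: csmooth_def)
  have "far i0 (max B C) p \<Longrightarrow> far i0 B p \<and> far i0 C p" for p by (auto simp: far_def)
  then have "\<forall>p. far i0 (max B C) p \<longrightarrow> f p + g p = 0" using B C by simp
  then show ?thesis using assms unfolding csmooth_def by (auto simp: periodic_in_def)
qed

lemma csmooth_diff: "csmooth i0 f \<Longrightarrow> csmooth i0 g \<Longrightarrow> csmooth i0 (\<lambda>p. f p - g p)"
  using csmooth_add[OF _ csmooth_cmult[of i0 g "-1"]] by simp

lemma psmooth_pd: "psmooth i0 f \<Longrightarrow> psmooth i0 (pd k f)"
  by (auto simp: psmooth_def intro: smooth_pd periodic_in_pd)

lemma csmooth_pdp: "csmooth i0 f \<Longrightarrow> pdp k f (pd k f)"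
  unfolding pdp_def
  using upd_derivative[OF csmoothD(1)] csmooth_bddm csmooth_bddm[OF csmooth_pd]
  by (auto simp: has_real_derivative_iff_has_vector_derivative)

section \<open>The weighted divergence and its commutator with the frame derivatives\<close>

definition Dk :: "'n::finite \<Rightarrow> 'n \<Rightarrow> (real^'n \<Rightarrow> real) \<Rightarrow> real^'n \<Rightarrow> real" where
  "Dk i0 k f p = lam i0 k * pd k f p"

text \<open>The coefficients of the tangential part of the position vector.\<close>

definition Yk :: "'n::finite \<Rightarrow> 'n \<Rightarrow> real^'n \<Rightarrow> real" where
  "Yk i0 k p = (if k = i0 then 0 else p $ k)"

text \<open>The weighted divergence of \<open>f\<close> times the \<open>k\<close>-th unit frame
  vector; the second term is the logarithmic derivative of the weight. Thus \<open>del\<close> is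
  minus the adjoint of \<open>Dk\<close>, in the relation of creation and annihilation
  operators.\<close>

definition del :: "'n::finite \<Rightarrow> 'n \<Rightarrow> (real^'n \<Rightarrow> real) \<Rightarrow> real^'n \<Rightarrow> real" where
  "del i0 k f p = Dk i0 k f p - Yk i0 k p / 2 * f p"

lemma psmooth_Yk: "psmooth i0 (Yk i0 k)"
  unfolding psmooth_def periodic_in_def Yk_def[abs_def]
  by (cases "k = i0") (auto simp: axis_def)

lemma csmooth_Dk: "csmooth i0 f \<Longrightarrow> csmooth i0 (Dk i0 k f)"
  unfolding Dk_def[abs_def] by (intro csmooth_cmult csmooth_pd)

lemma csmooth_del: "csmooth i0 f \<Longrightarrow> csmooth i0 (del i0 k f)"
proof -
  assume f: "csmooth i0 f"
  have "csmooth i0 (\<lambda>p. Dk i0 k f p - 1 / 2 * (Yk i0 k p * f p))"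
    by (intro csmooth_diff csmooth_Dk csmooth_cmult csmooth_mult f psmooth_Yk)
  then show ?thesis by (simp add: del_def[abs_def])
qed

lemma integral_del:
  assumes f: "csmooth i0 f"
  shows "(\<integral>p. del i0 k f p \<partial>cmeas i0) = 0"
proof -
  note pf = csmooth_pdp[OF f, of k]
  have "avg i0 k (del i0 k f) p = 0" for p
  proof (cases "k = i0")
    case True
    obtain C where C: "\<And>p. \<bar>pd k f p\<bar> \<le> C" using pdpD(2)[OF pf] by (auto simp: bddm_def)
    have "(\<integral>t. pd k f (upd p k t) \<partial>circ) = 0"
      using periodic_slice[OF csmoothD(2)[OF f], of p 0] True C
      by (intro circ_integral_deriv_periodic[OF pdpD(3)[OF pf] bddmD[OF bddm_slice[OF pdpD(2)[OF pf]]], where C = C]) auto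
    then show ?thesis unfolding avg_def using True
      by (simp add: marg_def del_def Dk_def Yk_def)
  next
    case False
    obtain C where C: "\<And>p. \<bar>pd k f p\<bar> \<le> C" using pdpD(2)[OF pf] by (auto simp: bddm_def)
    obtain B where B: "\<And>p. far i0 B p \<Longrightarrow> f p = 0" using f by (auto simp: csmooth_def)
    have "(\<integral>t. pd k f (upd p k t) - t / 2 * f (upd p k t) \<partial>gauss) = 0"
    proof (rule gauss_integration_by_parts[OF pdpD(3)[OF pf] bddmD[OF bddm_slice[OF pdpD(2)[OF pf]]], where C = C and B = B])
      fix t assume "B < \<bar>t\<bar>"
      then have "far i0 B (upd p k t)" using False by (auto simp: far_def upd_nth)
      then show "f (upd p k t) = 0" by (rule B)
    qed (rule C)
    then show ?thesis unfolding avg_def using False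
      by (simp add: marg_def del_def Dk_def Yk_def lam_def upd_nth)
  qed
  then show ?thesis
    using integral_cmeas_avg[OF csmooth_bddm[OF csmooth_del[OF f]], of i0 k k] by simp
qed

lemma Dk_mult: "smooth f \<Longrightarrow> smooth g \<Longrightarrow> Dk i0 k (\<lambda>p. g p * f p) p = g p * Dk i0 k f p + f p * Dk i0 k g p"
  by (simp add: Dk_def pd_eq_dd dd_mult algebra_simps)

lemma integral_mult_del:
  assumes f: "csmooth i0 f" and g: "psmooth i0 g"
  shows "(\<integral>p. g p * del i0 k f p \<partial>cmeas i0) = - (\<integral>p. f p * Dk i0 k g p \<partial>cmeas i0)"
proof -
  have "del i0 k (\<lambda>p. g p * f p) p = g p * del i0 k f p + f p * Dk i0 k g p" for p
    using Dk_mult[OF csmoothD(1)[OF f] psmoothD(1)[OF g]] by (simp add: del_def algebra_simps)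
  then have "(\<integral>p. g p * del i0 k f p + f p * Dk i0 k g p \<partial>cmeas i0) = 0"
    using integral_del[OF csmooth_mult[OF f g], of k] by simp
  moreover have "bddm (\<lambda>p. g p * del i0 k f p)"
    by (rule csmooth_bddm[OF csmooth_mult[OF csmooth_del[OF f] g]])
  moreover have "bddm (\<lambda>p. f p * Dk i0 k g p)"
  proof -
    have "csmooth i0 (\<lambda>p. lam i0 k * (pd k g p * f p))"
      by (intro csmooth_cmult csmooth_mult f psmooth_pd g)
    then show ?thesis using csmooth_bddm by (simp add: Dk_def algebra_simps)
  qed
  ultimately show ?thesis by (simp add: integrable_cmeas)
qed

text \<open>Mixed partial derivatives commute, so only the derivative of \<open>Yk / 2\<close>
  survives in the commutator: 1/2 on the flat diagonal, 0 in the angle.\<close>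

lemma Dk_del:
  assumes f: "smooth f"
  shows "Dk i0 i (del i0 j f) p = del i0 j (Dk i0 i f) p - (if i = j \<and> i \<noteq> i0 then f p / 2 else 0)"
proof -
  have sY: "smooth (Yk i0 j)" using psmooth_Yk psmoothD by blast
  have e: "del i0 j f = (\<lambda>p. lam i0 j * dd (axis j 1) f p + (- 1 / 2) * (Yk i0 j p * f p))"
    by (auto simp: del_def Dk_def pd_eq_dd)
  have e2: "Dk i0 i f = (\<lambda>p. lam i0 i * dd (axis i 1) f p)"
    by (auto simp: Dk_def pd_eq_dd)
  have dc: "dd v (\<lambda>p. c * g p) p = c * dd v g p" if "smooth g" for c v p and g :: "real^'a \<Rightarrow> real"
    using dd_compose_linear[OF bounded_linear_mult_right that] by blast
  have dY: "dd (axis i 1) (Yk i0 j) p = (if i = j \<and> i \<noteq> i0 then 1 else 0)"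
  proof (cases "j = i0")
    case True
    then have "Yk i0 j = (\<lambda>_. 0)" by (auto simp: Yk_def)
    then show ?thesis using dd_eqI[OF has_derivative_const] True by auto
  next
    case False
    then have "Yk i0 j = (\<lambda>p. p $ j)" by (auto simp: Yk_def)
    then show ?thesis using False by (auto simp: dd_nth axis_def)
  qed
  have "Dk i0 i (del i0 j f) p = lam i0 i * (lam i0 j * dd (axis i 1) (dd (axis j 1) f) p
      - 1 / 2 * (Yk i0 j p * dd (axis i 1) f p + (if i = j \<and> i \<noteq> i0 then f p else 0)))"
  proof -
    have s: "smooth (\<lambda>p. lam i0 j * dd (axis j 1) f p)" "smooth (\<lambda>p. Yk i0 j p * f p)"
      "smooth (\<lambda>p. (- 1 / 2) * (Yk i0 j p * f p))"
      by (intro smooth_mult smooth_const smooth_dd f sY)+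
    have "dd (axis i 1) (del i0 j f) p = lam i0 j * dd (axis i 1) (dd (axis j 1) f) p
        + (- 1 / 2) * (Yk i0 j p * dd (axis i 1) f p + dd (axis i 1) (Yk i0 j) p * f p)"
      unfolding e dd_add[OF s(1,3)] dc[OF smooth_dd[OF f]] dc[OF s(2)] dd_mult[OF sY f] by simp
    then show ?thesis by (subst Dk_def) (auto simp: pd_eq_dd dY)
  qed
  moreover have "del i0 j (Dk i0 i f) p = lam i0 j * (lam i0 i * dd (axis j 1) (dd (axis i 1) f) p)
      - Yk i0 j p / 2 * (lam i0 i * dd (axis i 1) f p)"
    unfolding del_def e2 Dk_def pd_eq_dd by (simp add: dc smooth_dd f)
  moreover have "lam i0 i = 1" if "i \<noteq> i0" using that by (simp add: lam_def)
  ultimately show ?thesis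
    using dd_commute_real[OF f, of "axis i 1" "axis j 1" p] by (auto simp: algebra_simps)
qed

text \<open>One operator is moved over by parts, the two are commuted, and the other is moved back.
  In the second variation this cancels the squared divergence against products of first
  derivatives.\<close>

lemma integral_del_del:
  assumes f: "csmooth i0 f" and g: "csmooth i0 g"
  shows "(\<integral>p. del i0 i f p * del i0 j g p \<partial>cmeas i0)
    = (\<integral>p. Dk i0 j f p * Dk i0 i g p \<partial>cmeas i0) + (if i = j \<and> i \<noteq> i0 then (\<integral>p. f p * g p \<partial>cmeas i0) / 2 else 0)"
proof -
  have "(\<integral>p. del i0 i f p * del i0 j g p \<partial>cmeas i0) = (\<integral>p. del i0 j g p * del i0 i f p \<partial>cmeas i0)"
    by (simp add: mult.commute)
  also have "\<dots> = - (\<integral>p. f p * Dk i0 i (del i0 j g) p \<partial>cmeas i0)"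
    by (rule integral_mult_del[OF f csmoothD(3)[OF csmooth_del[OF g]]])
  also have "\<dots> = - (\<integral>p. f p * del i0 j (Dk i0 i g) p - (if i = j \<and> i \<noteq> i0 then f p * g p / 2 else 0) \<partial>cmeas i0)"
    by (simp add: Dk_del[OF csmoothD(1)[OF g]] right_diff_distrib if_distrib cong: if_cong)
  also have "\<dots> = - (\<integral>p. f p * del i0 j (Dk i0 i g) p \<partial>cmeas i0) + (if i = j \<and> i \<noteq> i0 then (\<integral>p. f p * g p \<partial>cmeas i0) / 2 else 0)"
    using csmooth_bddm[OF f] csmooth_bddm[OF g] csmooth_bddm[OF csmooth_del[OF csmooth_Dk[OF g]]]
    by (auto simp: integrable_cmeas)
  also have "- (\<integral>p. f p * del i0 j (Dk i0 i g) p \<partial>cmeas i0) = (\<integral>p. Dk i0 i g p * Dk i0 j f p \<partial>cmeas i0)"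
    using integral_mult_del[OF csmooth_Dk[OF g] csmoothD(3)[OF f], of j i] by simp
  finally show ?thesis by (simp add: mult.commute)
qed

lemma measure_cmeas_space [simp]: "measure (cmeas i0) (space (cmeas i0)) = 1"
  by (rule prob_space.prob_space[OF prob_space_cmeas])

lemma integral_cmeas_trig:
  fixes i0 :: "'n::finite"
  shows "(\<integral>p. cos (p $ i0) \<partial>cmeas i0) = 0" "(\<integral>p. sin (p $ i0) \<partial>cmeas i0) = 0"
    "(\<integral>p. (cos (p $ i0))\<^sup>2 \<partial>cmeas i0) = 1 / 2" "(\<integral>p. (sin (p $ i0))\<^sup>2 \<partial>cmeas i0) = 1 / 2"
    "(\<integral>p. sin (p $ i0) * cos (p $ i0) \<partial>cmeas i0) = 0"
proof -
  have "(\<integral>p. h (p $ i0) \<partial>cmeas i0) = (\<integral>t. h t \<partial>circ)" if "bddm h" for h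
    using integral_cmeas_radial[OF bddm_nth[OF that], of i0 i0 0] by (simp add: upd_nth)
  from this[of cos] this[of sin] this[of "\<lambda>x. (cos x)\<^sup>2"] this[of "\<lambda>x. (sin x)\<^sup>2"] this[of "\<lambda>x. sin x * cos x"]
  show "(\<integral>p. cos (p $ i0) \<partial>cmeas i0) = 0" "(\<integral>p. sin (p $ i0) \<partial>cmeas i0) = 0"
    "(\<integral>p. (cos (p $ i0))\<^sup>2 \<partial>cmeas i0) = 1 / 2" "(\<integral>p. (sin (p $ i0))\<^sup>2 \<partial>cmeas i0) = 1 / 2"
    "(\<integral>p. sin (p $ i0) * cos (p $ i0) \<partial>cmeas i0) = 0"
    by (simp_all add: integral_circ_trig)
qed

lemma psmooth_trig: "psmooth i0 (\<lambda>p. a * cos (p $ i0) + b * sin (p $ i0))"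
  unfolding psmooth_def periodic_in_def using smooth_trig by (auto simp: axis_def)

lemma Dk_trig: "Dk i0 k (\<lambda>p. a * cos (p $ i0) + b * sin (p $ i0)) p
    = (if k = i0 then (b * cos (p $ i0) - a * sin (p $ i0)) / sqrt 2 else 0)"
  by (auto simp: Dk_def pd_eq_dd dd_trig lam_def axis_def)

lemma sum_if_diag:
  fixes f :: "'n::finite \<Rightarrow> 'n \<Rightarrow> real"
  shows "(\<Sum>k\<in>UNIV. \<Sum>l\<in>UNIV. if k = i0 \<and> l = i0 then f k l else 0) = f i0 i0"
proof -
  have "(\<Sum>k\<in>UNIV. \<Sum>l\<in>UNIV. if k = i0 \<and> l = i0 then f k l else 0) = (\<Sum>k\<in>UNIV. if k = i0 then f i0 i0 else 0)"
    by (intro sum.cong) auto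
  then show ?thesis by simp
qed

text \<open>The analytic core, detached from the geometry. \<open>T\<close> and \<open>N\<close>
  stand for the components of the variation field, \<open>W\<close> for the tangential components of
  the acceleration, \<open>z\<close> and \<open>w\<close> for the normal part of the velocity of
  x_s, \<open>z'\<close> for its angular tangential part, \<open>h\<close> for the velocity of t_s,
  \<open>M\<close> and \<open>P\<close> for the tangential and normal parts of the derivative of the
  field. \<open>J\<close> is the integrand (E')^2 + E''.\<close>

theorem second_variation_nonneg:
  fixes T N W :: "'n::finite \<Rightarrow> real^'n \<Rightarrow> real" and i0 :: 'n
  assumes T: "\<And>k. csmooth i0 (T k)" and N: "\<And>k. csmooth i0 (N k)" and W: "\<And>k. csmooth i0 (W k)"
    and mean: "\<And>p. avg i0 i0 (N i0) p = c" and h: "h = sqrt 2 * c"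
    and w: "\<And>j. w j = (\<integral>p. N j p \<partial>cmeas i0)"
    and a: "a = 2 * (\<integral>p. N i0 p * cos (p $ i0) \<partial>cmeas i0)"
    and b: "b = 2 * (\<integral>p. N i0 p * sin (p $ i0) \<partial>cmeas i0)"
    and z: "\<And>p. z p = a * cos (p $ i0) + b * sin (p $ i0)"
    and z': "\<And>p. z' p = b * cos (p $ i0) - a * sin (p $ i0)"
    and M: "\<And>k l p. M k l p = Dk i0 k (T l) p + (if k = i0 \<and> l = i0 then N i0 p / sqrt 2 else 0)"
    and P: "\<And>k l p. P k l p = Dk i0 k (N l) p - (if k = i0 \<and> l = i0 then T i0 p / sqrt 2 else 0)"
    and J: "\<And>p. J p = ((\<Sum>k\<in>UNIV. del i0 k (T k) p) + z p / sqrt 2)\<^sup>2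
        - ((N i0 p - z p)\<^sup>2 + (T i0 p - z' p)\<^sup>2 + (\<Sum>j\<in>UNIV - {i0}. (T j p)\<^sup>2 + (N j p - w j)\<^sup>2)) / 2
        + h * sqrt 2 * (N i0 p - z p) - h\<^sup>2 / 2
        + (\<Sum>k\<in>UNIV. \<Sum>l\<in>UNIV. (P k l p)\<^sup>2) - (\<Sum>k\<in>UNIV. \<Sum>l\<in>UNIV. M k l p * M l k p)
        + (\<Sum>k\<in>UNIV. del i0 k (W k) p)"
  shows "0 \<le> (\<integral>p. J p \<partial>cmeas i0)"
proof -
  \<comment> \<open>\<open>X\<close>, \<open>Y\<close> and \<open>U\<close> gather all terms with
    \<open>T\<close> and integrate to zero by parts; only \<open>R\<close>, free of
    \<open>T\<close>, contributes.\<close>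
  define X where "X = (\<lambda>p. (\<Sum>k\<in>UNIV. \<Sum>l\<in>UNIV. del i0 k (T k) p * del i0 l (T l) p)
      - (\<Sum>k\<in>UNIV. \<Sum>l\<in>UNIV. Dk i0 l (T k) p * Dk i0 k (T l) p) - (\<Sum>j\<in>UNIV - {i0}. T j p * T j p) / 2)"
  define Y where "Y = (\<lambda>p. sqrt 2 * (\<Sum>k\<in>UNIV. z p * del i0 k (T k) p) + T i0 p * z' p)"
  define U where "U = (\<lambda>p. del i0 i0 (\<lambda>p. N i0 p * T i0 p) p)"
  define R where "R = (\<lambda>p. (\<Sum>k\<in>UNIV. \<Sum>l\<in>UNIV. (Dk i0 k (N l) p)\<^sup>2) - (N i0 p)\<^sup>2 + N i0 p * z p - (z' p)\<^sup>2 / 2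
      + h * sqrt 2 * (N i0 p - z p) - h\<^sup>2 / 2 - (\<Sum>j\<in>UNIV - {i0}. (N j p - w j)\<^sup>2) / 2)"
  note bT = csmooth_bddm[OF T] and bN = csmooth_bddm[OF N]
  note bDT = csmooth_bddm[OF csmooth_Dk[OF T]] and bDN = csmooth_bddm[OF csmooth_Dk[OF N]]
  note bdT = csmooth_bddm[OF csmooth_del[OF T]] and bdW = csmooth_bddm[OF csmooth_del[OF W]]
  have cb: "bddm (\<lambda>p :: real^'n. cos (p $ i0))" "bddm (\<lambda>p :: real^'n. sin (p $ i0))" by (auto intro!: bddm_nth)
  have zeq: "z = (\<lambda>p. a * cos (p $ i0) + b * sin (p $ i0))" "z' = (\<lambda>p. b * cos (p $ i0) - a * sin (p $ i0))"
    using z z' by auto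
  have bz: "bddm z" "bddm z'" unfolding zeq using cb by auto
  have bUN: "csmooth i0 (\<lambda>p. N i0 p * T i0 p)" by (intro csmooth_mult T csmoothD(3) N)
  have decomp: "J p = X p + Y p - sqrt 2 * U p + (\<Sum>k\<in>UNIV. del i0 k (W k) p) + R p" for p
  proof -
    have sq: "((\<Sum>k\<in>UNIV. del i0 k (T k) p) + z p / sqrt 2)\<^sup>2
        = (\<Sum>k\<in>UNIV. \<Sum>l\<in>UNIV. del i0 k (T k) p * del i0 l (T l) p) + sqrt 2 * (\<Sum>k\<in>UNIV. z p * del i0 k (T k) p) + (z p)\<^sup>2 / 2"
    proof -
      have "2 * A * (zz / sqrt 2) = sqrt 2 * (zz * A)" for A zz :: real
        by (simp add: field_simps)
      moreover have "(\<Sum>k\<in>UNIV. \<Sum>l\<in>UNIV. del i0 k (T k) p * del i0 l (T l) p) = (\<Sum>k\<in>UNIV. del i0 k (T k) p)\<^sup>2"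
        by (simp only: power2_eq_square sum_product)
      moreover have "(\<Sum>k\<in>UNIV. z p * del i0 k (T k) p) = z p * (\<Sum>k\<in>UNIV. del i0 k (T k) p)"
        by (rule sum_distrib_left[symmetric])
      ultimately show ?thesis
        by (simp add: power2_sum power_divide)
    qed
    have MM: "M k l p * M l k p = Dk i0 l (T k) p * Dk i0 k (T l) p
        + (if k = i0 \<and> l = i0 then sqrt 2 * (N i0 p * Dk i0 i0 (T i0) p) + (N i0 p)\<^sup>2 / 2 else 0)" for k l
      unfolding M by (auto simp: field_simps power2_eq_square)
    have PP: "(P k l p)\<^sup>2 = (Dk i0 k (N l) p)\<^sup>2
        + (if k = i0 \<and> l = i0 then (T i0 p)\<^sup>2 / 2 - sqrt 2 * (T i0 p * Dk i0 i0 (N i0) p) else 0)" for k l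
      unfolding P by (auto simp: field_simps power2_eq_square)
    have UU: "U p = N i0 p * Dk i0 i0 (T i0) p + T i0 p * Dk i0 i0 (N i0) p"
      unfolding U_def del_def by (simp add: Dk_mult csmoothD(1)[OF T] csmoothD(1)[OF N] Yk_def)
    have SS: "(\<Sum>j\<in>UNIV - {i0}. (T j p)\<^sup>2 + (N j p - w j)\<^sup>2) = (\<Sum>j\<in>UNIV - {i0}. (T j p)\<^sup>2) + (\<Sum>j\<in>UNIV - {i0}. (N j p - w j)\<^sup>2)"
      by (simp add: sum.distrib)
    show ?thesis
      unfolding J sq MM PP UU SS X_def Y_def R_def sum.distrib sum_if_diag power2_eq_square[symmetric, of "T _ p"]
      by (simp add: power2_diff field_simps)
  qed
  have IX: "(\<integral>p. X p \<partial>cmeas i0) = 0"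
  proof -
    have "(\<integral>p. X p \<partial>cmeas i0) = (\<Sum>k\<in>UNIV. \<Sum>l\<in>UNIV. \<integral>p. del i0 k (T k) p * del i0 l (T l) p \<partial>cmeas i0)
      - (\<Sum>k\<in>UNIV. \<Sum>l\<in>UNIV. \<integral>p. Dk i0 l (T k) p * Dk i0 k (T l) p \<partial>cmeas i0) - (\<Sum>j\<in>UNIV - {i0}. \<integral>p. T j p * T j p \<partial>cmeas i0) / 2"
      unfolding X_def using bT bdT bDT by (simp add: integrable_cmeas)
    also have "(\<Sum>k\<in>UNIV. \<Sum>l\<in>UNIV. \<integral>p. del i0 k (T k) p * del i0 l (T l) p \<partial>cmeas i0)
       = (\<Sum>k\<in>UNIV. \<Sum>l\<in>UNIV. \<integral>p. Dk i0 l (T k) p * Dk i0 k (T l) p \<partial>cmeas i0)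
        + (\<Sum>k\<in>UNIV. \<Sum>l\<in>UNIV. if k = l \<and> k \<noteq> i0 then (\<integral>p. T k p * T l p \<partial>cmeas i0) / 2 else 0)"
      by (simp add: integral_del_del T sum.distrib)
    also have "(\<Sum>k\<in>UNIV. \<Sum>l\<in>UNIV. if k = l \<and> k \<noteq> i0 then (\<integral>p. T k p * T l p \<partial>cmeas i0) / 2 else 0)
       = (\<Sum>k\<in>UNIV. if k \<noteq> i0 then (\<integral>p. T k p * T k p \<partial>cmeas i0) / 2 else 0)"
    proof (intro sum.cong refl)
      fix k
      show "(\<Sum>l\<in>UNIV. if k = l \<and> k \<noteq> i0 then (\<integral>p. T k p * T l p \<partial>cmeas i0) / 2 else 0)
          = (if k \<noteq> i0 then (\<integral>p. T k p * T k p \<partial>cmeas i0) / 2 else 0)"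
        by (cases "k = i0") auto
    qed
    also have "\<dots> = (\<Sum>k\<in>UNIV - {i0}. \<integral>p. T k p * T k p \<partial>cmeas i0) / 2"
      unfolding sum_divide_distrib by (intro sum.mono_neutral_cong_right) auto
    finally show ?thesis by simp
  qed
  have IY: "(\<integral>p. Y p \<partial>cmeas i0) = 0"
  proof -
    have "(\<integral>p. z p * del i0 k (T k) p \<partial>cmeas i0) = - (\<integral>p. T k p * (if k = i0 then z' p / sqrt 2 else 0) \<partial>cmeas i0)" for k
      using integral_mult_del[OF T psmooth_trig[of i0 a b], where k = k] unfolding Dk_trig zeq .
    then have "(\<integral>p. z p * del i0 k (T k) p \<partial>cmeas i0) = (if k = i0 then - (\<integral>p. T i0 p * z' p \<partial>cmeas i0) / sqrt 2 else 0)" for k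
      by auto
    then have "(\<Sum>k\<in>UNIV. \<integral>p. z p * del i0 k (T k) p \<partial>cmeas i0) = - (\<integral>p. T i0 p * z' p \<partial>cmeas i0) / sqrt 2"
      by simp
    then show ?thesis
      unfolding Y_def using bT bz bdT by (simp add: integrable_cmeas)
  qed
  have IU: "(\<integral>p. U p \<partial>cmeas i0) = 0" unfolding U_def by (rule integral_del[OF bUN])
  have IW: "(\<integral>p. del i0 k (W k) p \<partial>cmeas i0) = 0" for k by (rule integral_del[OF W])
  have bX: "bddm X" "bddm Y" "bddm U" "bddm R"
    unfolding X_def Y_def U_def R_def using bT bN bDT bDN bdT bz csmooth_bddm[OF csmooth_del[OF bUN]] by simp_all
  have "(\<integral>p. J p \<partial>cmeas i0) = (\<integral>p. R p \<partial>cmeas i0)"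
    unfolding decomp using bX bdW IX IY IU IW by (simp add: integrable_cmeas)
  also have "(\<integral>p. R p \<partial>cmeas i0) = (\<Sum>k\<in>UNIV. \<Sum>l\<in>UNIV. \<integral>p. (Dk i0 k (N l) p)\<^sup>2 \<partial>cmeas i0) - (\<integral>p. (N i0 p)\<^sup>2 \<partial>cmeas i0)
      + (\<integral>p. N i0 p * z p \<partial>cmeas i0) - (\<integral>p. (z' p)\<^sup>2 \<partial>cmeas i0) / 2
      + h * sqrt 2 * ((\<integral>p. N i0 p \<partial>cmeas i0) - (\<integral>p. z p \<partial>cmeas i0)) - h\<^sup>2 / 2
      - (\<Sum>j\<in>UNIV - {i0}. \<integral>p. (N j p - w j)\<^sup>2 \<partial>cmeas i0) / 2"
    unfolding R_def using bN bDN bz by (simp add: integrable_cmeas)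
  also have "(\<integral>p. N i0 p * z p \<partial>cmeas i0) = (a\<^sup>2 + b\<^sup>2) / 2"
  proof -
    have "(\<integral>p. N i0 p * z p \<partial>cmeas i0) = a * (\<integral>p. N i0 p * cos (p $ i0) \<partial>cmeas i0) + b * (\<integral>p. N i0 p * sin (p $ i0) \<partial>cmeas i0)"
      unfolding z distrib_left using bN cb by (simp add: integrable_cmeas mult.left_commute[of "N i0 _"])
    then show ?thesis using a b by (simp add: power2_eq_square field_simps)
  qed
  also have "(\<integral>p. (z' p)\<^sup>2 \<partial>cmeas i0) = (a\<^sup>2 + b\<^sup>2) / 2"
  proof -
    have "(\<integral>p. (z' p)\<^sup>2 \<partial>cmeas i0) = (\<integral>p. b\<^sup>2 * (cos (p $ i0))\<^sup>2 + a\<^sup>2 * (sin (p $ i0))\<^sup>2 - 2 * a * b * (sin (p $ i0) * cos (p $ i0)) \<partial>cmeas i0)"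
      unfolding z' by (rule Bochner_Integration.integral_cong) (auto simp: power2_eq_square algebra_simps)
    also have "\<dots> = (a\<^sup>2 + b\<^sup>2) / 2"
      using cb by (simp add: integrable_cmeas integral_cmeas_trig)
    finally show ?thesis .
  qed
  also have "(\<integral>p. z p \<partial>cmeas i0) = 0"
    unfolding z using cb by (simp add: integrable_cmeas integral_cmeas_trig)
  also have "(\<integral>p. N i0 p \<partial>cmeas i0) = c"
    using integral_cmeas_avg[OF bN[of i0], of i0 i0] mean by simp
  finally have JR: "(\<integral>p. J p \<partial>cmeas i0) = (\<Sum>k\<in>UNIV. \<Sum>l\<in>UNIV. \<integral>p. (Dk i0 k (N l) p)\<^sup>2 \<partial>cmeas i0)
      - (\<integral>p. (N i0 p)\<^sup>2 \<partial>cmeas i0) + (a\<^sup>2 + b\<^sup>2) / 2 - (a\<^sup>2 + b\<^sup>2) / 2 / 2 + h * sqrt 2 * (c - 0) - h\<^sup>2 / 2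
      - (\<Sum>j\<in>UNIV - {i0}. \<integral>p. (N j p - w j)\<^sup>2 \<partial>cmeas i0) / 2" .
  \<comment> \<open>The value h = sqrt 2 c maximises h sqrt 2 c - h^2 / 2, and the maximum c^2 is
    exactly the allowance for the mean in \<open>radial_inequality\<close>. Likewise (a^2 + b^2) / 4
    remains from the translation.\<close>
  have hc: "h * sqrt 2 * (c - 0) - h\<^sup>2 / 2 = c\<^sup>2" by (simp add: h power_mult_distrib power2_eq_square)
  have rad: "(\<integral>p. (N i0 p)\<^sup>2 \<partial>cmeas i0) - (\<Sum>k\<in>UNIV. \<integral>p. (Dk i0 k (N i0) p)\<^sup>2 \<partial>cmeas i0) \<le> c\<^sup>2 + (a\<^sup>2 + b\<^sup>2) / 4"
    unfolding Dk_def by (rule radial_inequality[OF bN csmoothD(2)[OF N] csmooth_pdp[OF N] mean a b])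
  have nrm: "(\<Sum>j\<in>UNIV - {i0}. \<integral>p. (N j p - w j)\<^sup>2 \<partial>cmeas i0) / 2 \<le> (\<Sum>l\<in>UNIV - {i0}. \<Sum>k\<in>UNIV. \<integral>p. (Dk i0 k (N l) p)\<^sup>2 \<partial>cmeas i0)"
    unfolding sum_divide_distrib
  proof (rule sum_mono)
    fix l
    show "(\<integral>p. (N l p - w l)\<^sup>2 \<partial>cmeas i0) / 2 \<le> (\<Sum>k\<in>UNIV. \<integral>p. (Dk i0 k (N l) p)\<^sup>2 \<partial>cmeas i0)"
      using cylinder_poincare[OF bN csmoothD(2)[OF N] csmooth_pdp[OF N], of l] unfolding Dk_def w by simp
  qed
  have "(\<Sum>k\<in>UNIV. \<Sum>l\<in>UNIV. \<integral>p. (Dk i0 k (N l) p)\<^sup>2 \<partial>cmeas i0)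
      = (\<Sum>k\<in>UNIV. \<integral>p. (Dk i0 k (N i0) p)\<^sup>2 \<partial>cmeas i0) + (\<Sum>l\<in>UNIV - {i0}. \<Sum>k\<in>UNIV. \<integral>p. (Dk i0 k (N l) p)\<^sup>2 \<partial>cmeas i0)"
    by (subst sum.swap) (simp add: sum.remove)
  then show ?thesis unfolding JR using hc rad nrm by argo
qed

section \<open>Derivatives of determinants\<close>

lemma has_real_derivative_det:
  fixes A :: "real \<Rightarrow> real^'n::finite^'n"
  assumes "\<And>i j. ((\<lambda>s. A s $ i $ j) has_real_derivative A' $ i $ j) (at s)"
  shows "((\<lambda>s. det (A s)) has_real_derivative (\<Sum>k\<in>UNIV. det (\<chi> i. if i = k then A' $ k else A s $ i))) (at s)"
proof -
  have "((\<lambda>s. \<Prod>i\<in>UNIV. A s $ i $ p i) has_real_derivative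
      (\<Sum>k\<in>UNIV. A' $ k $ p k * (\<Prod>i\<in>UNIV - {k}. A s $ i $ p i))) (at s)" for p
    by (rule has_field_derivative_prod) (rule assms)
  then have "((\<lambda>s. det (A s)) has_real_derivative
      (\<Sum>p | p permutes UNIV. of_int (sign p) * (\<Sum>k\<in>UNIV. A' $ k $ p k * (\<Prod>i\<in>UNIV - {k}. A s $ i $ p i)))) (at s)"
    unfolding det_def
    by (intro DERIV_sum DERIV_cmult)
  also have "(\<Sum>p | p permutes UNIV. of_int (sign p) * (\<Sum>k\<in>UNIV. A' $ k $ p k * (\<Prod>i\<in>UNIV - {k}. A s $ i $ p i)))
      = (\<Sum>k\<in>UNIV. det (\<chi> i. if i = k then A' $ k else A s $ i))"
  proof -
    have "(\<Prod>i\<in>UNIV. (\<chi> i. if i = k then A' $ k else A s $ i) $ i $ p i) = A' $ k $ p k * (\<Prod>i\<in>UNIV - {k}. A s $ i $ p i)" for p k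
      by (simp add: prod.remove[of UNIV k])
    then show ?thesis
      unfolding det_def by (subst sum.swap) (simp add: sum_distrib_left)
  qed
  finally show ?thesis .
qed

lemma det_diag_row:
  fixes M :: "real^'n::finite^'n"
  assumes "\<And>i j. i \<noteq> k \<Longrightarrow> M $ i $ j = (if i = j then d i else 0)"
  shows "det M = M $ k $ k * (\<Prod>i\<in>UNIV - {k}. d i)"
proof -
  have id: "p = id" if p: "p permutes UNIV" "(\<Prod>i\<in>UNIV. M $ i $ p i) \<noteq> 0" for p
  proof -
    have "p i = i" if "i \<noteq> k" for i
    proof (rule ccontr)
      assume "p i \<noteq> i"
      then have "M $ i $ p i = 0" using assms[OF \<open>i \<noteq> k\<close>, of "p i"] by simp
      then show False using p(2) by (metis UNIV_I finite prod_zero)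
    qed
    then have "p permutes {k}" using p(1) unfolding permutes_def by auto
    then show ?thesis by simp
  qed
  have "det M = (\<Sum>p\<in>{id}. of_int (sign p) * (\<Prod>i\<in>UNIV. M $ i $ p i))"
    unfolding det_def using id by (intro sum.mono_neutral_right) (auto simp: permutes_id)
  also have "\<dots> = (\<Prod>i\<in>UNIV. M $ i $ i)" by simp
  also have "\<dots> = M $ k $ k * (\<Prod>i\<in>UNIV - {k}. M $ i $ i)" by (rule prod.remove) auto
  also have "(\<Prod>i\<in>UNIV - {k}. M $ i $ i) = (\<Prod>i\<in>UNIV - {k}. d i)" by (intro prod.cong) (auto simp: assms)
  finally show ?thesis .
qed

text \<open>A permutation contributes only if it fixes every index other than \<open>k\<close> and
  \<open>l\<close>; the identity and one transposition are left.\<close>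

lemma det_diag_two_rows:
  fixes M :: "real^'n::finite^'n"
  assumes kl: "k \<noteq> l" and M: "\<And>i j. i \<noteq> k \<Longrightarrow> i \<noteq> l \<Longrightarrow> M $ i $ j = (if i = j then d i else 0)"
  shows "det M = (M $ k $ k * M $ l $ l - M $ k $ l * M $ l $ k) * (\<Prod>i\<in>UNIV - {k, l}. d i)"
proof -
  have id: "p \<in> {id, Transposition.transpose k l}" if p: "p permutes UNIV" "(\<Prod>i\<in>UNIV. M $ i $ p i) \<noteq> 0" for p
  proof -
    have "p i = i" if "i \<noteq> k" "i \<noteq> l" for i
    proof (rule ccontr)
      assume "p i \<noteq> i"
      then have "M $ i $ p i = 0" using M[OF that, of "p i"] by simp
      then show False using p(2) by (metis UNIV_I finite prod_zero)
    qed
    then have "p permutes {k, l}" using p(1) unfolding permutes_def by auto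
    then show ?thesis by (simp add: permutes_doubleton_iff)
  qed
  have pr: "(\<Prod>i\<in>UNIV. M $ i $ p i) = M $ k $ p k * (M $ l $ p l * (\<Prod>i\<in>UNIV - {k, l}. d i))"
    if "\<And>i. i \<noteq> k \<Longrightarrow> i \<noteq> l \<Longrightarrow> p i = i" for p
  proof -
    have "(\<Prod>i\<in>UNIV. M $ i $ p i) = M $ k $ p k * (\<Prod>i\<in>UNIV - {k}. M $ i $ p i)"
      by (rule prod.remove) auto
    also have "(\<Prod>i\<in>UNIV - {k}. M $ i $ p i) = M $ l $ p l * (\<Prod>i\<in>UNIV - {k} - {l}. M $ i $ p i)"
      using kl by (intro prod.remove) auto
    also have "(\<Prod>i\<in>UNIV - {k} - {l}. M $ i $ p i) = (\<Prod>i\<in>UNIV - {k, l}. d i)"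
      by (intro prod.cong) (auto simp: M that)
    finally show ?thesis .
  qed
  have ne: "id \<noteq> Transposition.transpose k l" using kl by (metis id_apply transpose_apply_first)
  have "det M = (\<Sum>p\<in>{id, Transposition.transpose k l}. of_int (sign p) * (\<Prod>i\<in>UNIV. M $ i $ p i))"
    unfolding det_def using id by (intro sum.mono_neutral_right) (auto simp: permutes_id permutes_swap_id)
  also have "\<dots> = (\<Prod>i\<in>UNIV. M $ i $ id i) - (\<Prod>i\<in>UNIV. M $ i $ Transposition.transpose k l i)"
    using ne kl by (simp add: sign_swap_id)
  also have "\<dots> = M $ k $ k * (M $ l $ l * (\<Prod>i\<in>UNIV - {k, l}. d i)) - M $ k $ l * (M $ l $ k * (\<Prod>i\<in>UNIV - {k, l}. d i))"
    by (subst (1 2) pr) (auto simp: transpose_apply_other)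
  finally show ?thesis by (simp add: algebra_simps)
qed

text \<open>\<open>det1\<close> and \<open>det2\<close> are the first two derivatives of the
  determinant along a curve. As sums of determinants with replaced rows they are defined and
  continuous even where \<open>A\<close> is singular.\<close>

definition det1 :: "real^'n::finite^'n \<Rightarrow> real^'n^'n \<Rightarrow> real" where
  "det1 A A1 = (\<Sum>k\<in>UNIV. det (\<chi> i. if i = k then A1 $ k else A $ i))"

definition det2 :: "real^'n::finite^'n \<Rightarrow> real^'n^'n \<Rightarrow> real^'n^'n \<Rightarrow> real" where
  "det2 A A1 A2 = (\<Sum>k\<in>UNIV. \<Sum>l\<in>UNIV. det (\<chi> i. if i = l then (if l = k then A2 $ k else A1 $ l) else if i = k then A1 $ k else A $ i))"

lemma has_real_derivative_det1:
  fixes A A1 :: "real \<Rightarrow> real^'n::finite^'n"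
  assumes "\<And>i j. ((\<lambda>s. A s $ i $ j) has_real_derivative A1 s $ i $ j) (at s)"
    and "\<And>i j. ((\<lambda>s. A1 s $ i $ j) has_real_derivative A2 $ i $ j) (at s)"
  shows "((\<lambda>s. det (A s)) has_real_derivative det1 (A s) (A1 s)) (at s)"
    and "((\<lambda>s. det1 (A s) (A1 s)) has_real_derivative det2 (A s) (A1 s) A2) (at s)"
proof -
  show "((\<lambda>s. det (A s)) has_real_derivative det1 (A s) (A1 s)) (at s)"
    unfolding det1_def by (rule has_real_derivative_det) (rule assms)
  have "((\<lambda>s. det (\<chi> i. if i = k then A1 s $ k else A s $ i)) has_real_derivative
      (\<Sum>l\<in>UNIV. det (\<chi> i. if i = l then (\<chi> i. if i = k then A2 $ k else A1 s $ i) $ l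
         else (\<chi> i. if i = k then A1 s $ k else A s $ i) $ i))) (at s)" for k
    by (rule has_real_derivative_det) (simp add: assms)
  then show "((\<lambda>s. det1 (A s) (A1 s)) has_real_derivative det2 (A s) (A1 s) A2) (at s)"
    unfolding det1_def det2_def by (intro DERIV_sum) (simp cong: if_cong)
qed

text \<open>Over a diagonal matrix the replaced rows leave minors of size one or two. The outcome is
  Jacobi's formula and its second-order version, with the traces of the inverse times
  \<open>A1\<close> and of its square written out.\<close>

lemma det1_diag:
  fixes A A1 :: "real^'n::finite^'n"
  assumes A: "\<And>i j. A $ i $ j = (if i = j then d i else 0)" and d: "\<And>i. d i \<noteq> 0"
  shows "det A = (\<Prod>i\<in>UNIV. d i)"
    and "det1 A A1 = (\<Prod>i\<in>UNIV. d i) * (\<Sum>k\<in>UNIV. A1 $ k $ k / d k)"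
    and "det2 A A1 A2 = (\<Prod>i\<in>UNIV. d i) * ((\<Sum>k\<in>UNIV. A2 $ k $ k / d k) + (\<Sum>k\<in>UNIV. A1 $ k $ k / d k)\<^sup>2
        - (\<Sum>k\<in>UNIV. \<Sum>l\<in>UNIV. A1 $ k $ l * A1 $ l $ k / (d k * d l)))"
proof -
  show "det A = (\<Prod>i\<in>UNIV. d i)"
    using det_diagonal[of A] A by simp
  have rem: "(\<Prod>i\<in>UNIV - {k}. d i) = (\<Prod>i\<in>UNIV. d i) / d k" for k
    using prod.remove[of UNIV k d] d[of k] by simp
  have rem2: "(\<Prod>i\<in>UNIV - {k, l}. d i) = (\<Prod>i\<in>UNIV. d i) / (d k * d l)" if "k \<noteq> l" for k l
  proof -
    have "(\<Prod>i\<in>UNIV - {k}. d i) = d l * (\<Prod>i\<in>UNIV - {k} - {l}. d i)"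
      using that by (intro prod.remove) auto
    moreover have "UNIV - {k} - {l} = UNIV - {k, l}" by auto
    ultimately show ?thesis using rem[of k] d by (simp add: field_simps)
  qed
  have r: "det (\<chi> i. if i = k then R else A $ i) = (\<Prod>i\<in>UNIV. d i) * (R $ k / d k)" for k R
    by (subst det_diag_row[where k = k and d = d]) (auto simp: A rem)
  show "det1 A A1 = (\<Prod>i\<in>UNIV. d i) * (\<Sum>k\<in>UNIV. A1 $ k $ k / d k)"
    unfolding det1_def r by (simp add: sum_distrib_left)
  \<comment> \<open>For \<open>l = k\<close> the two products of entries of \<open>A1\<close>
    cancel, so one formula covers both cases and sums to the squared trace minus the trace of the
    square.\<close>
  have r2: "det (\<chi> i. if i = l then (if l = k then A2 $ k else A1 $ l) else if i = k then A1 $ k else A $ i)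
      = (\<Prod>i\<in>UNIV. d i) * ((if l = k then A2 $ k $ k / d k else 0) + A1 $ k $ k / d k * (A1 $ l $ l / d l)
        - A1 $ k $ l * A1 $ l $ k / (d k * d l))" for k l
  proof (cases "l = k")
    case True
    have "(\<chi> i. if i = l then (if l = k then A2 $ k else A1 $ l) else if i = k then A1 $ k else A $ i) = (\<chi> i. if i = k then A2 $ k else A $ i)"
      using True by (simp add: vec_eq_iff)
    then show ?thesis using True r[of k "A2 $ k"] by simp
  next
    case False
    have "det (\<chi> i. if i = l then A1 $ l else if i = k then A1 $ k else A $ i)
       = (A1 $ k $ k * A1 $ l $ l - A1 $ k $ l * A1 $ l $ k) * ((\<Prod>i\<in>UNIV. d i) / (d k * d l))"
      using False by (subst det_diag_two_rows[where k = k and l = l and d = d]) (auto simp: A rem2)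
    then show ?thesis using False d[of k] d[of l] by (simp add: field_simps)
  qed
  show "det2 A A1 A2 = (\<Prod>i\<in>UNIV. d i) * ((\<Sum>k\<in>UNIV. A2 $ k $ k / d k) + (\<Sum>k\<in>UNIV. A1 $ k $ k / d k)\<^sup>2
        - (\<Sum>k\<in>UNIV. \<Sum>l\<in>UNIV. A1 $ k $ l * A1 $ l $ k / (d k * d l)))"
    unfolding det2_def r2 sum_distrib_left[symmetric]
    by (simp add: sum.distrib sum_subtractf power2_eq_square sum_product)
qed

section \<open>Geometry of the cylinder\<close>

lemma has_derivative_vec_lambda:
  fixes f :: "'a::real_normed_vector \<Rightarrow> 'n::finite \<Rightarrow> 'b::real_normed_vector"
  assumes "\<And>j. ((\<lambda>p. f p j) has_derivative (\<lambda>v. f' v j)) (at x)"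
  shows "((\<lambda>p. \<chi> j. f p j) has_derivative (\<lambda>v. \<chi> j. f' v j)) (at x)"
proof -
  have bl: "bounded_linear (axis j :: 'b \<Rightarrow> 'b^'n)" for j
    by (rule bounded_linear_intro[where K = 1])
      (auto simp: axis_def vec_eq_iff norm_vec_def L2_set_def if_distrib[of norm] if_distrib[of "\<lambda>x. x\<^sup>2"] cong: if_cong)
  have e: "(\<chi> j. g j) = (\<Sum>j\<in>UNIV. axis j (g j))" for g :: "'n \<Rightarrow> 'b"
    by (simp add: vec_eq_iff axis_def)
  show ?thesis
    unfolding e by (intro has_derivative_sum bounded_linear.has_derivative[OF bl] assms)
qed

lemma smooth_cyl: "smooth (cyl i0)"
  and has_derivative_cyl: "(cyl i0 has_derivative
      (\<lambda>v. \<chi> j. if j = i0 then complex_of_real (sqrt 2) * (v $ i0 *\<^sub>R (\<i> * cis (p $ i0))) else complex_of_real (v $ j))) (at p)"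
proof -
  \<comment> \<open>A family closed under directional derivatives: the angular slot keeps its form
    with a new complex factor \<open>a\<close>, and the flat slots become constant, that is
    \<open>b\<close> turns into 0.\<close>
  define F where "F = (\<lambda>a b c (p :: real^'a). (\<chi> j. if j = i0 then a * cis (p $ i0) else complex_of_real (b * p $ j + c j)))"
  have d: "(F a b c has_derivative (\<lambda>v. \<chi> j. if j = i0 then a * (v $ i0 *\<^sub>R (\<i> * cis (p $ i0))) else complex_of_real (b * v $ j))) (at p)" for a b c p
    unfolding F_def
  proof (rule has_derivative_vec_lambda)
    fix j
    show "((\<lambda>p. if j = i0 then a * cis (p $ i0) else complex_of_real (b * p $ j + c j)) has_derivative
        (\<lambda>v. if j = i0 then a * (v $ i0 *\<^sub>R (\<i> * cis (p $ i0))) else complex_of_real (b * v $ j))) (at p)"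
      by (cases "j = i0")
        (auto intro!: derivative_eq_intros bounded_linear_imp_has_derivative[OF bounded_linear_vec_nth])
  qed
  have cylF: "cyl i0 = F (complex_of_real (sqrt 2)) 1 (\<lambda>_. 0)"
    by (auto simp: F_def cyl_def fun_eq_iff)
  show "(cyl i0 has_derivative
      (\<lambda>v. \<chi> j. if j = i0 then complex_of_real (sqrt 2) * (v $ i0 *\<^sub>R (\<i> * cis (p $ i0))) else complex_of_real (v $ j))) (at p)" for p
    unfolding cylF using d[of "complex_of_real (sqrt 2)" 1 "\<lambda>_. 0" p] by (simp only: mult_1)
  have "\<exists>a b c. cyl i0 = F a b c" using cylF by blast
  then show "smooth (cyl i0)"
  proof (coinduct rule: smooth_coinduct)
    case (step f)
    then obtain a b c where f: "f = F a b c" by blast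
    have "dd v f = F (a * (v $ i0 *\<^sub>R \<i>)) 0 (\<lambda>j. b * v $ j)" for v
      unfolding f by (rule ext, subst dd_eqI[OF d]) (auto simp: F_def vec_eq_iff)
    then show ?case using d f unfolding differentiable_def by blast
  qed
qed

text \<open>The \<open>k\<close>-th unit tangent vector has \<open>eps i0 k\<close> as its only nonzero entry, at \<open>k\<close>.\<close>

definition eps :: "'n \<Rightarrow> 'n \<Rightarrow> real^'n::finite \<Rightarrow> complex" where
  "eps i0 k p = (if k = i0 then \<i> * cis (p $ i0) else 1)"

lemma lam_pos: "lam i0 k > 0" "lam i0 k \<noteq> 0"
  by (auto simp: lam_def)

lemma norm_eps: "norm (eps i0 k p) = 1"
  by (simp add: eps_def norm_mult)

lemma pd_cyl: "pd k (cyl i0) p = axis k (eps i0 k p /\<^sub>R lam i0 k)"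
  unfolding pd_eq_dd dd_eqI[OF has_derivative_cyl]
  by (auto simp: vec_eq_iff axis_def eps_def lam_def scaleR_conv_of_real)

lemma metric_cyl: "metric (cyl i0) p $ i $ j = (if i = j then 1 / (lam i0 i)\<^sup>2 else 0)"
  using lam_pos(1)[of i0 i]
  by (auto simp: metric_def pd_cyl inner_axis_axis dot_square_norm norm_eps power2_eq_square divide_simps)

lemma immersion_cyl: "immersion (cyl i0)"
proof -
  have "det (metric (cyl i0) p) = (\<Prod>i\<in>UNIV. 1 / (lam i0 i)\<^sup>2)" for p
    by (rule det1_diag(1)) (auto simp: metric_cyl lam_pos)
  then show ?thesis by (auto simp: immersion_def smooth_cyl lam_pos)
qed

text \<open>The coordinate tangent vectors sit in different complex slots, as for every product of
  plane curves.\<close>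

lemma lagrangian_cyl: "lagrangian (cyl i0)"
  unfolding lagrangian_def omega_def pd_cyl
  by (auto simp: immersion_cyl axis_def intro!: sum.neutral)

lemma matrix_inv_metric_cyl: "matrix_inv (metric (cyl i0) p) $ i $ j = (if i = j then (lam i0 i)\<^sup>2 else 0)"
proof -
  define D where "D = (\<chi> i j. if i = j then (lam i0 i)\<^sup>2 else (0::real))"
  have "metric (cyl i0) p ** D = mat 1" "D ** metric (cyl i0) p = mat 1"
    using lam_pos(2)[of i0]
    by (auto simp: D_def matrix_matrix_mult_def metric_cyl vec_eq_iff mat_def if_distrib[of "\<lambda>x. x * _"] if_distrib[of "\<lambda>x. _ * x"] cong: if_cong)
  \<comment> \<open>\<open>matrix_inv\<close> is defined by choice; the explicit inverse
    \<open>D\<close> shows that there is something to choose, and uniqueness of inverses then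
    identifies it.\<close>
  then have "metric (cyl i0) p ** matrix_inv (metric (cyl i0) p) = mat 1" "D ** metric (cyl i0) p = mat 1"
    unfolding matrix_inv_def by (metis (mono_tags, lifting) someI_ex)+
  then have "matrix_inv (metric (cyl i0) p) = D"
    by (metis matrix_mul_assoc matrix_mul_lid matrix_mul_rid)
  then show ?thesis by (simp add: D_def)
qed

lemma normal_part_cyl: "normal_part (cyl i0) p v = v - (\<Sum>k\<in>UNIV. (v $ k \<bullet> eps i0 k p) *\<^sub>R axis k (eps i0 k p))"
proof -
  have "(\<Sum>i\<in>UNIV. \<Sum>j\<in>UNIV. (matrix_inv (metric (cyl i0) p) $ i $ j * (v \<bullet> pd i (cyl i0) p)) *\<^sub>R pd j (cyl i0) p)
      = (\<Sum>i\<in>UNIV. \<Sum>j\<in>UNIV. if i = j then (v $ i \<bullet> eps i0 i p) *\<^sub>R axis i (eps i0 i p) else 0)"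
  proof (intro sum.cong refl)
    fix i j
    show "(matrix_inv (metric (cyl i0) p) $ i $ j * (v \<bullet> pd i (cyl i0) p)) *\<^sub>R pd j (cyl i0) p
      = (if i = j then (v $ i \<bullet> eps i0 i p) *\<^sub>R axis i (eps i0 i p) else 0)"
      using lam_pos(2)[of i0 i]
      by (simp add: matrix_inv_metric_cyl pd_cyl inner_axis power2_eq_square) (auto simp: vec_eq_iff axis_def field_simps)
  qed
  then show ?thesis by (simp add: normal_part_def)
qed

lemma pd_pd_cyl: "pd i (pd j (cyl i0)) p = (if i = i0 \<and> j = i0 then axis i0 (- complex_of_real (sqrt 2) * cis (p $ i0)) else 0)"
proof (cases "j = i0")
  case True
  have "pd j (cyl i0) = (\<lambda>p. axis i0 (complex_of_real (sqrt 2) * (\<i> * cis (p $ i0))))"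
    using True by (auto simp: pd_cyl eps_def lam_def fun_eq_iff scaleR_conv_of_real)
  moreover have "((\<lambda>p :: real^'a. axis i0 (complex_of_real (sqrt 2) * (\<i> * cis (p $ i0))) :: complex^'a) has_derivative
      (\<lambda>v. \<chi> j. if j = i0 then complex_of_real (sqrt 2) * (\<i> * (v $ i0 *\<^sub>R (\<i> * cis (p $ i0)))) else 0)) (at p)"
    unfolding axis_def
  proof (rule has_derivative_vec_lambda)
    fix j
    show "((\<lambda>p. if j = i0 then complex_of_real (sqrt 2) * (\<i> * cis (p $ i0)) else 0) has_derivative
        (\<lambda>v. if j = i0 then complex_of_real (sqrt 2) * (\<i> * (v $ i0 *\<^sub>R (\<i> * cis (p $ i0)))) else 0)) (at p)"
      by (cases "j = i0") (auto intro!: derivative_eq_intros bounded_linear_imp_has_derivative[OF bounded_linear_vec_nth])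
  qed
  ultimately show ?thesis
    using True by (auto simp: pd_eq_dd[of i] dd_eqI vec_eq_iff axis_def)
next
  case False
  then have "pd j (cyl i0) = (\<lambda>p. axis j 1)"
    by (auto simp: pd_cyl eps_def lam_def fun_eq_iff)
  then show ?thesis using False by (simp add: pd_eq_dd[of i] dd_eqI[OF has_derivative_const])
qed

text \<open>Only the circle is curved. With radius R its curvature vector is -1/R times the outer
  unit normal, and the normal part of the position is R times it, so the equation holds exactly for
  R = sqrt 2.\<close>

lemma self_shrinker_cyl: "self_shrinker (cyl i0)"
proof -
  have "mean_curv (cyl i0) p = - (1 / 2) *\<^sub>R normal_part (cyl i0) p (cyl i0 p)" for p
  proof -
    let ?n = "axis i0 (complex_of_real (sqrt 2) * cis (p $ i0)) :: complex^'a"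
    have orth: "cis t \<bullet> (\<i> * cis t) = 0" for t by (simp add: inner_complex_def)
    have zero: "normal_part (cyl i0) p 0 = 0" by (simp add: normal_part_cyl)
    have n: "normal_part (cyl i0) p (axis i0 (c * cis (p $ i0))) = axis i0 (c * cis (p $ i0))" if "c \<in> \<real>" for c
    proof -
      obtain r where "c = complex_of_real r" using \<open>c \<in> \<real>\<close> by (rule Reals_cases)
      then have "(axis i0 (c * cis (p $ i0)) :: complex^'a) $ k \<bullet> eps i0 k p = 0" for k
        by (auto simp: axis_def eps_def inner_complex_def)
      then show ?thesis by (simp add: normal_part_cyl)
    qed
    have "mean_curv (cyl i0) p = (\<Sum>i\<in>UNIV. \<Sum>j\<in>UNIV. if i = i0 \<and> j = i0 then (1 / 2) *\<^sub>R (- ?n) else 0)"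
      unfolding mean_curv_def
    proof (intro sum.cong refl)
      fix i j
      have nn: "axis i0 (- complex_of_real (sqrt 2) * cis (p $ i0)) = - ?n"
        by (simp add: vec_eq_iff axis_def)
      have n': "normal_part (cyl i0) p (axis i0 (- complex_of_real (sqrt 2) * cis (p $ i0))) = - ?n"
        using n[of "- complex_of_real (sqrt 2)"] nn by simp
      show "matrix_inv (metric (cyl i0) p) $ i $ j *\<^sub>R normal_part (cyl i0) p (pd i (pd j (cyl i0)) p)
          = (if i = i0 \<and> j = i0 then (1 / 2) *\<^sub>R (- ?n) else 0)"
        using n' by (auto simp: pd_pd_cyl zero matrix_inv_metric_cyl lam_def power_divide)
    qed
    also have "\<dots> = (\<Sum>i\<in>UNIV. if i = i0 then (1 / 2) *\<^sub>R (- ?n) else 0)"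
      by (intro sum.cong refl) auto
    also have "\<dots> = - (1 / 2) *\<^sub>R ?n" by simp
    also have "?n = normal_part (cyl i0) p (cyl i0 p)"
    proof -
      have "(\<Sum>k\<in>UNIV. (cyl i0 p $ k \<bullet> eps i0 k p) *\<^sub>R axis k (eps i0 k p) :: complex^'a) = cyl i0 p - ?n"
        by (auto simp: vec_eq_iff axis_def cyl_def eps_def inner_complex_def if_distrib[of "\<lambda>x. _ *\<^sub>R x"] complex_eq_iff cong: if_cong)
      then show ?thesis by (simp add: normal_part_cyl)
    qed
    finally show ?thesis .
  qed
  then show ?thesis by (simp add: self_shrinker_def immersion_cyl)
qed

section \<open>The weighted measure as a density\<close>

definition yy :: "'n::finite \<Rightarrow> real^'n \<Rightarrow> real" where
  "yy i0 p = (\<Sum>j\<in>UNIV - {i0}. (p $ j)\<^sup>2)"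

definition dens :: "'n \<Rightarrow> 'n \<Rightarrow> real \<Rightarrow> real" where
  "dens i0 j x = (if j = i0 then indicator {0..2*pi} x / (2 * pi) else exp (- x\<^sup>2 / 4) / sqrt (4 * pi))"

lemma dens_measurable [measurable]: "dens i0 j \<in> borel_measurable borel"
  unfolding dens_def[abs_def] by measurable

lemma marg_density: "marg i0 j = density lborel (dens i0 j)"
  by (auto simp: marg_def circ_def gauss_def dens_def[abs_def] normal_density_sqrt2[abs_def])

lemma dens_nonneg: "dens i0 j x \<ge> 0"
  by (auto simp: dens_def)

text \<open>Lebesgue measure is determined by its values on boxes, which are products of edge
  lengths. This links integrals over the parameter space to the product measure behind
  \<open>cmeas\<close>.\<close>

lemma lborel_vec_eq: "(lborel :: (real^'n::finite) measure) = distr (\<Pi>\<^sub>M j\<in>UNIV. lborel) borel (\<lambda>x. \<chi> j. x j)"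
proof (rule lborel_eqI)
  interpret product_sigma_finite "\<lambda>_::'n. lborel :: real measure" by standard
  fix l u :: "real^'n" assume lu: "\<And>b. b \<in> Basis \<Longrightarrow> l \<bullet> b \<le> u \<bullet> b"
  have le: "l $ j \<le> u $ j" for j
    using lu[of "axis j 1"] by (simp add: inner_axis)
  have m: "(\<lambda>x. \<chi> j. x j) \<in> measurable (\<Pi>\<^sub>M j\<in>(UNIV::'n set). lborel) (borel :: (real^'n) measure)"
    by (rule measurable_vec_lambda_PiM) simp
  have "(\<lambda>x. \<chi> j. x j) -` box l u \<inter> space (\<Pi>\<^sub>M j\<in>(UNIV::'n set). lborel) = Pi\<^sub>E UNIV (\<lambda>j. {l $ j<..<u $ j})"
    by (auto simp: mem_box_cart space_PiM PiE_iff)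
  then have "emeasure (distr (\<Pi>\<^sub>M j\<in>(UNIV::'n set). lborel) borel (\<lambda>x. \<chi> j. x j)) (box l u)
      = emeasure (\<Pi>\<^sub>M j\<in>(UNIV::'n set). lborel) (Pi\<^sub>E UNIV (\<lambda>j. {l $ j<..<u $ j}))"
    using m by (subst emeasure_distr) auto
  also have "\<dots> = (\<Prod>j\<in>UNIV. ennreal (u $ j - l $ j))"
    using le by (subst emeasure_PiM) auto
  also have "\<dots> = ennreal (\<Prod>j\<in>UNIV. u $ j - l $ j)"
    using le by (intro prod_ennreal) auto
  also have "(\<Prod>j\<in>UNIV. u $ j - l $ j) = (\<Prod>b\<in>Basis. (u - l) \<bullet> b)"
  proof -
    have inj: "inj (\<lambda>j::'n. axis j (1::real))" by (auto simp: inj_def axis_eq_axis)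
    have "(Basis :: (real^'n) set) = range (\<lambda>j. axis j 1)" by (auto simp: Basis_vec_def)
    then have "(\<Prod>b\<in>Basis. (u - l) \<bullet> b) = (\<Prod>b\<in>range (\<lambda>j::'n. axis j (1::real)). (u - l) \<bullet> b)" by simp
    also have "\<dots> = (\<Prod>j\<in>UNIV. u $ j - l $ j)"
      by (subst prod.reindex[OF inj]) (simp add: inner_axis)
    finally show ?thesis by simp
  qed
  finally show "emeasure (distr (\<Pi>\<^sub>M j\<in>(UNIV::'n set). lborel) borel (\<lambda>x. \<chi> j. x j)) (box l u) = ennreal (\<Prod>b\<in>Basis. (u - l) \<bullet> b)" .
qed simp

lemma cmeas_density: "cmeas i0 = density lborel (\<lambda>p :: real^'n::finite. \<Prod>j\<in>UNIV. dens i0 j (p $ j))"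
proof -
  interpret L: product_sigma_finite "\<lambda>_::'n. lborel :: real measure" by standard
  interpret product_sigma_finite "marg i0"
    by (intro product_sigma_finite.intro prob_space_imp_sigma_finite prob_space_marg)
  let ?L = "\<Pi>\<^sub>M j\<in>(UNIV::'n set). (lborel :: real measure)"
  have [measurable]: "(\<lambda>x. dens i0 j (x j)) \<in> borel_measurable ?L" for j
    using measurable_component_singleton[of j UNIV "\<lambda>_. lborel :: real measure"] by (intro measurable_compose[OF _ dens_measurable]) simp
  have "density ?L (\<lambda>x. ennreal (\<Prod>j\<in>UNIV. dens i0 j (x j))) = Pi\<^sub>M UNIV (marg i0)"
  proof (rule PiM_eqI)
    show "sets (density ?L (\<lambda>x. ennreal (\<Prod>j\<in>UNIV. dens i0 j (x j)))) = sets (Pi\<^sub>M UNIV (marg i0))"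
      by (simp cong: sets_PiM_cong)
    fix A assume A: "\<And>j. j \<in> UNIV \<Longrightarrow> A j \<in> sets (marg i0 j)"
    then have [measurable]: "A j \<in> sets borel" for j by simp
    have AL: "Pi\<^sub>E UNIV A \<in> sets ?L" using A by (intro sets_PiM_I_finite) auto
    have "emeasure (density ?L (\<lambda>x. ennreal (\<Prod>j\<in>UNIV. dens i0 j (x j)))) (Pi\<^sub>E UNIV A)
        = (\<integral>\<^sup>+x. ennreal (\<Prod>j\<in>UNIV. dens i0 j (x j)) * indicator (Pi\<^sub>E UNIV A) x \<partial>?L)"
      by (rule emeasure_density[OF _ AL]) measurable
    also have "\<dots> = (\<integral>\<^sup>+x. (\<Prod>j\<in>UNIV. ennreal (dens i0 j (x j)) * indicator (A j) (x j)) \<partial>?L)"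
    proof (rule nn_integral_cong)
      fix x
      have "(\<Prod>j\<in>UNIV. indicator (A j) (x j)) = (indicator (Pi\<^sub>E UNIV A) x :: ennreal)"
      proof (cases "x \<in> Pi\<^sub>E UNIV A")
        case False
        then obtain j where "x j \<notin> A j" by auto
        then have "(\<Prod>j\<in>UNIV. indicator (A j) (x j)) = (0 :: ennreal)"
          by (intro prod_zero bexI[of _ j]) auto
        then show ?thesis using False by simp
      qed (auto simp: PiE_iff)
      then show "ennreal (\<Prod>j\<in>UNIV. dens i0 j (x j)) * indicator (Pi\<^sub>E UNIV A) x
          = (\<Prod>j\<in>UNIV. ennreal (dens i0 j (x j)) * indicator (A j) (x j))"
        by (simp add: prod.distrib prod_ennreal dens_nonneg)
    qed
    also have "\<dots> = (\<Prod>j\<in>UNIV. \<integral>\<^sup>+x. ennreal (dens i0 j x) * indicator (A j) x \<partial>lborel)"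
      by (rule L.product_nn_integral_prod) auto
    also have "\<dots> = (\<Prod>j\<in>UNIV. emeasure (marg i0 j) (A j))"
      unfolding marg_density by (intro prod.cong refl emeasure_density[symmetric]) auto
    finally show "emeasure (density ?L (\<lambda>x. ennreal (\<Prod>j\<in>UNIV. dens i0 j (x j)))) (Pi\<^sub>E UNIV A) = (\<Prod>j\<in>UNIV. emeasure (marg i0 j) (A j))" .
  qed simp
  then have "cmeas i0 = distr (density ?L (\<lambda>x. ennreal (\<Prod>j\<in>UNIV. dens i0 j ((\<chi> j. x j) $ j)))) borel (\<lambda>x. \<chi> j. x j)"
    by (simp add: cmeas_def)
  also have "\<dots> = density (distr ?L borel (\<lambda>x. \<chi> j. x j)) (\<lambda>p. ennreal (\<Prod>j\<in>UNIV. dens i0 j (p $ j)))"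
  proof (rule density_distr[symmetric])
    show "(\<lambda>x. \<chi> j. x j) \<in> measurable ?L (borel :: (real^'n) measure)"
      by (rule measurable_vec_lambda_PiM) simp
    have [measurable]: "(\<lambda>p :: real^'n. p $ j) \<in> borel_measurable borel" for j
      by (intro borel_measurable_continuous_onI continuous_intros)
    show "(\<lambda>p :: real^'n. ennreal (\<Prod>j\<in>UNIV. dens i0 j (p $ j))) \<in> borel_measurable borel"
      by measurable
  qed
  finally show ?thesis unfolding lborel_vec_eq .
qed

text \<open>The constant undoes the normalisation of the one-variable densities: 2 pi for the angle
  and sqrt (4 pi) for each flat coordinate.\<close>

lemma integral_fund_dom:
  fixes i0 :: "'n::finite"
  assumes f: "bddm f"
  shows "integral (fund_dom i0) (\<lambda>p. exp (- yy i0 p / 4) * f p)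
    = 2 * pi * sqrt (4 * pi) ^ (CARD('n) - 1) * (\<integral>p. f p \<partial>cmeas i0)"
proof -
  let ?C = "2 * pi * sqrt (4 * pi) ^ (CARD('n) - 1)"
  define S where "S = {p :: real^'n. 0 \<le> p $ i0 \<and> p $ i0 \<le> 2 * pi}"
  define r where "r = (\<lambda>p. \<Prod>j\<in>UNIV. dens i0 j (p $ j))"
  have r: "r p = indicator S p * exp (- yy i0 p / 4) / ?C" for p
  proof -
    have "(\<Prod>j\<in>UNIV - {i0}. dens i0 j (p $ j)) = (\<Prod>j\<in>UNIV - {i0}. exp (- (p $ j)\<^sup>2 / 4) / sqrt (4 * pi))"
      by (intro prod.cong) (auto simp: dens_def)
    also have "\<dots> = exp (- yy i0 p / 4) / sqrt (4 * pi) ^ (CARD('n) - 1)"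
      unfolding prod_dividef exp_sum[symmetric, OF finite]
      by (simp add: yy_def sum_negf sum_divide_distrib card_Diff_singleton)
    finally have "(\<Prod>j\<in>UNIV - {i0}. dens i0 j (p $ j)) = exp (- yy i0 p / 4) / sqrt (4 * pi) ^ (CARD('n) - 1)" .
    moreover have "dens i0 i0 (p $ i0) = indicator S p / (2 * pi)"
      by (simp add: dens_def S_def indicator_def)
    ultimately show ?thesis
      unfolding r_def by (simp add: prod.remove[of UNIV i0])
  qed
  have [measurable]: "(\<lambda>p :: real^'n. p $ j) \<in> borel_measurable borel" for j
    by (intro borel_measurable_continuous_onI continuous_intros)
  have rm: "r \<in> borel_measurable lborel" unfolding r_def by measurable
  have rn: "AE p in lborel. 0 \<le> r p" unfolding r_def by (auto intro!: prod_nonneg dens_nonneg)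
  have fm: "f \<in> borel_measurable lborel" using bddmD[OF f] by simp
  have cm: "cmeas i0 = density lborel r" unfolding cmeas_density r_def ..
  have int: "integrable lborel (\<lambda>p. r p *\<^sub>R f p)"
    using integrable_cmeas[OF f, of i0] unfolding cm integrable_density[OF fm rm rn] .
  have Cpos: "?C > 0" by simp
  have eq: "indicator S p *\<^sub>R (exp (- yy i0 p / 4) * f p) = ?C * (r p *\<^sub>R f p)" for p
    unfolding r using Cpos by simp
  have sint: "set_integrable lborel S (\<lambda>p. exp (- yy i0 p / 4) * f p)"
    unfolding set_integrable_def eq using int by (rule integrable_mult_right)
  \<comment> \<open>\<open>fund_dom\<close> is half-open while \<open>circ\<close> lives on the
    closed interval; the difference lies in a hyperplane.\<close>
  have "integral (fund_dom i0) (\<lambda>p. exp (- yy i0 p / 4) * f p) = integral S (\<lambda>p. exp (- yy i0 p / 4) * f p)"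
  proof (rule integral_spike_set)
    have n: "negligible {p :: real^'n. p $ i0 = 2 * pi}" by (simp add: cart_eq_inner_axis axis_in_Basis_iff negligible_standard_hyperplane)
    show "negligible {p \<in> fund_dom i0 - S. exp (- yy i0 p / 4) * f p \<noteq> 0}"
      by (rule negligible_subset[OF n]) (auto simp: fund_dom_def S_def)
    show "negligible {p \<in> S - fund_dom i0. exp (- yy i0 p / 4) * f p \<noteq> 0}"
      by (rule negligible_subset[OF n]) (auto simp: fund_dom_def S_def)
  qed
  also have "\<dots> = (LINT p:S|lborel. exp (- yy i0 p / 4) * f p)"
    using set_borel_integral_eq_integral(2)[OF sint] by simp
  also have "\<dots> = ?C * (\<integral>p. r p *\<^sub>R f p \<partial>lborel)"
    unfolding set_lebesgue_integral_def eq by simp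
  also have "(\<integral>p. r p *\<^sub>R f p \<partial>lborel) = (\<integral>p. f p \<partial>cmeas i0)"
    unfolding cm by (rule integral_density[OF fm rm rn, symmetric])
  finally show ?thesis .
qed

section \<open>The second variation\<close>

text \<open>
  \<open>nu = - \<i> eps\<close> spans the normal directions; \<open>tc\<close> and \<open>nc\<close> are the tangential and normal components
  of a vector field.
\<close>

definition nu :: "'n \<Rightarrow> 'n \<Rightarrow> real^'n::finite \<Rightarrow> complex" where
  "nu i0 k p = (if k = i0 then cis (p $ i0) else - \<i>)"

definition tc :: "'n \<Rightarrow> (real^'n::finite \<Rightarrow> complex^'n) \<Rightarrow> 'n \<Rightarrow> real^'n \<Rightarrow> real" where
  "tc i0 X k p = X p $ k \<bullet> eps i0 k p"

definition nc :: "'n \<Rightarrow> (real^'n::finite \<Rightarrow> complex^'n) \<Rightarrow> 'n \<Rightarrow> real^'n \<Rightarrow> real" where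
  "nc i0 X k p = X p $ k \<bullet> nu i0 k p"

lemma inner_frame: "x \<bullet> y = (x \<bullet> eps i0 k p) * (y \<bullet> eps i0 k p) + (x \<bullet> nu i0 k p) * (y \<bullet> nu i0 k p)"
proof -
  have eq: "(u * c + v * s) * (u' * c + v' * s) + (u * - s + v * c) * (u' * - s + v' * c) = (u * u' + v * v') * (c\<^sup>2 + s\<^sup>2)" for u v u' v' c s :: real
    by (simp add: power2_eq_square algebra_simps)
  show ?thesis
    using eq[of "Re x" "cos (p $ i0)" "Im x" "sin (p $ i0)" "Re y" "Im y"]
    by (simp add: eps_def nu_def inner_complex_def algebra_simps)
qed

lemma norm_frame: "x \<bullet> x = (x \<bullet> eps i0 k p)\<^sup>2 + (x \<bullet> nu i0 k p)\<^sup>2"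
  using inner_frame[of x x i0 k p] by (simp add: power2_eq_square)

lemma smooth_vec_component:
  fixes X :: "real^'n::finite \<Rightarrow> complex^'n"
  assumes "smooth X"
  shows "smooth (\<lambda>p. Re (X p $ k))" "smooth (\<lambda>p. Im (X p $ k))"
proof -
  have "bounded_linear (\<lambda>x :: complex^'n. Re (x $ k))" "bounded_linear (\<lambda>x :: complex^'n. Im (x $ k))"
    by (auto intro: bounded_linear_compose[OF bounded_linear_Re bounded_linear_vec_nth] bounded_linear_compose[OF bounded_linear_Im bounded_linear_vec_nth])
  then show "smooth (\<lambda>p. Re (X p $ k))" "smooth (\<lambda>p. Im (X p $ k))"
    using smooth_compose_linear assms by blast+
qed

lemma csmooth_components:
  fixes X :: "real^'n::finite \<Rightarrow> complex^'n"
  assumes X: "smooth X" "periodic_in i0 X" "\<And>p. far i0 B p \<Longrightarrow> X p = 0"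
  shows "csmooth i0 (tc i0 X k)" "csmooth i0 (nc i0 X k)"
proof -
  have "cis (t + 2 * pi) = cis t" for t by (simp add: complex_eq_iff)
  then have per: "periodic_in i0 (tc i0 X k)" "periodic_in i0 (nc i0 X k)"
    using X(2) by (auto simp: periodic_in_def tc_def nc_def eps_def nu_def)
  have supp: "tc i0 X k p = 0" "nc i0 X k p = 0" if "far i0 B p" for p
    using X(3)[OF that] by (simp_all add: tc_def nc_def)
  note s = smooth_vec_component[OF X(1)]
  have "smooth (tc i0 X k)"
  proof (cases "k = i0")
    case True
    have "tc i0 X k = (\<lambda>p. - (Re (X p $ k) * sin (p $ i0)) + Im (X p $ k) * cos (p $ i0))"
      using True by (auto simp: tc_def eps_def inner_complex_def fun_eq_iff)
    then show ?thesis using s by simp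
  next
    case False
    then have "tc i0 X k = (\<lambda>p. Re (X p $ k))" by (auto simp: tc_def eps_def inner_complex_def)
    then show ?thesis using s by simp
  qed
  moreover have "smooth (nc i0 X k)"
  proof (cases "k = i0")
    case True
    have "nc i0 X k = (\<lambda>p. Re (X p $ k) * cos (p $ i0) + Im (X p $ k) * sin (p $ i0))"
      using True by (auto simp: nc_def nu_def inner_complex_def fun_eq_iff)
    then show ?thesis using s by simp
  next
    case False
    then have "nc i0 X k = (\<lambda>p. - Im (X p $ k))" by (auto simp: nc_def nu_def inner_complex_def)
    then show ?thesis using s by simp
  qed
  ultimately show "csmooth i0 (tc i0 X k)" "csmooth i0 (nc i0 X k)"
    using per supp by (auto simp: csmooth_def)
qed

text \<open>The frame turns with the angle: in the circle slot the derivative of \<open>eps\<close>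
  is \<open>- nu\<close> and that of \<open>nu\<close> is \<open>eps\<close>. These rotation terms,
  scaled by \<open>lam\<close>, are the second fundamental form of the cylinder.\<close>

lemma frame_derivatives:
  fixes X :: "real^'n::finite \<Rightarrow> complex^'n"
  assumes X: "smooth X"
  shows "lam i0 k * (pd k X p $ l \<bullet> eps i0 l p) = Dk i0 k (tc i0 X l) p + (if k = i0 \<and> l = i0 then nc i0 X i0 p / sqrt 2 else 0)"
    and "lam i0 k * (pd k X p $ l \<bullet> nu i0 l p) = Dk i0 k (nc i0 X l) p - (if k = i0 \<and> l = i0 then tc i0 X i0 p / sqrt 2 else 0)"
proof -
  have dX: "((\<lambda>p. X p $ l) has_derivative (\<lambda>v. dd v X p $ l)) (at p)"
    by (rule bounded_linear.has_derivative[OF bounded_linear_vec_nth smooth_has_derivative[OF X]])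
  have nth: "((\<lambda>p :: real^'n. p $ i0) has_derivative (\<lambda>v. v $ i0)) (at p)"
    by (rule bounded_linear_imp_has_derivative[OF bounded_linear_vec_nth])
  have de: "(eps i0 l has_derivative (\<lambda>v. if l = i0 then - v $ i0 *\<^sub>R nu i0 l p else 0)) (at p)"
    unfolding eps_def[abs_def] nu_def
    by (cases "l = i0") (auto intro!: derivative_eq_intros nth simp: fun_eq_iff complex_eq_iff)
  have dn: "(nu i0 l has_derivative (\<lambda>v. if l = i0 then v $ i0 *\<^sub>R eps i0 l p else 0)) (at p)"
    unfolding eps_def nu_def[abs_def]
    by (cases "l = i0") (auto intro!: derivative_eq_intros nth)
  have "(tc i0 X l has_derivative (\<lambda>v. X p $ l \<bullet> (if l = i0 then - v $ i0 *\<^sub>R nu i0 l p else 0) + dd v X p $ l \<bullet> eps i0 l p)) (at p)"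
    unfolding tc_def[abs_def] by (rule has_derivative_inner[OF dX de])
  from dd_eqI[OF this, of "axis k 1"]
  show "lam i0 k * (pd k X p $ l \<bullet> eps i0 l p) = Dk i0 k (tc i0 X l) p + (if k = i0 \<and> l = i0 then nc i0 X i0 p / sqrt 2 else 0)"
    by (auto simp: Dk_def pd_eq_dd nc_def lam_def axis_def algebra_simps)
  have "(nc i0 X l has_derivative (\<lambda>v. X p $ l \<bullet> (if l = i0 then v $ i0 *\<^sub>R eps i0 l p else 0) + dd v X p $ l \<bullet> nu i0 l p)) (at p)"
    unfolding nc_def[abs_def] by (rule has_derivative_inner[OF dX dn])
  from dd_eqI[OF this, of "axis k 1"]
  show "lam i0 k * (pd k X p $ l \<bullet> nu i0 l p) = Dk i0 k (nc i0 X l) p - (if k = i0 \<and> l = i0 then tc i0 X i0 p / sqrt 2 else 0)"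
    by (auto simp: Dk_def pd_eq_dd tc_def lam_def axis_def algebra_simps)
qed

lemma cyl_nth: "cyl i0 p $ k = (if k = i0 then sqrt 2 *\<^sub>R nu i0 k p else (p $ k) *\<^sub>R eps i0 k p)"
  by (simp add: cyl_def nu_def eps_def scaleR_conv_of_real)

lemma cyl_inner: "cyl i0 p \<bullet> X p = sqrt 2 * nc i0 X i0 p + (\<Sum>k\<in>UNIV. Yk i0 k p * tc i0 X k p)"
proof -
  have "cyl i0 p $ k \<bullet> X p $ k = (if k = i0 then sqrt 2 * nc i0 X i0 p else 0) + Yk i0 k p * tc i0 X k p" for k
    by (auto simp: cyl_nth nc_def tc_def Yk_def inner_commute)
  then show ?thesis unfolding inner_vec_def by (simp add: sum.distrib)
qed

lemma cyl_norm: "cyl i0 p \<bullet> cyl i0 p = 2 + yy i0 p"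
proof -
  have "cyl i0 p $ k \<bullet> cyl i0 p $ k = (if k = i0 then 2 else (p $ k)\<^sup>2)" for k
    by (simp add: cyl_nth dot_square_norm norm_eps nu_def)
  then have "cyl i0 p \<bullet> cyl i0 p = (\<Sum>k\<in>UNIV. if k = i0 then 2 else (p $ k)\<^sup>2)" by (simp add: inner_vec_def)
  also have "\<dots> = 2 + (\<Sum>k\<in>UNIV - {i0}. if k = i0 then 2 else (p $ k)\<^sup>2)" by (simp add: sum.remove[of UNIV i0])
  also have "(\<Sum>k\<in>UNIV - {i0}. if k = i0 then 2 else (p $ k)\<^sup>2) = yy i0 p" unfolding yy_def by (intro sum.cong) auto
  finally show ?thesis .
qed

text \<open>\<open>nu\<close> is \<open>eps\<close> turned by a quarter, so pairing with a tangent
  vector under \<open>omega\<close> reads off the normal component. Closedness of the 1-form thereby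
  becomes a condition on \<open>nc\<close>.\<close>

lemma var_form_eq: "var_form i0 Fv j p = nc i0 (var_field Fv) j p / lam i0 j"
proof -
  have om: "omega u (axis j c) = Re (u $ j) * Im c - Im (u $ j) * Re c" for u :: "complex^'a" and c
    unfolding omega_def by (simp add: axis_def if_distrib[of Re] if_distrib[of Im] if_distrib[of "\<lambda>x. _ * x"] sum_subtractf cong: if_cong)
  show ?thesis
    unfolding var_form_def pd_cyl nc_def om by (auto simp: eps_def nu_def inner_complex_def lam_def field_simps)
qed

text \<open>\<open>z\<close> and \<open>h\<close> are the velocities of x_s = s z and t_s = 1 + h s.
  The two restrictions on them keep the comparison motion from changing the exponent by unbounded
  functions of the flat coordinates.\<close>

locale variation =
  fixes i0 :: "'n::finite" and Fv :: "real \<Rightarrow> real^'n \<Rightarrow> complex^'n" and z :: "complex^'n" and h :: real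
  assumes var: "cyl_variation i0 Fv"
    and z_normal: "\<And>j. j \<noteq> i0 \<Longrightarrow> Re (z $ j) = 0"
    and h_cases: "h = 0 \<or> UNIV = {i0}"
begin

definition FF where "FF = (\<lambda>(s, p). Fv s p)"
definition Fs where "Fs = dd (1, 0) FF"
definition Fss where "Fss = dd (1, 0) Fs"
definition Fj where "Fj j = dd (0, axis j 1) FF"
definition Fsj where "Fsj j = dd (1, 0) (Fj j)"
definition Fssj where "Fssj j = dd (1, 0) (Fsj j)"

lemma FF_eq: "FF (s, p) = Fv s p" by (simp add: FF_def)

lemma smooth_FF: "smooth FF" using var by (simp add: cyl_variation_def FF_def)

lemma smooth_F: "smooth Fs" "smooth Fss" "smooth (Fj j)" "smooth (Fsj j)" "smooth (Fssj j)"
  unfolding Fs_def Fss_def Fj_def Fsj_def Fssj_def by (intro smooth_dd smooth_FF)+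

lemma s_derivative:
  fixes G :: "real \<times> (real^'n) \<Rightarrow> complex^'n"
  assumes "smooth G" shows "((\<lambda>s. G (s, p)) has_vector_derivative dd (1, 0) G (s, p)) (at s)"
  using smooth_line_derivative[OF assms, of "(0, p)" "(1, 0)" s] by simp

lemma F_derivs:
  "((\<lambda>s. Fv s p) has_vector_derivative Fs (s, p)) (at s)"
  "((\<lambda>s. Fs (s, p)) has_vector_derivative Fss (s, p)) (at s)"
  "((\<lambda>s. Fj j (s, p)) has_vector_derivative Fsj j (s, p)) (at s)"
  "((\<lambda>s. Fsj j (s, p)) has_vector_derivative Fssj j (s, p)) (at s)"
  using s_derivative[OF smooth_FF] s_derivative[OF smooth_F(1)] s_derivative[OF smooth_F(3)] s_derivative[OF smooth_F(4)]
  by (simp_all add: FF_eq Fs_def Fss_def Fsj_def Fssj_def)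

lemma slice_smooth:
  fixes G :: "real \<times> (real^'n) \<Rightarrow> complex^'n"
  assumes "smooth G"
  shows "smooth (\<lambda>p. G (s, p))" "pd j (\<lambda>p. G (s, p)) p = dd (0, axis j 1) G (s, p)"
proof -
  have L: "bounded_linear (\<lambda>p :: real^'n. (0 :: real, p))" by (rule bounded_linear_Pair[OF bounded_linear_zero bounded_linear_ident])
  show "smooth (\<lambda>p. G (s, p))" "pd j (\<lambda>p. G (s, p)) p = dd (0, axis j 1) G (s, p)"
    using smooth_compose_affine[OF L assms, where a = "(s, 0)"] by (simp_all add: pd_eq_dd)
qed

lemma smooth_Fv: "smooth (Fv s)" using slice_smooth(1)[OF smooth_FF, of s] by (simp add: FF_eq)

lemma pd_Fv: "pd j (Fv s) p = Fj j (s, p)"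
  using slice_smooth(2)[OF smooth_FF, of j s p] by (simp add: FF_eq Fj_def)

definition V where "V p = Fs (0, p)"
definition W where "W p = Fss (0, p)"

lemma V_var_field: "V = var_field Fv"
  by (auto simp: V_def Fs_def dd_def var_field_def FF_def fun_eq_iff)

lemma smooth_V: "smooth V" "smooth W"
  unfolding V_def[abs_def] W_def[abs_def] by (intro slice_smooth smooth_F)+

lemma pd_V: "pd j V p = Fsj j (0, p)" "pd j W p = Fssj j (0, p)"
proof -
  have c1: "dd (0, axis j 1) Fs = Fsj j"
    unfolding Fs_def Fsj_def Fj_def by (rule ext) (rule dd_commute[OF smooth_FF])
  have c2: "dd (0, axis j 1) Fss = dd (1, 0) (dd (0, axis j 1) Fs)"
    unfolding Fss_def by (rule ext) (rule dd_commute[OF smooth_F(1)])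
  show "pd j V p = Fsj j (0, p)" "pd j W p = Fssj j (0, p)"
    unfolding V_def[abs_def] W_def[abs_def] slice_smooth(2)[OF smooth_F(1)] slice_smooth(2)[OF smooth_F(2)] c2 c1
    by (simp_all add: Fssj_def)
qed

lemma far_bound: "\<exists>B\<ge>0. \<forall>s p. far i0 B p \<longrightarrow> Fv s p = cyl i0 p"
proof -
  obtain B where B: "\<And>s p. far i0 B p \<Longrightarrow> Fv s p = cyl i0 p"
    using var unfolding cyl_variation_def far_def by blast
  have "far i0 B p" if "far i0 (max B 0) p" for p using that by (auto simp: far_def)
  then show ?thesis using B by (intro exI[of _ "max B 0"]) auto
qed

lemma periodic_Fv: "periodic_in i0 (Fv s)" using var by (simp add: cyl_variation_def)

lemma Fv_0: "Fv 0 = cyl i0" using var by (simp add: cyl_variation_def)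

lemma far_V: assumes "\<And>s p. far i0 B p \<Longrightarrow> Fv s p = cyl i0 p" "far i0 B p" shows "V p = 0" "W p = 0"
proof -
  have 0: "Fs (s, p) = 0" for s
  proof -
    have "((\<lambda>s. cyl i0 p) has_vector_derivative Fs (s, p)) (at s)"
      using F_derivs(1)[of p s] assms by simp
    then show ?thesis using vector_derivative_unique_at has_vector_derivative_const by blast
  qed
  have "((\<lambda>s. 0) has_vector_derivative Fss (0, p)) (at 0)"
    using F_derivs(2)[of p 0] unfolding 0 .
  then have "Fss (0, p) = 0" using vector_derivative_unique_at has_vector_derivative_const by blast
  then show "V p = 0" "W p = 0" using 0 by (auto simp: V_def W_def)
qed

lemma periodic_V: "periodic_in i0 V" "periodic_in i0 W"
proof -
  let ?q = "\<lambda>p. p + (2 * pi) *\<^sub>R axis i0 1"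
  have e: "(\<lambda>s. Fv s (?q p)) = (\<lambda>s. Fv s p)" for p using periodic_Fv by (auto simp: periodic_in_def)
  have 0: "Fs (s, ?q p) = Fs (s, p)" for s p
    using F_derivs(1)[of "?q p" s] F_derivs(1)[of p s] unfolding e by (rule vector_derivative_unique_at)
  have "Fss (s, ?q p) = Fss (s, p)" for s p
    using F_derivs(2)[of "?q p" s] F_derivs(2)[of p s] unfolding 0 by (rule vector_derivative_unique_at)
  then show "periodic_in i0 V" "periodic_in i0 W" using 0 by (auto simp: V_def W_def periodic_in_def)
qed

lemma csmooth_V: "csmooth i0 (tc i0 V k)" "csmooth i0 (nc i0 V k)" "csmooth i0 (tc i0 W k)"
proof -
  obtain B where B: "\<And>s p. far i0 B p \<Longrightarrow> Fv s p = cyl i0 p" using far_bound by auto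
  show "csmooth i0 (tc i0 V k)" "csmooth i0 (nc i0 V k)" "csmooth i0 (tc i0 W k)"
    using csmooth_components[OF smooth_V(1) periodic_V(1), of B k] csmooth_components[OF smooth_V(2) periodic_V(2), of B k]
      far_V[OF B] by blast+
qed

definition g1 where "g1 s p = (\<chi> i j. Fsj i (s, p) \<bullet> Fj j (s, p) + Fj i (s, p) \<bullet> Fsj j (s, p))"
definition g2 where "g2 s p = (\<chi> i j. Fssj i (s, p) \<bullet> Fj j (s, p) + 2 * (Fsj i (s, p) \<bullet> Fsj j (s, p)) + Fj i (s, p) \<bullet> Fssj j (s, p))"
definition G where "G s p = det (metric (Fv s) p)"
definition G1 where "G1 s p = det1 (metric (Fv s) p) (g1 s p)"
definition G2 where "G2 s p = det2 (metric (Fv s) p) (g1 s p) (g2 s p)"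
definition ph where "ph s p = (Fv s p - s *\<^sub>R z) \<bullet> (Fv s p - s *\<^sub>R z)"
definition ph1 where "ph1 s p = 2 * ((Fv s p - s *\<^sub>R z) \<bullet> (Fs (s, p) - z))"
definition ph2 where "ph2 s p = 2 * ((Fs (s, p) - z) \<bullet> (Fs (s, p) - z)) + 2 * ((Fv s p - s *\<^sub>R z) \<bullet> Fss (s, p))"

lemma metric_Fv: "metric (Fv s) p = (\<chi> i j. Fj i (s, p) \<bullet> Fj j (s, p))"
  by (simp add: metric_def pd_Fv)

lemma inner_deriv:
  fixes f g :: "real \<Rightarrow> complex^'n"
  assumes "(f has_vector_derivative f') (at s)" "(g has_vector_derivative g') (at s)"
  shows "((\<lambda>s. f s \<bullet> g s) has_real_derivative f s \<bullet> g' + f' \<bullet> g s) (at s)"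
  using bounded_bilinear.has_vector_derivative[OF bounded_bilinear_inner assms]
  by (simp add: has_real_derivative_iff_has_vector_derivative)

lemma G_derivs: "((\<lambda>s. G s p) has_real_derivative G1 s p) (at s)" "((\<lambda>s. G1 s p) has_real_derivative G2 s p) (at s)"
proof -
  have a: "((\<lambda>s. metric (Fv s) p $ i $ j) has_real_derivative g1 s p $ i $ j) (at s)" for i j
    unfolding metric_Fv g1_def using inner_deriv[OF F_derivs(3)[of i] F_derivs(3)[of j], of p p s] by (simp add: add.commute)
  have b: "((\<lambda>s. g1 s p $ i $ j) has_real_derivative g2 s p $ i $ j) (at s)" for i j
  proof -
    have "((\<lambda>s. Fsj i (s, p) \<bullet> Fj j (s, p) + Fj i (s, p) \<bullet> Fsj j (s, p)) has_real_derivative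
        (Fsj i (s, p) \<bullet> Fsj j (s, p) + Fssj i (s, p) \<bullet> Fj j (s, p)) + (Fj i (s, p) \<bullet> Fssj j (s, p) + Fsj i (s, p) \<bullet> Fsj j (s, p))) (at s)"
      by (intro DERIV_add inner_deriv F_derivs)
    moreover have "(Fsj i (s, p) \<bullet> Fsj j (s, p) + Fssj i (s, p) \<bullet> Fj j (s, p)) + (Fj i (s, p) \<bullet> Fssj j (s, p) + Fsj i (s, p) \<bullet> Fsj j (s, p))
        = g2 s p $ i $ j" by (simp add: g2_def)
    ultimately show ?thesis by (simp add: g1_def)
  qed
  show "((\<lambda>s. G s p) has_real_derivative G1 s p) (at s)" "((\<lambda>s. G1 s p) has_real_derivative G2 s p) (at s)"
    unfolding G_def G1_def G2_def using has_real_derivative_det1[OF a b] by blast+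
qed

lemma ph_derivs: "((\<lambda>s. ph s p) has_real_derivative ph1 s p) (at s)" "((\<lambda>s. ph1 s p) has_real_derivative ph2 s p) (at s)"
proof -
  have a: "((\<lambda>s. Fv s p - s *\<^sub>R z) has_vector_derivative Fs (s, p) - z) (at s)"
    using has_vector_derivative_diff[OF F_derivs(1) has_vector_derivative_scaleR[OF DERIV_ident has_vector_derivative_const]] by simp
  have b: "((\<lambda>s. Fs (s, p) - z) has_vector_derivative Fss (s, p)) (at s)"
    using has_vector_derivative_diff[OF F_derivs(2) has_vector_derivative_const] by simp
  show "((\<lambda>s. ph s p) has_real_derivative ph1 s p) (at s)"
    unfolding ph_def ph1_def using inner_deriv[OF a a] by (simp add: inner_commute)
  show "((\<lambda>s. ph1 s p) has_real_derivative ph2 s p) (at s)"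
    unfolding ph1_def ph2_def using DERIV_cmult[OF inner_deriv[OF a b], of 2] by (simp add: algebra_simps)
qed

abbreviation (input) tt where "tt s \<equiv> 1 + h * s"

text \<open>
  \<open>exp E\<close> is the integrand of \<open>F\<close> with the factor \<open>exp (- |y|\<^sup>2 / 4)\<close> and constants removed;
  \<open>E1\<close> and \<open>E2\<close> are its derivatives in \<open>s\<close> for \<open>x\<^sub>s = s z\<close> and \<open>t\<^sub>s = 1 + h s\<close>.
\<close>

definition E where "E s p = - real CARD('n) / 2 * ln (tt s) - ph s p / (4 * tt s) + yy i0 p / 4 + ln (G s p) / 2"
definition E1 where "E1 s p = - real CARD('n) / 2 * (h / tt s) - ph1 s p / (4 * tt s) + h * ph s p / (4 * (tt s)\<^sup>2) + G1 s p / (2 * G s p)"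
definition E2 where "E2 s p = real CARD('n) / 2 * (h\<^sup>2 / (tt s)\<^sup>2) - ph2 s p / (4 * tt s) + h * ph1 s p / (2 * (tt s)\<^sup>2) - h\<^sup>2 * ph s p / (2 * (tt s) ^ 3)
    + (G2 s p / G s p - (G1 s p / G s p)\<^sup>2) / 2"

lemma E_derivs:
  assumes t: "tt s > 0" and G: "G s p > 0"
  shows "((\<lambda>s. E s p) has_real_derivative E1 s p) (at s)" "((\<lambda>s. E1 s p) has_real_derivative E2 s p) (at s)"
proof -
  have dt: "((\<lambda>s. tt s) has_real_derivative h) (at s)" by (auto intro!: derivative_eq_intros)
  have "((\<lambda>s. E s p) has_real_derivative
      - real CARD('n) / 2 * (h / tt s) - (ph1 s p * (4 * tt s) - ph s p * (4 * h)) / ((4 * tt s) * (4 * tt s)) + 0 + (G1 s p / G s p) / 2) (at s)"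
    unfolding E_def
  proof (intro DERIV_add DERIV_diff DERIV_divide DERIV_cmult ph_derivs dt DERIV_const DERIV_cdivide)
    show "((\<lambda>s. ln (tt s)) has_real_derivative h / tt s) (at s)"
      using DERIV_ln_divide[OF t] DERIV_chain2[OF DERIV_ln_divide[OF t] dt] by simp
    show "((\<lambda>s. ln (G s p)) has_real_derivative G1 s p / G s p) (at s)"
      using DERIV_chain2[OF DERIV_ln_divide[OF G] G_derivs(1)] by simp
  qed (use t in simp)
  moreover have "- real CARD('n) / 2 * (h / tt s) - (ph1 s p * (4 * tt s) - ph s p * (4 * h)) / ((4 * tt s) * (4 * tt s)) + 0 + (G1 s p / G s p) / 2 = E1 s p"
  proof -
    have "(a * (4 * t) - b * (4 * c)) / ((4 * t) * (4 * t)) = a / (4 * t) - c * b / (4 * t\<^sup>2)" if "t > 0" for a b c t :: real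
      using that by (simp add: field_simps power2_eq_square)
    from this[OF t] show ?thesis unfolding E1_def using G by simp
  qed
  ultimately show "((\<lambda>s. E s p) has_real_derivative E1 s p) (at s)" by simp
  have dt2: "((\<lambda>s. 4 * (tt s)\<^sup>2) has_real_derivative 8 * tt s * h) (at s)"
    by (auto intro!: derivative_eq_intros simp: algebra_simps)
  have dt4: "((\<lambda>s. 4 * tt s) has_real_derivative 4 * h) (at s)" using DERIV_cmult[OF dt, of 4] .
  have "((\<lambda>s. E1 s p) has_real_derivative
      - real CARD('n) / 2 * ((0 * tt s - h * h) / (tt s * tt s)) - (ph2 s p * (4 * tt s) - ph1 s p * (4 * h)) / ((4 * tt s) * (4 * tt s))
      + ((h * ph1 s p) * (4 * (tt s)\<^sup>2) - h * ph s p * (8 * tt s * h)) / ((4 * (tt s)\<^sup>2) * (4 * (tt s)\<^sup>2))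
      + (G2 s p * (2 * G s p) - G1 s p * (2 * G1 s p)) / ((2 * G s p) * (2 * G s p))) (at s)"
    unfolding E1_def
    by (intro DERIV_add DERIV_diff DERIV_divide DERIV_cmult ph_derivs G_derivs dt dt2 dt4 DERIV_const) (use t G in auto)
  moreover have "- real CARD('n) / 2 * ((0 * tt s - h * h) / (tt s * tt s)) - (ph2 s p * (4 * tt s) - ph1 s p * (4 * h)) / ((4 * tt s) * (4 * tt s))
      + ((h * ph1 s p) * (4 * (tt s)\<^sup>2) - h * ph s p * (8 * tt s * h)) / ((4 * (tt s)\<^sup>2) * (4 * (tt s)\<^sup>2))
      + (G2 s p * (2 * G s p) - G1 s p * (2 * G1 s p)) / ((2 * G s p) * (2 * G s p)) = E2 s p"
  proof -
    have 1: "- N / 2 * ((0 * t - h * h) / (t * t)) = N / 2 * (h\<^sup>2 / t\<^sup>2)" for t N :: real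
      by (simp add: power2_eq_square)
    have 2: "(a * (4 * t) - b * (4 * c)) / ((4 * t) * (4 * t)) = a / (4 * t) - c * b / (4 * t\<^sup>2)" if "t > 0" for a b c t :: real
      using that by (simp add: field_simps power2_eq_square)
    have 3: "(c * b * (4 * t\<^sup>2) - c * a * (8 * t * c)) / ((4 * t\<^sup>2) * (4 * t\<^sup>2)) = c * b / (4 * t\<^sup>2) - c\<^sup>2 * a / (2 * t ^ 3)" if "t > 0" for a b c t :: real
      using that by (simp add: field_simps power2_eq_square power3_eq_cube)
    have 4: "(g2 * (2 * g) - g1 * (2 * g1)) / ((2 * g) * (2 * g)) = (g2 / g - (g1 / g)\<^sup>2) / 2" if "g > 0" for g g1 g2 :: real
      using that by (simp add: field_simps power2_eq_square)
    show ?thesis unfolding 1 2[OF t] 3[OF t] 4[OF G] E2_def by simp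
  qed
  ultimately show "((\<lambda>s. E1 s p) has_real_derivative E2 s p) (at s)" by simp
qed

lemma cont_F: "continuous_on A (\<lambda>(s, p). Fv s p)" "continuous_on A Fs" "continuous_on A Fss"
  "continuous_on A (Fj j)" "continuous_on A (Fsj j)" "continuous_on A (Fssj j)"
  using smooth_continuous_on[OF smooth_FF] by (auto simp: FF_def intro!: smooth_continuous_on smooth_F)

lemma continuous_on_det:
  fixes M :: "'a::topological_space \<Rightarrow> real^'m::finite^'m"
  assumes "\<And>i j. continuous_on A (\<lambda>x. M x $ i $ j)"
  shows "continuous_on A (\<lambda>x. det (M x))"
  unfolding det_def by (intro continuous_intros assms)

lemma cont_G: "continuous_on A (\<lambda>x. G (fst x) (snd x))" "continuous_on A (\<lambda>x. G1 (fst x) (snd x))"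
  "continuous_on A (\<lambda>x. G2 (fst x) (snd x))"
  "continuous_on A (\<lambda>x. ph (fst x) (snd x))" "continuous_on A (\<lambda>x. ph1 (fst x) (snd x))" "continuous_on A (\<lambda>x. ph2 (fst x) (snd x))"
proof -
  have Fv: "continuous_on A (\<lambda>x. Fv (fst x) (snd x))" using cont_F(1) by (simp add: case_prod_beta)
  have m: "continuous_on A (\<lambda>x. metric (Fv (fst x)) (snd x) $ i $ j)"
    "continuous_on A (\<lambda>x. g1 (fst x) (snd x) $ i $ j)" "continuous_on A (\<lambda>x. g2 (fst x) (snd x) $ i $ j)" for i j
    unfolding metric_Fv g1_def g2_def by (auto intro!: continuous_intros cont_F)
  show "continuous_on A (\<lambda>x. G (fst x) (snd x))"
    unfolding G_def by (intro continuous_on_det m)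
  have cif: "continuous_on A f \<Longrightarrow> continuous_on A g \<Longrightarrow> continuous_on A (\<lambda>x. if b then f x else g x)"
    for b and f g :: "real \<times> (real^'n) \<Rightarrow> real" by (cases b) auto
  have ic: "(if b then x else y) $ j = (if b then x $ j else y $ j)" for b and x y :: "real^'n" and j by simp
  show "continuous_on A (\<lambda>x. G1 (fst x) (snd x))"
    unfolding G1_def det1_def by (intro continuous_on_sum continuous_on_det) (simp add: ic cif m)
  show "continuous_on A (\<lambda>x. G2 (fst x) (snd x))"
    unfolding G2_def det2_def by (intro continuous_on_sum continuous_on_det) (simp add: ic cif m)
  show "continuous_on A (\<lambda>x. ph (fst x) (snd x))" "continuous_on A (\<lambda>x. ph1 (fst x) (snd x))" "continuous_on A (\<lambda>x. ph2 (fst x) (snd x))"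
    unfolding ph_def ph1_def ph2_def using cont_F(2,3) by (auto intro!: continuous_intros Fv)
qed

text \<open>A variation is not assumed to consist of immersions. On this open set the metric is
  nondegenerate and the time positive, so the logarithms in \<open>E\<close> are meaningful.\<close>

definition good where "good = {x :: real \<times> (real^'n). G (fst x) (snd x) > 0 \<and> tt (fst x) > 0}"

lemma open_good: "open good"
  unfolding good_def by (intro open_Collect_conj open_Collect_less continuous_intros cont_G)

lemma cont_E: "continuous_on good (\<lambda>x. E (fst x) (snd x))" "continuous_on good (\<lambda>x. E1 (fst x) (snd x))"
  "continuous_on good (\<lambda>x. E2 (fst x) (snd x))"
proof -
  have ne: "G (fst x) (snd x) \<noteq> 0" "tt (fst x) \<noteq> 0" "G (fst x) (snd x) > 0" "tt (fst x) > 0" if "x \<in> good" for x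
    using that by (auto simp: good_def)
  have y: "continuous_on good (\<lambda>x. yy i0 (snd x))" unfolding yy_def by (intro continuous_intros)
  show "continuous_on good (\<lambda>x. E (fst x) (snd x))" "continuous_on good (\<lambda>x. E1 (fst x) (snd x))"
  "continuous_on good (\<lambda>x. E2 (fst x) (snd x))"
    unfolding E_def E1_def E2_def
    by (intro continuous_intros cont_G y; use ne in \<open>auto dest!: ne\<close>)+
qed

end

lemma prod_lam: "(\<Prod>i\<in>UNIV. 1 / (lam i0 (i :: 'n::finite))\<^sup>2) = 2"
proof -
  have "(\<Prod>i\<in>UNIV - {i0}. 1 / (lam i0 i)\<^sup>2) = 1" by (intro prod.neutral) (auto simp: lam_def)
  then show ?thesis by (simp add: prod.remove[of UNIV i0] lam_def power_divide)
qed

context variation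
begin

lemma G_0: "G 0 p = 2"
  unfolding G_def Fv_0 using det1_diag(1)[OF metric_cyl, of i0 p] lam_pos(2)[of i0] by (simp add: prod_lam)

lemma metric_far:
  assumes "\<And>s p. far i0 B p \<Longrightarrow> Fv s p = cyl i0 p" "far i0 B p"
  shows "metric (Fv s) p = (\<chi> i j. if i = j then 1 / (lam i0 i)\<^sup>2 else 0)"
proof -
  have "pd j (Fv s) p = pd j (cyl i0) p" for j
    unfolding pd_eq_dd by (rule dd_cong_open[OF open_far[of i0 B]]) (use assms smooth_Fv in auto)
  then have "metric (Fv s) p = metric (cyl i0) p" by (simp add: metric_def)
  then show ?thesis by (simp add: vec_eq_iff metric_cyl)
qed

text \<open>Since \<open>z\<close> has no real part in the flat slots, the cross terms between
  position and translation vanish there, and the flat coordinates enter \<open>ph\<close> only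
  through \<open>yy\<close>.\<close>

lemma ph_far:
  assumes "Fv s p = cyl i0 p"
  shows "ph s p - yy i0 p = (sqrt 2 *\<^sub>R cis (p $ i0) - s *\<^sub>R z $ i0) \<bullet> (sqrt 2 *\<^sub>R cis (p $ i0) - s *\<^sub>R z $ i0)
     + (\<Sum>k\<in>UNIV - {i0}. (s * Im (z $ k))\<^sup>2)"
proof -
  have "ph s p = (cyl i0 p $ i0 - s *\<^sub>R z $ i0) \<bullet> (cyl i0 p $ i0 - s *\<^sub>R z $ i0)
      + (\<Sum>k\<in>UNIV - {i0}. (cyl i0 p $ k - s *\<^sub>R z $ k) \<bullet> (cyl i0 p $ k - s *\<^sub>R z $ k))"
    unfolding ph_def assms inner_vec_def by (simp add: sum.remove[of UNIV i0])
  also have "(\<Sum>k\<in>UNIV - {i0}. (cyl i0 p $ k - s *\<^sub>R z $ k) \<bullet> (cyl i0 p $ k - s *\<^sub>R z $ k))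
      = (\<Sum>k\<in>UNIV - {i0}. (p $ k)\<^sup>2 + (s * Im (z $ k))\<^sup>2)"
    by (intro sum.cong) (auto simp: cyl_def inner_complex_def z_normal power2_eq_square)
  finally show ?thesis by (simp add: sum.distrib yy_def cyl_nth nu_def)
qed

text \<open>
  Outside a compact part \<open>E\<close> depends only on the angle (this needs \<open>h_cases\<close>), so compactness yields
  bounds that are uniform on the whole cylinder.
\<close>

lemma uniform_bounds:
  "\<exists>e>0. \<exists>C. \<forall>s p. \<bar>s\<bar> < e \<longrightarrow> (s, p) \<in> good \<and> \<bar>E s p\<bar> \<le> C \<and> \<bar>E1 s p\<bar> \<le> C \<and> \<bar>E2 s p\<bar> \<le> C"
proof -
  obtain B where B0: "B \<ge> 0" and B: "\<And>s p. far i0 B p \<Longrightarrow> Fv s p = cyl i0 p" using far_bound by auto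
  let ?K = "Kbox i0 (B + 1)"
  have cK: "compact ?K" by (simp add: Kbox_def)
  \<comment> \<open>At \<open>s = 0\<close> every point is good because \<open>G\<close> is the
    constant 2; compactness of the box extends this to an interval of \<open>s\<close>.\<close>
  have "\<exists>U V. openin euclidean U \<and> openin euclidean V \<and> 0 \<in> U \<and> ?K \<subseteq> V \<and> U \<times> V \<subseteq> good"
    by (rule tube_lemma_right) (use open_good cK G_0 in \<open>auto simp: euclidean_product_topology compactin_euclidean_iff good_def\<close>)
  then obtain U V' where UV: "open U" "0 \<in> U" "?K \<subseteq> V'" "U \<times> V' \<subseteq> good" by auto
  then obtain e where e: "e > 0" "cball 0 e \<subseteq> U" using open_contains_cball by blast
  let ?S = "cball (0::real) e \<times> ?K"
  have Sg: "?S \<subseteq> good" using UV e by auto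
  have "compact ?S" using cK by (intro compact_Times) auto
  then have bd: "\<exists>C. \<forall>x\<in>?S. \<bar>f x\<bar> \<le> C" if "continuous_on good f" for f :: "real \<times> (real^'n) \<Rightarrow> real"
    using compact_imp_bounded[OF compact_continuous_image[OF continuous_on_subset[OF that Sg]]]
    unfolding bounded_iff by (metis imageI real_norm_def)
  obtain C0 C1 C2 where C: "\<And>x. x \<in> ?S \<Longrightarrow> \<bar>E (fst x) (snd x)\<bar> \<le> C0 \<and> \<bar>E1 (fst x) (snd x)\<bar> \<le> C1 \<and> \<bar>E2 (fst x) (snd x)\<bar> \<le> C2"
    using bd[OF cont_E(1)] bd[OF cont_E(2)] bd[OF cont_E(3)] by metis
  \<comment> \<open>All times are packed into the value of \<open>f\<close>, so that one
    representative \<open>q\<close> in the box serves every \<open>s\<close>. The equality of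
    \<open>E\<close> at both points can then be differentiated in \<open>s\<close> to compare
    \<open>E1\<close> and \<open>E2\<close>.\<close>
  define f where "f = (\<lambda>p. \<lambda>s. (G s p, E s p))"
  have perf: "periodic_in i0 f"
  proof -
    have m: "metric (Fv s) (p + (2 * pi) *\<^sub>R axis i0 1) = metric (Fv s) p" for s p
      using periodic_in_pd[OF smooth_Fv periodic_Fv] by (simp add: metric_def periodic_in_def)
    have "Fv s (p + (2 * pi) *\<^sub>R axis i0 1) = Fv s p" for s p using periodic_Fv by (simp add: periodic_in_def)
    moreover have "yy i0 (p + (2 * pi) *\<^sub>R axis i0 1) = yy i0 p" for p
      unfolding yy_def by (intro sum.cong) (auto simp: axis_def)
    ultimately show ?thesis by (simp add: periodic_in_def f_def G_def E_def ph_def m)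
  qed
  have invf: "f p = f q" if pq: "far i0 B p" "far i0 B q" "p $ i0 = q $ i0" for p q
  proof -
    have Gpq: "G s p = G s q" for s unfolding G_def using metric_far[OF B pq(1)] metric_far[OF B pq(2)] by simp
    have h0: "h = 0" using h_cases pq(1) by (auto simp: far_def)
    have pe: "ph s p - yy i0 p = ph s q - yy i0 q" for s
      using ph_far[OF B[OF pq(1)]] ph_far[OF B[OF pq(2)]] pq(3) by simp
    have "E s p = E s q" for s
      unfolding E_def Gpq using pe[of s] by (simp add: h0)
    then show ?thesis by (simp add: f_def Gpq)
  qed
  have main: "(s, p) \<in> good \<and> \<bar>E s p\<bar> \<le> C0 \<and> \<bar>E1 s p\<bar> \<le> C1 \<and> \<bar>E2 s p\<bar> \<le> C2" if s: "\<bar>s\<bar> < e" for s p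
  proof -
    obtain q where q: "q \<in> ?K" "f p = f q" using reduce_to_Kbox[OF perf B0 invf] by blast
    have eq: "G r p = G r q" "E r p = E r q" for r using q(2) by (auto simp: f_def fun_eq_iff)
    have gq: "(r, q) \<in> good" if "\<bar>r\<bar> < e" for r using Sg q(1) that by (auto simp: subset_iff)
    then have gp: "(r, p) \<in> good" if "\<bar>r\<bar> < e" for r using that eq(1) by (simp add: good_def)
    have e1: "E1 r p = E1 r q" if r: "\<bar>r\<bar> < e" for r
    proof (rule DERIV_unique)
      show "((\<lambda>s. E s p) has_real_derivative E1 r p) (at r)" using gp[OF r] by (intro E_derivs) (auto simp: good_def)
      show "((\<lambda>s. E s p) has_real_derivative E1 r q) (at r)"
        using gq[OF r] unfolding eq by (intro E_derivs) (auto simp: good_def)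
    qed
    have "E2 s p = E2 s q"
    proof (rule DERIV_unique)
      show "((\<lambda>s. E1 s p) has_real_derivative E2 s p) (at s)" using gp[OF s] by (intro E_derivs) (auto simp: good_def)
      have 1: "((\<lambda>s. E1 s q) has_real_derivative E2 s q) (at s)" using gq[OF s] by (intro E_derivs) (auto simp: good_def)
      show "((\<lambda>s. E1 s p) has_real_derivative E2 s q) (at s)"
      proof (rule has_field_derivative_transform_within_open[OF 1, of "{-e<..<e}"])
        show "E1 r q = E1 r p" if "r \<in> {-e<..<e}" for r using e1[of r] that by auto
      qed (use s in auto)
    qed
    moreover have "(s, q) \<in> ?S" using s q(1) by auto
    ultimately show ?thesis using C[of "(s, q)"] gp[OF s] e1[OF s] eq(2)[of s] by simp
  qed
  show ?thesis
    by (rule exI[of _ e], rule conjI[OF e(1)], rule exI[of _ "max C0 (max C1 C2)"]) (use main in \<open>auto simp: le_max_iff_disj\<close>)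
qed

text \<open>With the Gaussian factor removed and the radius constant, nothing varies over the
  cylinder. Hence \<open>exp (E 0 p)\<close> factors out of the second derivative and leaves an
  integral against \<open>cmeas\<close>.\<close>

lemma E_0: "E 0 p = ln 2 / 2 - 1 / 2"
  by (simp add: E_def G_0 ph_def Fv_0 cyl_norm field_simps)

lemma cont_slice:
  assumes "continuous_on good (\<lambda>x. f (fst x) (snd x))" "\<And>p. (s, p) \<in> good"
  shows "continuous_on UNIV (f s)"
proof -
  have "continuous_on UNIV (\<lambda>p. (\<lambda>x. f (fst x) (snd x)) (s, p))"
    by (rule continuous_on_compose2[OF assms(1)]) (use assms(2) in \<open>auto intro!: continuous_intros\<close>)
  then show ?thesis by simp
qed

lemma Ffun_eq:
  assumes g: "\<And>p. (s, p) \<in> good" and b: "bddm (\<lambda>p. exp (E s p))"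
  shows "Ffun i0 (s *\<^sub>R z) (tt s) (Fv s)
    = (4 * pi) powr (- real CARD('n) / 2) * (2 * pi * sqrt (4 * pi) ^ (CARD('n) - 1)) * (\<integral>p. exp (E s p) \<partial>cmeas i0)"
proof -
  have t: "tt s > 0" and G: "\<And>p. G s p > 0" using g by (auto simp: good_def)
  have pw: "(4 * pi * tt s) powr (- real CARD('n) / 2) = (4 * pi) powr (- real CARD('n) / 2) * tt s powr (- real CARD('n) / 2)"
    by (rule powr_mult)
  have ig: "exp (- (norm (Fv s p - s *\<^sub>R z))\<^sup>2 / (4 * tt s)) * area_density (Fv s) p
      = inverse (tt s powr (- real CARD('n) / 2)) * (exp (- yy i0 p / 4) * exp (E s p))" for p
  proof -
    have "sqrt (G s p) = exp (ln (G s p) / 2)"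
      using G[of p] by (simp add: powr_half_sqrt[symmetric] powr_def)
    moreover have "inverse (tt s powr (- real CARD('n) / 2)) = exp (real CARD('n) / 2 * ln (tt s))"
      using t by (simp add: powr_def exp_minus[symmetric])
    ultimately show ?thesis
      unfolding area_density_def G_def[symmetric] E_def ph_def[symmetric] power2_norm_eq_inner
      by (simp add: exp_add[symmetric])
  qed
  have tp: "tt s powr (- real CARD('n) / 2) \<noteq> 0" using t by simp
  have "integral (fund_dom i0) (\<lambda>p. exp (- (norm (Fv s p - s *\<^sub>R z))\<^sup>2 / (4 * tt s)) * area_density (Fv s) p)
      = inverse (tt s powr (- real CARD('n) / 2)) * integral (fund_dom i0) (\<lambda>p. exp (- yy i0 p / 4) * exp (E s p))"
    unfolding ig by simp
  then show ?thesis
    unfolding Ffun_def pw integral_fund_dom[OF b] using tp by (simp add: field_simps)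
qed

text \<open>Two differentiations under the integral sign, dominated through
  \<open>uniform_bounds\<close>. The positive factor \<open>c\<close> collects the normalisation of
  \<open>Ffun\<close> and the constant \<open>exp (E 0 p)\<close>.\<close>

lemma second_derivative:
  "\<exists>D1 c. c > 0 \<and> (\<forall>\<^sub>F s in nhds 0. ((\<lambda>r. Ffun i0 (r *\<^sub>R z) (1 + h * r) (Fv r)) has_real_derivative D1 s) (at s)) \<and>
     (D1 has_real_derivative c * (\<integral>p. (E1 0 p)\<^sup>2 + E2 0 p \<partial>cmeas i0)) (at 0)"
proof -
  obtain e C where e: "e > 0" and C: "\<And>s p. \<bar>s\<bar> < e \<Longrightarrow> (s, p) \<in> good \<and> \<bar>E s p\<bar> \<le> C \<and> \<bar>E1 s p\<bar> \<le> C \<and> \<bar>E2 s p\<bar> \<le> C"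
    using uniform_bounds by blast
  have C0: "C \<ge> 0" using C[of 0 0] e by auto
  interpret prob_space "cmeas i0" by (rule prob_space_cmeas)
  define k where "k = (4 * pi) powr (- real CARD('n) / 2) * (2 * pi * sqrt (4 * pi) ^ (CARD('n) - 1))"
  have kpos: "k > 0" unfolding k_def by simp
  have bE: "bddm (E s)" "bddm (E1 s)" "bddm (E2 s)" "bddm (\<lambda>p. exp (E s p))" if "\<bar>s\<bar> < e" for s
  proof -
    have g: "\<And>p. (s, p) \<in> good" using C that by blast
    note c = cont_slice[OF cont_E(1) g] cont_slice[OF cont_E(2) g] cont_slice[OF cont_E(3) g]
    show "bddm (E s)" "bddm (E1 s)" "bddm (E2 s)"
      using c C[OF that] by (auto simp: bddm_def intro!: borel_measurable_continuous_onI)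
    have "\<bar>exp (E s p)\<bar> \<le> exp C" for p using C[OF that, of p] by auto
    then show "bddm (\<lambda>p. exp (E s p))"
      using c(1) by (auto simp: bddm_def intro!: borel_measurable_continuous_onI continuous_intros)
  qed
  define D1 where "D1 = (\<lambda>s. k * (\<integral>p. E1 s p * exp (E s p) \<partial>cmeas i0))"
  have m: "f \<in> borel_measurable (cmeas i0)" if "bddm f" for f
    using bddmD[OF that] by (simp cong: measurable_cong_sets)
  have d1: "((\<lambda>r. Ffun i0 (r *\<^sub>R z) (1 + h * r) (Fv r)) has_real_derivative D1 s) (at s)" if s: "\<bar>s\<bar> < e" for s
  proof -
    have "((\<lambda>s. \<integral>p. exp (E s p) \<partial>cmeas i0) has_real_derivative (\<integral>p. E1 s p * exp (E s p) \<partial>cmeas i0)) (at s)"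
    proof (rule has_real_derivative_integral[where a = "-e" and b = e and C = "C * exp C"])
      fix r p assume r: "r \<in> {-e<..<e}"
      then have r': "\<bar>r\<bar> < e" by auto
      show "integrable (cmeas i0) (\<lambda>p. exp (E r p))" using bE(4)[OF r'] by (rule integrable_cmeas)
      show "((\<lambda>s. exp (E s p)) has_real_derivative E1 r p * exp (E r p)) (at r)"
        using DERIV_chain2[OF DERIV_exp E_derivs(1)] C[OF r', of p] by (simp add: good_def mult.commute)
      show "\<bar>E1 r p * exp (E r p)\<bar> \<le> C * exp C"
        unfolding abs_mult using C[OF r', of p] C0 by (intro mult_mono) auto
    qed (use s bE[OF s] in \<open>auto intro!: m finite_measure_axioms\<close>)
    from DERIV_cmult[OF this, of k]
    have "((\<lambda>s. k * (\<integral>p. exp (E s p) \<partial>cmeas i0)) has_real_derivative D1 s) (at s)" by (simp add: D1_def)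
    then show ?thesis
    proof (rule has_field_derivative_transform_within_open[of _ _ _ "{-e<..<e}"])
      fix r assume "r \<in> {-e<..<e}"
      then have r: "\<bar>r\<bar> < e" by auto
      show "k * (\<integral>p. exp (E r p) \<partial>cmeas i0) = Ffun i0 (r *\<^sub>R z) (1 + h * r) (Fv r)"
        unfolding k_def using C[OF r] bE(4)[OF r] by (subst Ffun_eq) auto
    qed (use s in auto)
  qed
  have "((\<lambda>s. \<integral>p. E1 s p * exp (E s p) \<partial>cmeas i0) has_real_derivative (\<integral>p. ((E1 0 p)\<^sup>2 + E2 0 p) * exp (E 0 p) \<partial>cmeas i0)) (at 0)"
  proof (rule has_real_derivative_integral[where a = "-e" and b = e and C = "(C\<^sup>2 + C) * exp C"])
    fix r p assume r: "r \<in> {-e<..<e}"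
    then have r': "\<bar>r\<bar> < e" by auto
    show "integrable (cmeas i0) (\<lambda>p. E1 r p * exp (E r p))" using bE[OF r'] by (intro integrable_cmeas) auto
    have g: "tt r > 0" "G r p > 0" using C[OF r', of p] by (auto simp: good_def)
    show "((\<lambda>s. E1 s p * exp (E s p)) has_real_derivative ((E1 r p)\<^sup>2 + E2 r p) * exp (E r p)) (at r)"
      using DERIV_mult[OF E_derivs(2)[OF g] DERIV_chain2[OF DERIV_exp E_derivs(1)[OF g]]]
      by (simp add: power2_eq_square algebra_simps)
    have "\<bar>(E1 r p)\<^sup>2 + E2 r p\<bar> \<le> C\<^sup>2 + C"
    proof -
      have "(E1 r p)\<^sup>2 \<le> C\<^sup>2" using C[OF r', of p] C0 by (simp add: abs_le_square_iff[symmetric])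
      then show ?thesis using C[OF r', of p] zero_le_power2[of "E1 r p"] by linarith
    qed
    then show "\<bar>((E1 r p)\<^sup>2 + E2 r p) * exp (E r p)\<bar> \<le> (C\<^sup>2 + C) * exp C"
      unfolding abs_mult using C[OF r', of p] C0 by (intro mult_mono) auto
  qed (use e bE[of 0] in \<open>auto intro!: m finite_measure_axioms\<close>)
  from DERIV_cmult[OF this, of k]
  have "(D1 has_real_derivative k * (exp (ln 2 / 2 - 1 / 2) * (\<integral>p. (E1 0 p)\<^sup>2 + E2 0 p \<partial>cmeas i0))) (at 0)"
    by (simp add: D1_def[abs_def] E_0 mult.commute[of _ "exp _"])
  moreover have "\<forall>\<^sub>F s in nhds 0. ((\<lambda>r. Ffun i0 (r *\<^sub>R z) (1 + h * r) (Fv r)) has_real_derivative D1 s) (at s)"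
    unfolding eventually_nhds_metric using e d1 by (intro exI[of _ e]) (auto simp: dist_real_def)
  ultimately show ?thesis using kpos by (intro exI[of _ D1] exI[of _ "k * exp (ln 2 / 2 - 1 / 2)"]) (auto simp: mult.assoc)
qed

end

section \<open>The integrand of the second variation in the moving frame\<close>

context variation
begin

text \<open>In the unit frame the metric has first derivative \<open>m\<close> plus its transpose,
  and the trace of its second derivative contains the full squared derivative of \<open>V\<close>.
  Passing to the logarithm removes the squared trace, and the squares of \<open>m\<close> cancel;
  the squares of \<open>q\<close> and the products of \<open>m\<close> with its transpose
  remain.\<close>

lemma log_det_derivatives:
  defines "m \<equiv> \<lambda>k l p. lam i0 k * (pd k V p $ l \<bullet> eps i0 l p)"
    and "q \<equiv> \<lambda>k l p. lam i0 k * (pd k V p $ l \<bullet> nu i0 l p)"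
  shows "G1 0 p / G 0 p = 2 * (\<Sum>k\<in>UNIV. m k k p)"
    and "G2 0 p / G 0 p - (G1 0 p / G 0 p)\<^sup>2 = 2 * ((\<Sum>k\<in>UNIV. lam i0 k * (pd k W p $ k \<bullet> eps i0 k p))
        + (\<Sum>k\<in>UNIV. \<Sum>l\<in>UNIV. (q k l p)\<^sup>2) - (\<Sum>k\<in>UNIV. \<Sum>l\<in>UNIV. m k l p * m l k p))"
proof -
  define d where "d = (\<lambda>k. 1 / (lam i0 k)\<^sup>2)"
  have A: "metric (Fv 0) p $ i $ j = (if i = j then d i else 0)" for i j
    by (simp add: Fv_0 metric_cyl d_def)
  have dn: "d i \<noteq> 0" for i by (simp add: d_def lam_pos)
  have pr: "(\<Prod>i\<in>UNIV. d i) = 2" unfolding d_def by (rule prod_lam)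
  have Fj0: "Fj k (0, p) = axis k (eps i0 k p /\<^sub>R lam i0 k)" for k
    using pd_Fv[of k 0 p] by (simp add: Fv_0 pd_cyl)
  have g1e: "g1 0 p $ k $ l = (m k l p + m l k p) / (lam i0 k * lam i0 l)" for k l
    using lam_pos(2)[of i0 k] lam_pos(2)[of i0 l]
    by (simp add: g1_def Fj0 pd_V[symmetric] inner_axis inner_axis' m_def inner_commute[of "eps _ _ _"] field_simps)
  have nrm: "pd k V p \<bullet> pd k V p * (lam i0 k)\<^sup>2 = (\<Sum>l\<in>UNIV. (m k l p)\<^sup>2 + (q k l p)\<^sup>2)" for k
    unfolding inner_vec_def sum_distrib_right m_def q_def
  proof (intro sum.cong refl)
    fix l
    show "pd k V p $ l \<bullet> pd k V p $ l * (lam i0 k)\<^sup>2 = (lam i0 k * (pd k V p $ l \<bullet> eps i0 l p))\<^sup>2 + (lam i0 k * (pd k V p $ l \<bullet> nu i0 l p))\<^sup>2"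
      by (subst norm_frame[of _ i0 l p]) (simp add: power_mult_distrib algebra_simps)
  qed
  have g2e: "g2 0 p $ k $ k / d k = 2 * (lam i0 k * (pd k W p $ k \<bullet> eps i0 k p)) + 2 * (\<Sum>l\<in>UNIV. (m k l p)\<^sup>2 + (q k l p)\<^sup>2)" for k
  proof -
    have "g2 0 p $ k $ k = 2 * (pd k W p $ k \<bullet> eps i0 k p / lam i0 k) + 2 * (pd k V p \<bullet> pd k V p)"
      by (simp add: g2_def Fj0 pd_V[symmetric] inner_axis inner_axis' inner_commute[of "eps _ _ _"] field_simps)
    then show ?thesis unfolding nrm[symmetric] d_def
      using lam_pos(2)[of i0 k] by (simp add: power2_eq_square field_simps)
  qed
  have tr1: "g1 0 p $ k $ k / d k = 2 * m k k p" for k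
    using lam_pos(2)[of i0 k] by (simp add: g1e d_def power2_eq_square)
  have cr: "g1 0 p $ k $ l * g1 0 p $ l $ k / (d k * d l) = (m k l p)\<^sup>2 + (m l k p)\<^sup>2 + 2 * (m k l p * m l k p)" for k l
    using lam_pos(2)[of i0 k] lam_pos(2)[of i0 l] by (simp add: g1e d_def power2_eq_square field_simps)
  have 1: "G1 0 p / G 0 p = (\<Sum>k\<in>UNIV. 2 * m k k p)"
    unfolding G1_def G_0 det1_diag(2)[OF A dn] pr tr1 by simp
  then show "G1 0 p / G 0 p = 2 * (\<Sum>k\<in>UNIV. m k k p)" by (simp add: sum_distrib_left)
  have sw: "(\<Sum>k\<in>UNIV. \<Sum>l\<in>UNIV. (m l k p)\<^sup>2) = (\<Sum>k\<in>UNIV. \<Sum>l\<in>UNIV. (m k l p)\<^sup>2)" by (rule sum.swap)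
  have 2: "G2 0 p / G 0 p = (\<Sum>k\<in>UNIV. 2 * (lam i0 k * (pd k W p $ k \<bullet> eps i0 k p)) + 2 * (\<Sum>l\<in>UNIV. (m k l p)\<^sup>2 + (q k l p)\<^sup>2))
      + (G1 0 p / G 0 p)\<^sup>2 - (\<Sum>k\<in>UNIV. \<Sum>l\<in>UNIV. (m k l p)\<^sup>2 + (m l k p)\<^sup>2 + 2 * (m k l p * m l k p))"
    unfolding 1 unfolding G2_def G_0 det1_diag(3)[OF A dn] pr g2e tr1 cr by simp
  show "G2 0 p / G 0 p - (G1 0 p / G 0 p)\<^sup>2 = 2 * ((\<Sum>k\<in>UNIV. lam i0 k * (pd k W p $ k \<bullet> eps i0 k p))
        + (\<Sum>k\<in>UNIV. \<Sum>l\<in>UNIV. (q k l p)\<^sup>2) - (\<Sum>k\<in>UNIV. \<Sum>l\<in>UNIV. m k l p * m l k p))"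
    unfolding 2 by (simp add: sum.distrib sum_distrib_left[symmetric] sw)
qed

text \<open>The curvature of the circle contributes the radial component divided by sqrt 2, and the
  position term subtracts the same amount: this cancellation is the self-shrinker equation. Only a
  weighted divergence of the tangential part is left.\<close>

lemma trace_frame:
  assumes "smooth X"
  shows "(\<Sum>k\<in>UNIV. lam i0 k * (pd k X p $ k \<bullet> eps i0 k p)) - (cyl i0 p \<bullet> X p) / 2 = (\<Sum>k\<in>UNIV. del i0 k (tc i0 X k) p)"
proof -
  have d: "(\<Sum>k\<in>UNIV. if k = i0 \<and> k = i0 then c else 0) = (c::real)" for c by simp
  have s2: "sqrt 2 * x / 2 = x / sqrt 2" for x :: real by (simp add: field_simps)
  show ?thesis
    unfolding frame_derivatives(1)[OF assms] cyl_inner del_def sum.distrib sum_subtractf d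
    by (simp add: add_divide_distrib sum_divide_distrib s2)
qed

lemma cyl_inner_z: "cyl i0 p \<bullet> z = sqrt 2 * (Re (z $ i0) * cos (p $ i0) + Im (z $ i0) * sin (p $ i0))"
proof -
  have "Yk i0 k p * tc i0 (\<lambda>_. z) k p = 0" for k
    using z_normal[of k] by (auto simp: Yk_def tc_def eps_def inner_complex_def)
  then have "(\<Sum>k\<in>UNIV. Yk i0 k p * tc i0 (\<lambda>_. z) k p) = 0" by (intro sum.neutral) auto
  then show ?thesis
    using cyl_inner[of i0 p "\<lambda>_. z"] by (simp add: nc_def nu_def inner_complex_def)
qed

lemma one_dimensional:
  assumes "UNIV = {i0}"
  shows "CARD('n) = 1" "yy i0 p = 0" "Yk i0 k p = 0"
proof -
  show "CARD('n) = 1" using arg_cong[OF assms, of card] by simp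
  show "yy i0 p = 0" unfolding yy_def using assms by simp
  show "Yk i0 k p = 0" using assms by (auto simp: Yk_def)
qed

lemma integrand_eq:
  defines "\<zeta> \<equiv> \<lambda>p. Re (z $ i0) * cos (p $ i0) + Im (z $ i0) * sin (p $ i0)"
    and "\<zeta>' \<equiv> \<lambda>p. Im (z $ i0) * cos (p $ i0) - Re (z $ i0) * sin (p $ i0)"
    and "m \<equiv> \<lambda>k l p. Dk i0 k (tc i0 V l) p + (if k = i0 \<and> l = i0 then nc i0 V i0 p / sqrt 2 else 0)"
    and "q \<equiv> \<lambda>k l p. Dk i0 k (nc i0 V l) p - (if k = i0 \<and> l = i0 then tc i0 V i0 p / sqrt 2 else 0)"
  shows "(E1 0 p)\<^sup>2 + E2 0 p = ((\<Sum>k\<in>UNIV. del i0 k (tc i0 V k) p) + \<zeta> p / sqrt 2)\<^sup>2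
        - ((nc i0 V i0 p - \<zeta> p)\<^sup>2 + (tc i0 V i0 p - \<zeta>' p)\<^sup>2 + (\<Sum>j\<in>UNIV - {i0}. (tc i0 V j p)\<^sup>2 + (nc i0 V j p - (- Im (z $ j)))\<^sup>2)) / 2
        + h * sqrt 2 * (nc i0 V i0 p - \<zeta> p) - h\<^sup>2 / 2
        + (\<Sum>k\<in>UNIV. \<Sum>l\<in>UNIV. (q k l p)\<^sup>2) - (\<Sum>k\<in>UNIV. \<Sum>l\<in>UNIV. m k l p * m l k p)
        + (\<Sum>k\<in>UNIV. del i0 k (tc i0 W k) p)"
proof -
  have mm: "lam i0 k * (pd k V p $ l \<bullet> eps i0 l p) = m k l p" "lam i0 k * (pd k V p $ l \<bullet> nu i0 l p) = q k l p" for k l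
    unfolding m_def q_def by (rule frame_derivatives[OF smooth_V(1)])+
  have F0: "Fv 0 p = cyl i0 p" "Fs (0, p) = V p" "Fss (0, p) = W p" by (simp_all add: Fv_0 V_def W_def)
  have ph0: "ph 0 p = 2 + yy i0 p" by (simp add: ph_def F0 cyl_norm)
  have ph10: "ph1 0 p = 2 * (cyl i0 p \<bullet> V p) - 2 * (sqrt 2 * \<zeta> p)"
    by (simp add: ph1_def F0 inner_diff_right cyl_inner_z \<zeta>_def)
  have ph20: "ph2 0 p = 2 * ((V p - z) \<bullet> (V p - z)) + 2 * (cyl i0 p \<bullet> W p)"
    by (simp add: ph2_def F0)
  have s2: "sqrt 2 / 2 * x = x / sqrt 2" for x :: real by (simp add: field_simps)
  \<comment> \<open>A nonzero \<open>h\<close> forces n = 1, where \<open>yy\<close> vanishes and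
    only the circle contributes to the position term; this collapses the terms with
    \<open>h\<close>.\<close>
  have hn: "h * (2 + yy i0 p) / 4 = h * real CARD('n) / 2" "h * (cyl i0 p \<bullet> V p) = h * (sqrt 2 * nc i0 V i0 p)"
      "real CARD('n) / 2 * h\<^sup>2 - h\<^sup>2 * (2 + yy i0 p) / 2 = - h\<^sup>2 / 2"
    using h_cases one_dimensional by (auto simp: cyl_inner)
  \<comment> \<open>Criticality of the cylinder: the integrand of the first variation is a weighted
    divergence plus a first Fourier mode, and both integrate to zero.\<close>
  have e1: "E1 0 p = (\<Sum>k\<in>UNIV. del i0 k (tc i0 V k) p) + \<zeta> p / sqrt 2"
  proof -
    have "E1 0 p = - (h * real CARD('n) / 2) - (cyl i0 p \<bullet> V p) / 2 + sqrt 2 / 2 * \<zeta> p + h * (2 + yy i0 p) / 4 + (\<Sum>k\<in>UNIV. m k k p)"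
    proof -
      have r: "G1 0 p / (2 * G 0 p) = (\<Sum>k\<in>UNIV. m k k p)"
        using log_det_derivatives(1)[of p] unfolding mm by (simp only: divide_divide_eq_left[symmetric] mult.commute[of 2])
      show ?thesis unfolding E1_def ph0 ph10 r by (simp add: field_simps)
    qed
    then show ?thesis
      using trace_frame[OF smooth_V(1), of p] unfolding mm s2 hn(1) by simp
  qed
  have zn: "(V p - z) \<bullet> (V p - z) = (nc i0 V i0 p - \<zeta> p)\<^sup>2 + (tc i0 V i0 p - \<zeta>' p)\<^sup>2
      + (\<Sum>j\<in>UNIV - {i0}. (tc i0 V j p)\<^sup>2 + (nc i0 V j p - (- Im (z $ j)))\<^sup>2)"
  proof -
    have c: "(V p - z) $ k \<bullet> (V p - z) $ k = (tc i0 V k p - z $ k \<bullet> eps i0 k p)\<^sup>2 + (nc i0 V k p - z $ k \<bullet> nu i0 k p)\<^sup>2" for k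
      by (subst norm_frame[of _ i0 k p]) (simp add: tc_def nc_def inner_diff_left)
    have zi: "z $ i0 \<bullet> eps i0 i0 p = \<zeta>' p" "z $ i0 \<bullet> nu i0 i0 p = \<zeta> p"
      by (auto simp: eps_def nu_def inner_complex_def \<zeta>_def \<zeta>'_def)
    have zj: "z $ j \<bullet> eps i0 j p = 0" "z $ j \<bullet> nu i0 j p = - Im (z $ j)" if "j \<noteq> i0" for j
      using that z_normal[OF that] by (auto simp: eps_def nu_def inner_complex_def)
    have "(V p - z) \<bullet> (V p - z) = (V p - z) $ i0 \<bullet> (V p - z) $ i0 + (\<Sum>j\<in>UNIV - {i0}. (V p - z) $ j \<bullet> (V p - z) $ j)"
      unfolding inner_vec_def by (simp add: sum.remove[of UNIV i0])
    also have "(\<Sum>j\<in>UNIV - {i0}. (V p - z) $ j \<bullet> (V p - z) $ j) = (\<Sum>j\<in>UNIV - {i0}. (tc i0 V j p)\<^sup>2 + (nc i0 V j p - (- Im (z $ j)))\<^sup>2)"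
      by (intro sum.cong refl) (auto simp: c zj simp del: vector_minus_component)
    finally show ?thesis by (simp add: c zi del: vector_minus_component)
  qed
  have "E2 0 p = (real CARD('n) / 2 * h\<^sup>2 - h\<^sup>2 * (2 + yy i0 p) / 2) - ((V p - z) \<bullet> (V p - z)) / 2
      + (h * (cyl i0 p \<bullet> V p) - h * (sqrt 2 * \<zeta> p))
      + ((\<Sum>k\<in>UNIV. lam i0 k * (pd k W p $ k \<bullet> eps i0 k p)) - (cyl i0 p \<bullet> W p) / 2)
      + (\<Sum>k\<in>UNIV. \<Sum>l\<in>UNIV. (q k l p)\<^sup>2) - (\<Sum>k\<in>UNIV. \<Sum>l\<in>UNIV. m k l p * m l k p)"
    unfolding E2_def ph0 ph10 ph20 log_det_derivatives(2)[of p, unfolded mm] by (simp add: field_simps)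
  also have "\<dots> = - h\<^sup>2 / 2 - ((V p - z) \<bullet> (V p - z)) / 2 + h * sqrt 2 * (nc i0 V i0 p - \<zeta> p)
      + (\<Sum>k\<in>UNIV. del i0 k (tc i0 W k) p)
      + (\<Sum>k\<in>UNIV. \<Sum>l\<in>UNIV. (q k l p)\<^sup>2) - (\<Sum>k\<in>UNIV. \<Sum>l\<in>UNIV. m k l p * m l k p)"
    unfolding hn trace_frame[OF smooth_V(2)] by (simp add: algebra_simps)
  finally show ?thesis unfolding e1 zn by simp
qed

end

text \<open>The angular derivative of the periodic function \<open>v\<close> integrates to zero over
  each circle, so the angular mean of \<open>u\<close> does not change along coordinate
  \<open>j\<close>. Far out along that coordinate it is zero.\<close>

lemma radial_mean_zero:
  fixes i0 :: "'n::finite"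
  assumes u: "csmooth i0 u" and v: "csmooth i0 v" and j: "j \<noteq> i0"
    and closed: "\<And>p. pd j u p = d * pd i0 v p"
  shows "avg i0 i0 u p = 0"
proof -
  have z: "avg i0 i0 (pd j u) p = 0" for p
  proof -
    note pv = csmooth_pdp[OF v, of i0]
    obtain C where C: "\<And>p. \<bar>pd i0 v p\<bar> \<le> C" using pdpD(2)[OF pv] by (auto simp: bddm_def)
    have "(\<integral>t. pd i0 v (upd p i0 t) \<partial>circ) = 0"
      using periodic_slice[OF csmoothD(2)[OF v], of p 0] C
      by (intro circ_integral_deriv_periodic[OF pdpD(3)[OF pv] bddmD[OF bddm_slice[OF pdpD(2)[OF pv]]], where C = C]) auto
    then show ?thesis by (simp add: avg_def marg_def closed)
  qed
  obtain B where B: "\<And>p. far i0 B p \<Longrightarrow> u p = 0" using u by (auto simp: csmooth_def)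
  have "pdp j (avg i0 i0 u) (avg i0 i0 (pd j u))"
    using csmooth_pdp[OF u, of j] j by (intro pdp_avg) auto
  then have "((\<lambda>t. avg i0 i0 u (upd p j t)) has_real_derivative 0) (at t)" for t
    using pdpD(3)[of j "avg i0 i0 u" "avg i0 i0 (pd j u)" p t] z by simp
  then have "avg i0 i0 u (upd p j (p $ j)) = avg i0 i0 u (upd p j (\<bar>B\<bar> + 1))"
    by (intro DERIV_isconst_all) simp
  also have "\<dots> = 0"
  proof -
    have "far i0 B (upd (upd p j (\<bar>B\<bar> + 1)) i0 t)" for t
      using j by (auto simp: far_def upd_nth intro!: exI[of _ j])
    then show ?thesis by (simp add: avg_def B)
  qed
  finally show ?thesis by simp
qed

lemma lagrangian_F_stable_cyl: "lagrangian_F_stable (i0 :: 'n::finite)"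
  unfolding lagrangian_F_stable_def F_stable_wrt_def
proof (intro allI impI)
  fix Fv :: "real \<Rightarrow> real^'n \<Rightarrow> complex^'n"
  assume "cyl_variation i0 Fv \<and> lagrangian_variation i0 Fv"
  then have var: "cyl_variation i0 Fv" and lag: "lagrangian_variation i0 Fv" by auto
  define N where "N = nc i0 (var_field Fv)"
  have csN: "csmooth i0 (N k)" for k
  proof -
    \<comment> \<open>The velocities will be defined through \<open>N\<close>, so the regularity of
      \<open>N\<close> is obtained beforehand with zero velocities; the variation field does not
      depend on them.\<close>
    interpret variation i0 Fv 0 0 by standard (simp_all add: var)
    show ?thesis using csmooth_V(2)[of k] by (simp add: N_def V_var_field)
  qed
  define c where "c = avg i0 i0 (N i0) 0"
  have c: "(\<forall>p. avg i0 i0 (N i0) p = c) \<and> (c = 0 \<or> UNIV = {i0})"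
  proof (cases "UNIV = {i0}")
    case True
    have "avg i0 i0 (N i0) p = c" for p
      unfolding c_def
    proof (rule invariant_imp_eq[of UNIV])
      fix k :: 'n and p t
      have "k = i0" using True by blast
      then show "avg i0 i0 (N i0) (upd p k t) = avg i0 i0 (N i0) p" by simp
    qed simp_all
    then show ?thesis using True by blast
  next
    case False
    then obtain j where j: "j \<noteq> i0" by auto
    \<comment> \<open>The factor reflects the lengths of the coordinate vectors: sqrt 2 in the
      angle, 1 in the flat directions.\<close>
    have "pd j (N i0) p = 1 / sqrt 2 * pd i0 (N j) p" for p
    proof -
      have vf: "var_form i0 Fv k = (\<lambda>p. (1 / lam i0 k) * N k p)" for k
        by (auto simp: var_form_eq N_def)
      have dc: "pd i (\<lambda>p. (1 / lam i0 k) * N k p) p = (1 / lam i0 k) * pd i (N k) p" for i k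
        unfolding pd_eq_dd by (rule dd_compose_linear[OF bounded_linear_mult_right csmoothD(1)[OF csN]])
      have "(1 / lam i0 i0) * pd j (N i0) p = (1 / lam i0 j) * pd i0 (N j) p"
        unfolding dc[symmetric] using lag unfolding lagrangian_variation_def vf by blast
      then show ?thesis using j by (simp add: lam_def field_simps)
    qed
    then have "avg i0 i0 (N i0) p = 0" for p
      by (rule radial_mean_zero[OF csN csN j])
    then show ?thesis by (simp add: c_def)
  qed
  \<comment> \<open>\<open>h\<close>, \<open>a\<close>, \<open>b\<close> and \<open>w\<close>
    maximise the part of the second variation that depends on the velocities. The sign of
    \<open>w\<close> in \<open>z\<close> comes from the flat normal vector being minus the imaginary
    unit.\<close>
  define h where "h = sqrt 2 * c"
  define a where "a = 2 * (\<integral>p. N i0 p * cos (p $ i0) \<partial>cmeas i0)"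
  define b where "b = 2 * (\<integral>p. N i0 p * sin (p $ i0) \<partial>cmeas i0)"
  define w where "w = (\<lambda>j. \<integral>p. N j p \<partial>cmeas i0)"
  define z :: "complex^'n" where "z = (\<chi> j. if j = i0 then Complex a b else Complex 0 (- w j))"
  interpret variation i0 Fv z h
    by standard (use var c in \<open>auto simp: z_def h_def\<close>)
  have za: "Re (z $ i0) = a" "Im (z $ i0) = b" and zw: "\<And>j. j \<noteq> i0 \<Longrightarrow> - Im (z $ j) = w j"
    by (auto simp: z_def)
  have NV: "nc i0 V = N" by (simp add: N_def V_var_field)
  have nonneg: "0 \<le> (\<integral>p. (E1 0 p)\<^sup>2 + E2 0 p \<partial>cmeas i0)"
  proof (rule second_variation_nonneg[where T = "tc i0 V" and N = N and W = "tc i0 W" and c = c and h = h and w = w and a = a and b = b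
      and z = "\<lambda>p. a * cos (p $ i0) + b * sin (p $ i0)" and z' = "\<lambda>p. b * cos (p $ i0) - a * sin (p $ i0)"
      and M = "\<lambda>k l p. Dk i0 k (tc i0 V l) p + (if k = i0 \<and> l = i0 then N i0 p / sqrt 2 else 0)"
      and P = "\<lambda>k l p. Dk i0 k (N l) p - (if k = i0 \<and> l = i0 then tc i0 V i0 p / sqrt 2 else 0)"])
    show "(E1 0 p)\<^sup>2 + E2 0 p = ((\<Sum>k\<in>UNIV. del i0 k (tc i0 V k) p) + (a * cos (p $ i0) + b * sin (p $ i0)) / sqrt 2)\<^sup>2
        - ((N i0 p - (a * cos (p $ i0) + b * sin (p $ i0)))\<^sup>2 + (tc i0 V i0 p - (b * cos (p $ i0) - a * sin (p $ i0)))\<^sup>2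
          + (\<Sum>j\<in>UNIV - {i0}. (tc i0 V j p)\<^sup>2 + (N j p - w j)\<^sup>2)) / 2
        + h * sqrt 2 * (N i0 p - (a * cos (p $ i0) + b * sin (p $ i0))) - h\<^sup>2 / 2
        + (\<Sum>k\<in>UNIV. \<Sum>l\<in>UNIV. (Dk i0 k (N l) p - (if k = i0 \<and> l = i0 then tc i0 V i0 p / sqrt 2 else 0))\<^sup>2)
        - (\<Sum>k\<in>UNIV. \<Sum>l\<in>UNIV. (Dk i0 k (tc i0 V l) p + (if k = i0 \<and> l = i0 then N i0 p / sqrt 2 else 0))
            * (Dk i0 l (tc i0 V k) p + (if l = i0 \<and> k = i0 then N i0 p / sqrt 2 else 0)))
        + (\<Sum>k\<in>UNIV. del i0 k (tc i0 W k) p)" for p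
    proof -
      have "(\<Sum>j\<in>UNIV - {i0}. (tc i0 V j p)\<^sup>2 + (N j p - w j)\<^sup>2) = (\<Sum>j\<in>UNIV - {i0}. (tc i0 V j p)\<^sup>2 + (N j p - (- Im (z $ j)))\<^sup>2)"
        by (intro sum.cong refl) (simp add: zw)
      then show ?thesis using integrand_eq[of p] unfolding za NV by simp
    qed
  qed (use c csN csmooth_V in \<open>auto simp: h_def w_def a_def b_def\<close>)
  obtain D1 k where k: "k > 0"
    and 1: "\<forall>\<^sub>F s in nhds 0. ((\<lambda>r. Ffun i0 (r *\<^sub>R z) (1 + h * r) (Fv r)) has_real_derivative D1 s) (at s)"
    and 2: "(D1 has_real_derivative k * (\<integral>p. (E1 0 p)\<^sup>2 + E2 0 p \<partial>cmeas i0)) (at 0)"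
    using second_derivative by blast
  have "smooth (\<lambda>s :: real. s *\<^sub>R z)" by (rule smooth_bounded_linear[OF bounded_linear_scaleR_left])
  moreover have "smooth (\<lambda>s :: real. 1 + h * s)"
    by (intro smooth_add smooth_const smooth_bounded_linear[OF bounded_linear_mult_right])
  ultimately show "\<exists>(xs :: real \<Rightarrow> complex^'n) (ts :: real \<Rightarrow> real) D1 D2.
      smooth xs \<and> smooth ts \<and> xs 0 = 0 \<and> ts 0 = 1 \<and>
      (\<forall>\<^sub>F s in nhds 0. ((\<lambda>r. Ffun i0 (xs r) (ts r) (Fv r)) has_real_derivative D1 s) (at s)) \<and>
      (D1 has_real_derivative D2) (at 0) \<and> D2 \<ge> 0"
    using 1 2 nonneg k
    by (intro exI[of _ "\<lambda>s. s *\<^sub>R z"] exI[of _ "\<lambda>s. 1 + h * s"] exI[of _ D1] exI[of _ "k * (\<integral>p. (E1 0 p)\<^sup>2 + E2 0 p \<partial>cmeas i0)"])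
      (simp add: mult_nonneg_nonneg less_imp_le)
qed

text \<open>Exact forms are closed, because the mixed derivatives of the potential commute.\<close>

lemma hamiltonian_imp_lagrangian:
  assumes "hamiltonian_variation i0 Fv"
  shows "lagrangian_variation i0 Fv"
proof -
  obtain f where f: "smooth f" "\<And>j. pd j f = var_form i0 Fv j"
    using assms unfolding hamiltonian_variation_def by blast
  have "pd i (pd j f) p = pd j (pd i f) p" for i j p
    unfolding pd_eq_dd by (rule dd_commute_real[OF f(1)])
  then show ?thesis unfolding lagrangian_variation_def f(2) by blast
qed

lemma hamiltonian_F_stable_cyl: "hamiltonian_F_stable i0"
  using lagrangian_F_stable_cyl[of i0] hamiltonian_imp_lagrangian
  unfolding hamiltonian_F_stable_def lagrangian_F_stable_def F_stable_wrt_def by blast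

theorem theorem4p1:
  fixes i0 :: "'n::finite"
  shows "lagrangian (cyl i0) \<and> self_shrinker (cyl i0) \<and>
         lagrangian_F_stable i0 \<and> hamiltonian_F_stable i0"
  using lagrangian_cyl self_shrinker_cyl lagrangian_F_stable_cyl hamiltonian_F_stable_cyl by blast

end
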